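(* For any given $T>0$ there exists an open dense set $\mathcal F\subset\mathcal C^3_0(\mathbb R^2;\mathbb R^2)$ such that, for every vector field $\mathbf w\in\mathcal F$, the following holds. (i) The set $$\mathcal S_1=\big\{(t,x)\in[0,T[\,\times\mathbb R^2\,;\ \operatorname{rank}(I+tD_x\mathbf w(x))=1\big\}$$ is an embedded manifold of dimension $2$. (ii) There are at most finitely many points $(\tau_k,y_k)\in\mathcal S_1$, $k=1,\ldots,N$, where this manifold is perpendicular to the $t$-axis. (iii) Let $\tau=\tau(x)$ be the function implicitly defined by $(\tau(x),x)\in\mathcal S_1$ in a neighborhood of such points. Then the Hessian matrix of second order partial derivatives $$H=\begin{pmatrix}\tau_{x_1x_1}&\tau_{x_1x_2}\\ \tau_{x_2x_1}&\tau_{x_2x_2}\end{pmatrix}$$ has rank $2$ at each point $y_k$, $k=1,\ldots,N$. (iv) At each point $(\tau_k,y_k)$, $k=1,\ldots,N$, the matrix $I+\tau_kD_x\mathbf w(y_k)$ has a nonzero eigenvalue.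
   Context: $\mathcal C^3(\mathbb R^2;\mathbb R^2)$ is the Banach space of three times continuously differentiable vector fields $\mathbf w=(w_1,w_2):\mathbb R^2\to\mathbb R^2$ with finite norm $$\|\mathbf w\|_{\mathcal C^3}=\sup_{x\in\mathbb R^2}\ \sup_{|\alpha|\le 3,\ i=1,2}|D^\alpha w_i(x)|<+\infty .$$ $\mathcal C^3_0(\mathbb R^2;\mathbb R^2)$ is the closed subspace of those $\mathbf w\in\mathcal C^3(\mathbb R^2;\mathbb R^2)$ whose Jacobian matrix satisfies $\lim_{|x|\to+\infty}D\mathbf w(x)=\mathbf 0$, with the topology of the $\mathcal C^3$ norm; "open" and "dense" refer to this topology. $D_x\mathbf w(x)$ is the $2\times2$ Jacobian matrix of $\mathbf w$ at $x$, $I$ is the $2\times 2$ identity matrix, and $[0,T[$ is the half-open interval. "Embedded manifold of dimension $2$" means a $\mathcal C^2$ embedded $2$-dimensional submanifold of the space $\mathbb R\times\mathbb R^2$ of points $(t,x)$ (possibly empty). It is perpendicular to the $t$-axis at a point if its tangent plane there is $\{0\}\times\mathbb R^2$; near such a point it is the graph $t=\tau(x)$ of a $\mathcal C^2$ function. *)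

theory Defs
  imports "HOL-Analysis.Analysis"
begin

definition dir_deriv :: "'a::real_normed_vector \<Rightarrow> ('a \<Rightarrow> 'b::real_normed_vector) \<Rightarrow> 'a \<Rightarrow> 'b" where
  "dir_deriv v f = (\<lambda>x. frechet_derivative f (at x) v)"

text \<open>\<open>Ck_on k f U\<close> is intended for open sets \<open>U\<close> only: the derivatives are
  taken with respect to the whole space and not relative to \<open>U\<close>.\<close>

fun Ck_on :: "nat \<Rightarrow> ('a::euclidean_space \<Rightarrow> 'b::real_normed_vector) \<Rightarrow> 'a set \<Rightarrow> bool" where
  "Ck_on 0 f U \<longleftrightarrow> continuous_on U f"
| "Ck_on (Suc k) f U \<longleftrightarrow>
     (\<forall>x\<in>U. f differentiable (at x)) \<and> (\<forall>b\<in>Basis. Ck_on k (dir_deriv b f) U)"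

definition partial :: "'n::finite \<Rightarrow> (real^'n \<Rightarrow> 'b::real_normed_vector) \<Rightarrow> real^'n \<Rightarrow> 'b" where
  "partial i = dir_deriv (axis i 1)"

definition multi_deriv :: "nat^2 \<Rightarrow> (real^2 \<Rightarrow> real) \<Rightarrow> real^2 \<Rightarrow> real" where
  "multi_deriv \<alpha> f = (partial 1 ^^ (\<alpha> $ 1)) ((partial 2 ^^ (\<alpha> $ 2)) f)"

definition C3_values :: "(real^2 \<Rightarrow> real^2) \<Rightarrow> real set" where
  "C3_values w = {\<bar>multi_deriv \<alpha> (\<lambda>y. w y $ i) x\<bar> | x \<alpha> i. \<alpha> $ 1 + \<alpha> $ 2 \<le> 3}"

definition C3_norm :: "(real^2 \<Rightarrow> real^2) \<Rightarrow> real" where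
  "C3_norm w = Sup (C3_values w)"

text \<open>Boundedness is required separately because \<open>Sup\<close> on \<^typ>\<open>real\<close> carries no
  information about sets that are unbounded above.\<close>

definition C3 :: "(real^2 \<Rightarrow> real^2) set" where
  "C3 = {w. Ck_on 3 w UNIV \<and> bdd_above (C3_values w)}"

definition C3_0 :: "(real^2 \<Rightarrow> real^2) set" where
  "C3_0 = {w \<in> C3. ((\<lambda>x. jacobian w (at x)) \<longlongrightarrow> 0) at_infinity}"

text \<open>The locale \<^locale>\<open>Metric_space\<close> demands symmetry and nonnegativity off the carrier
  as well, whence the case distinction.\<close>

definition C3_dist :: "(real^2 \<Rightarrow> real^2) \<Rightarrow> (real^2 \<Rightarrow> real^2) \<Rightarrow> real" where
  "C3_dist v w = (if v \<in> C3 \<and> w \<in> C3 then C3_norm (\<lambda>x. v x - w x) else 0)"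

definition C3_0_topology :: "(real^2 \<Rightarrow> real^2) topology" where
  "C3_0_topology = Metric_space.mtopology C3_0 C3_dist"

text \<open>Every point of \<open>S\<close> has a neighbourhood in which a \<open>C\<^sup>k\<close> change of
  coordinates of the ambient space straightens \<open>S\<close> to a linear subspace of dimension \<open>d\<close>.
  The empty set qualifies.\<close>

definition embedded_submanifold :: "nat \<Rightarrow> nat \<Rightarrow> 'a::euclidean_space set \<Rightarrow> bool" where
  "embedded_submanifold k d S \<longleftrightarrow>
     (\<forall>p\<in>S. \<exists>U V \<phi> \<psi> (L::'a set). open U \<and> open V \<and> p \<in> U
        \<and> homeomorphism U V \<phi> \<psi> \<and> Ck_on k \<phi> U \<and> Ck_on k \<psi> V
        \<and> subspace L \<and> dim L = d \<and> \<phi> ` (S \<inter> U) = L \<inter> V)"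

text \<open>Velocities of \<open>C\<^sup>1\<close> curves in \<open>S\<close> through \<open>p\<close>.\<close>

definition tangent_space :: "'a::euclidean_space set \<Rightarrow> 'a \<Rightarrow> 'a set" where
  "tangent_space S p =
     {v. \<exists>\<gamma> e. e > 0 \<and> Ck_on 1 \<gamma> {-e<..<e::real} \<and> \<gamma> ` {-e<..<e} \<subseteq> S
        \<and> \<gamma> 0 = p \<and> (\<gamma> has_vector_derivative v) (at 0)}"

definition perpendicular_to_t_axis :: "(real \<times> (real^2)) set \<Rightarrow> real \<times> (real^2) \<Rightarrow> bool" where
  "perpendicular_to_t_axis S p \<longleftrightarrow> tangent_space S p = {0} \<times> UNIV"

text \<open>Near \<open>p\<close>, the set \<open>S\<close> is the graph \<open>t = \<tau>(x)\<close> of a \<open>C\<^sup>2\<close> function defined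
  near \<open>snd p\<close>. If \<open>p \<in> S\<close>, this determines the germ of \<open>\<tau>\<close> at \<open>snd p\<close>.\<close>

definition local_graph_at :: "(real \<times> (real^2)) set \<Rightarrow> real \<times> (real^2) \<Rightarrow> (real^2 \<Rightarrow> real) \<Rightarrow> bool" where
  "local_graph_at S p \<tau> \<longleftrightarrow>
     (\<exists>W V. open W \<and> p \<in> W \<and> open V \<and> snd p \<in> V \<and> Ck_on 2 \<tau> V
        \<and> S \<inter> W = (\<lambda>x. (\<tau> x, x)) ` V)"

definition hessian :: "(real^'n::finite \<Rightarrow> real) \<Rightarrow> real^'n \<Rightarrow> real^'n^'n" where
  "hessian f x = (\<chi> i j. partial j (partial i f) x)"

definition eigenvalue :: "real^'n^'n \<Rightarrow> real \<Rightarrow> bool" where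
  "eigenvalue A c \<longleftrightarrow> (\<exists>v. v \<noteq> 0 \<and> A *v v = c *\<^sub>R v)"

definition flow_jacobian :: "(real^2 \<Rightarrow> real^2) \<Rightarrow> real \<times> (real^2) \<Rightarrow> real^2^2" where
  "flow_jacobian w p = mat 1 + fst p *\<^sub>R jacobian w (at (snd p))"

definition S1 :: "real \<Rightarrow> (real^2 \<Rightarrow> real^2) \<Rightarrow> (real \<times> (real^2)) set" where
  "S1 T w = {p \<in> {0..<T} \<times> UNIV. rank (flow_jacobian w p) = 1}"


text \<open>The remainder shows that \<^const>\<open>C3_dist\<close> is a metric on \<^const>\<open>C3_0\<close>, so that
  \<^const>\<open>C3_0_topology\<close> is the topology of the \<open>C\<^sup>3\<close> norm.\<close>

lemma dir_deriv_diff: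
  assumes "\<forall>x. f differentiable (at x)" "\<forall>x. g differentiable (at x)"
  shows "dir_deriv b (\<lambda>x. f x - g x) = (\<lambda>x. dir_deriv b f x - dir_deriv b g x)"
proof
  fix x
  have "((\<lambda>x. f x - g x) has_derivative
      (\<lambda>h. frechet_derivative f (at x) h - frechet_derivative g (at x) h)) (at x)"
    using assms by (intro has_derivative_diff) (auto simp: frechet_derivative_works[symmetric])
  from frechet_derivative_at[OF this, symmetric]
  show "dir_deriv b (\<lambda>x. f x - g x) x = dir_deriv b f x - dir_deriv b g x"
    by (simp add: dir_deriv_def fun_eq_iff)
qed

lemma dir_deriv_nth:
  fixes f :: "'a::euclidean_space \<Rightarrow> real^'n"
  assumes "\<forall>x. f differentiable (at x)"
  shows "dir_deriv b (\<lambda>x. f x $ i) = (\<lambda>x. dir_deriv b f x $ i)"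
proof
  fix x
  have "((\<lambda>x. f x $ i) has_derivative (\<lambda>h. frechet_derivative f (at x) h $ i)) (at x)"
    using assms
    by (intro bounded_linear.has_derivative[OF bounded_linear_vec_nth])
      (simp add: frechet_derivative_works[symmetric])
  from frechet_derivative_at[OF this, symmetric]
  show "dir_deriv b (\<lambda>x. f x $ i) x = dir_deriv b f x $ i"
    by (simp add: dir_deriv_def fun_eq_iff)
qed

lemma Ck_on_diff:
  "Ck_on k f UNIV \<Longrightarrow> Ck_on k g UNIV \<Longrightarrow> Ck_on k (\<lambda>x. f x - g x) UNIV"
  by (induction k arbitrary: f g) (auto simp: dir_deriv_diff intro: continuous_on_diff)

lemma Ck_on_nth:
  fixes f :: "'a::euclidean_space \<Rightarrow> real^'n"
  shows "Ck_on k f UNIV \<Longrightarrow> Ck_on k (\<lambda>x. f x $ i) UNIV"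
proof (induction k arbitrary: f)
  case (Suc k)
  then have "\<forall>x. f differentiable (at x)" by simp
  moreover from this have "(\<lambda>x. f x $ i) differentiable (at x)" for x
    unfolding differentiable_def
    using bounded_linear.has_derivative[OF bounded_linear_vec_nth] by blast
  ultimately show ?case using Suc by (auto simp: dir_deriv_nth)
qed (auto intro: continuous_intros)

lemma Ck_on_partial: "Ck_on (Suc k) f UNIV \<Longrightarrow> Ck_on k (partial i f) UNIV"
  by (simp add: partial_def axis_in_Basis_iff)

lemma Ck_on_partial_funpow:
  "Ck_on (m + k) f UNIV \<Longrightarrow> Ck_on k ((partial i ^^ m) f) UNIV"
  by (induction m arbitrary: k) (auto simp del: Ck_on.simps intro!: Ck_on_partial)

lemma partial_funpow_diff:
  assumes "Ck_on m f UNIV" "Ck_on m g UNIV"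
  shows "(partial i ^^ m) (\<lambda>x. f x - g x)
    = (\<lambda>x. (partial i ^^ m) f x - (partial i ^^ m) g x)"
  using assms
proof (induction m arbitrary: f g)
  case (Suc m)
  have "partial i (\<lambda>x. f x - g x) = (\<lambda>x. partial i f x - partial i g x)"
    using Suc.prems by (simp add: partial_def dir_deriv_diff)
  with Suc.IH[OF Ck_on_partial[OF Suc.prems(1)] Ck_on_partial[OF Suc.prems(2)], of i i]
  show ?case by (simp add: funpow_Suc_right del: funpow.simps)
qed simp

lemma Ck_on_mono: "Ck_on k f UNIV \<Longrightarrow> j \<le> k \<Longrightarrow> Ck_on j f UNIV"
proof (induction k arbitrary: j f)
  case (Suc k)
  show ?case
  proof (cases j)
    case 0
    then show ?thesis using Suc.prems
      by (auto intro!: continuous_at_imp_continuous_on differentiable_imp_continuous_within)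
  next
    case (Suc j')
    then show ?thesis using Suc.prems Suc.IH by auto
  qed
qed simp

lemma multi_deriv_diff:
  assumes "Ck_on 3 v UNIV" "Ck_on 3 w UNIV" "\<alpha> $ 1 + \<alpha> $ 2 \<le> 3"
  shows "multi_deriv \<alpha> (\<lambda>y. (v y - w y) $ i) x
    = multi_deriv \<alpha> (\<lambda>y. v y $ i) x - multi_deriv \<alpha> (\<lambda>y. w y $ i) x"
proof -
  have 1: "Ck_on (\<alpha> $ 2 + \<alpha> $ 1) (\<lambda>y. v y $ i) UNIV" "Ck_on (\<alpha> $ 2 + \<alpha> $ 1) (\<lambda>y. w y $ i) UNIV"
    using Ck_on_mono[OF Ck_on_nth[OF assms(1)]] Ck_on_mono[OF Ck_on_nth[OF assms(2)]] assms(3)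
    by (auto simp: add.commute)
  have 2: "Ck_on (\<alpha> $ 2) (\<lambda>y. v y $ i) UNIV" "Ck_on (\<alpha> $ 2) (\<lambda>y. w y $ i) UNIV"
    using Ck_on_mono[OF 1(1)] Ck_on_mono[OF 1(2)] by auto
  show ?thesis
    using partial_funpow_diff[OF Ck_on_partial_funpow[OF 1(1)] Ck_on_partial_funpow[OF 1(2)]]
      partial_funpow_diff[OF 2]
    by (simp add: multi_deriv_def)
qed

lemma C3_values_le: "x \<in> C3_values w \<Longrightarrow> bdd_above (C3_values w) \<Longrightarrow> x \<le> C3_norm w"
  unfolding C3_norm_def by (rule cSup_upper)

lemma C3_values_zeroth: "\<bar>w x $ i\<bar> \<in> C3_values w"
proof -
  have "multi_deriv 0 (\<lambda>y. w y $ i) x = w x $ i" by (simp add: multi_deriv_def)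
  moreover have "(0::nat^2) $ 1 + (0::nat^2) $ 2 \<le> 3" by simp
  ultimately show ?thesis unfolding C3_values_def mem_Collect_eq
    by (intro exI[of _ x] exI[of _ "0::nat^2"] exI[of _ i]) simp
qed

lemma C3_values_diffE:
  assumes "v \<in> C3" "w \<in> C3" "r \<in> C3_values (\<lambda>x. v x - w x)"
  obtains s t where "\<bar>s\<bar> \<in> C3_values v" "\<bar>t\<bar> \<in> C3_values w" "r = \<bar>s - t\<bar>"
proof -
  from assms(3) obtain x \<alpha> i
    where 1: "r = \<bar>multi_deriv \<alpha> (\<lambda>y. (v y - w y) $ i) x\<bar>" "\<alpha> $ 1 + \<alpha> $ 2 \<le> 3"
    unfolding C3_values_def by blast
  have "r = \<bar>multi_deriv \<alpha> (\<lambda>y. v y $ i) x - multi_deriv \<alpha> (\<lambda>y. w y $ i) x\<bar>"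
    using 1 assms multi_deriv_diff[of v w \<alpha> i x] unfolding C3_def by simp
  with 1(2) show ?thesis
    using that unfolding C3_values_def by blast
qed

lemma C3_diff:
  assumes "v \<in> C3" "w \<in> C3"
  shows "(\<lambda>x. v x - w x) \<in> C3" "C3_norm (\<lambda>x. v x - w x) \<le> C3_norm v + C3_norm w"
proof -
  have le: "r \<le> C3_norm v + C3_norm w" if r: "r \<in> C3_values (\<lambda>x. v x - w x)" for r
  proof -
    obtain s t where "\<bar>s\<bar> \<in> C3_values v" "\<bar>t\<bar> \<in> C3_values w" "r = \<bar>s - t\<bar>"
      by (rule C3_values_diffE[OF assms r])
    moreover from this have "\<bar>s\<bar> \<le> C3_norm v" "\<bar>t\<bar> \<le> C3_norm w"
      using assms C3_values_le unfolding C3_def by auto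
    ultimately show ?thesis by linarith
  qed
  then have "bdd_above (C3_values (\<lambda>x. v x - w x))" by (rule bdd_aboveI)
  with assms show "(\<lambda>x. v x - w x) \<in> C3" by (simp add: C3_def Ck_on_diff)
  show "C3_norm (\<lambda>x. v x - w x) \<le> C3_norm v + C3_norm w"
    unfolding C3_norm_def[of "\<lambda>x. v x - w x"]
  proof (rule cSup_least)
    show "C3_values (\<lambda>x. v x - w x) \<noteq> {}"
      using C3_values_zeroth[of "\<lambda>x. v x - w x" 0 1] by blast
  qed (rule le)
qed

lemma C3_norm_eq_0: "w \<in> C3 \<Longrightarrow> C3_norm w = 0 \<longleftrightarrow> w = (\<lambda>x. 0)"
proof
  assume "w \<in> C3" "C3_norm w = 0"
  then have "\<bar>w x $ i\<bar> \<le> 0" for x i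
    using C3_values_le[OF C3_values_zeroth, of w x i] by (simp add: C3_def)
  then show "w = (\<lambda>x. 0)" by (auto simp: vec_eq_iff fun_eq_iff)
next
  assume w: "w = (\<lambda>x. 0)"
  have "(partial i ^^ m) (\<lambda>x::real^2. 0::real) = (\<lambda>x. 0)" for i m
    by (induction m) (auto simp: partial_def dir_deriv_def)
  then have "multi_deriv \<alpha> (\<lambda>x. 0) = (\<lambda>x. 0)" for \<alpha>
    by (simp add: multi_deriv_def)
  then have "C3_values w \<subseteq> {0}" using w by (auto simp: C3_values_def)
  moreover have "C3_values w \<noteq> {}"
    using C3_values_zeroth[of w 0 1] by blast
  ultimately have "C3_values w = {0}" by blast
  then show "C3_norm w = 0" by (simp add: C3_norm_def)
qed

lemma C3_norm_nonneg: "w \<in> C3 \<Longrightarrow> 0 \<le> C3_norm w"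
  using C3_values_le[OF C3_values_zeroth, of w 0 1] by (simp add: C3_def)

lemma zero_in_C3: "(\<lambda>x. 0) \<in> C3"
proof -
  have "Ck_on k (\<lambda>x::real^2. 0::real^2) UNIV" for k
    by (induction k) (auto simp: dir_deriv_def)
  moreover have "(partial i ^^ m) (\<lambda>x::real^2. 0::real) = (\<lambda>x. 0)" for i m
    by (induction m) (auto simp: partial_def dir_deriv_def)
  ultimately show ?thesis by (auto simp: C3_def C3_values_def multi_deriv_def)
qed

lemma C3_norm_minus_commute_le:
  assumes "v \<in> C3" "w \<in> C3"
  shows "C3_norm (\<lambda>x. v x - w x) \<le> C3_norm (\<lambda>x. w x - v x)"
proof -
  have "C3_norm (\<lambda>x. 0 - (w x - v x)) \<le> C3_norm (\<lambda>x. 0) + C3_norm (\<lambda>x. w x - v x)"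
    using C3_diff[OF zero_in_C3 C3_diff(1)[OF assms(2,1)]] by simp
  then show ?thesis using C3_norm_eq_0[OF zero_in_C3] by simp
qed

lemma Metric_space_C3: "Metric_space C3 C3_dist"
proof
  fix u v w :: "real^2 \<Rightarrow> real^2"
  show "0 \<le> C3_dist v w" by (simp add: C3_dist_def C3_norm_nonneg C3_diff)
  show "C3_dist v w = C3_dist w v"
    using C3_norm_minus_commute_le[of v w] C3_norm_minus_commute_le[of w v]
    by (auto simp: C3_dist_def)
  assume vw: "v \<in> C3" "w \<in> C3"
  show "C3_dist v w = 0 \<longleftrightarrow> v = w"
    using vw C3_norm_eq_0[OF C3_diff(1)[OF vw]] by (auto simp: C3_dist_def fun_eq_iff)
  assume u: "u \<in> C3"
  have "C3_norm (\<lambda>x. (u x - v x) - (w x - v x))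
      \<le> C3_norm (\<lambda>x. u x - v x) + C3_norm (\<lambda>x. w x - v x)"
    using u vw by (intro C3_diff)
  then have "C3_norm (\<lambda>x. u x - w x) \<le> C3_norm (\<lambda>x. u x - v x) + C3_norm (\<lambda>x. v x - w x)"
    using C3_norm_minus_commute_le[of w v] vw by simp
  then show "C3_dist u w \<le> C3_dist u v + C3_dist v w"
    using u vw by (simp add: C3_dist_def)
qed

lemma Metric_space_C3_0: "Metric_space C3_0 C3_dist"
  by (rule Metric_space.subspace[OF Metric_space_C3]) (auto simp: C3_0_def)

end

theory Submission
  imports Defs
begin

text \<open>Put \<open>G(t, x) = det (I + t Dw(x))\<close>. A point of \<open>[0, T] \<times> \<real>\<^sup>2\<close> is degenerate if
  \<open>G = 0\<close>, \<open>G\<^sub>x = 0\<close> and \<open>G\<^sub>t det G\<^sub>x\<^sub>x = 0\<close>. If there are no such points, then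
  \<open>I + t Dw\<close> never vanishes, \<open>\<S>\<^sub>1\<close> is the regular zero set of \<open>G\<close>, its tangent plane is
  perpendicular to the \<open>t\<close>-axis exactly where \<open>G\<^sub>x = 0\<close>, such points are isolated in a compact set
  because \<open>(G, G\<^sub>x)\<close> is a local diffeomorphism there, the Hessian of \<open>\<tau>\<close> is \<open>- G\<^sub>x\<^sub>x / G\<^sub>t\<close>,
  and \<open>t G\<^sub>t = - tr (I + t Dw)\<close>, so that the trace is a nonzero eigenvalue.

  Since \<open>Dw\<close> tends to zero at infinity, \<open>G\<close> has no zeros far away, and closed conditions on the
  \<open>3\<close>-jet are avoided by an open set of fields. For density, first make \<open>I + t Dw\<close> nonzero by
  adding a linear field on a large ball (a dimension count). The degenerate points are then split
  according to the entry of \<open>I + t Dw\<close> of largest modulus. Where a given entry is nonzero, add to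
  one component of \<open>w\<close> the polynomial
  \<open>l\<^sub>1 x\<^sub>i + l\<^sub>2 x\<^sub>j + q\<^sub>1 x\<^sub>i\<^sup>2 / 2 + q\<^sub>2 x\<^sub>i x\<^sub>j\<close>: the equations \<open>G = 0\<close>, \<open>G\<^sub>x = 0\<close> can be
  solved explicitly for the four parameters in terms of \<open>(t, x)\<close> and one further variable, and the
  parameters for which a degenerate point exists are critical values of this map of \<open>\<real>\<^sup>4\<close>,
  a null set by Sard.\<close>

section \<open>Calculus of \<open>C\<^sup>k\<close> maps\<close>

lemma dir_deriv_eqI: "(f has_derivative f') (at x) \<Longrightarrow> dir_deriv b f x = f' b"
  by (metis dir_deriv_def frechet_derivative_at)

lemma has_derivative_dir_deriv:
  "f differentiable (at x) \<Longrightarrow> (f has_derivative (\<lambda>h. dir_deriv h f x)) (at x)"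
  unfolding dir_deriv_def using frechet_derivative_works by blast

lemma Ck_on_SucI:
  assumes "open U" "\<And>x. x \<in> U \<Longrightarrow> (f has_derivative f' x) (at x)"
    and "\<And>b. b \<in> Basis \<Longrightarrow> Ck_on k (dir_deriv b f) U"
  shows "Ck_on (Suc k) f U"
  using assms by (auto simp: differentiable_def)

text \<open>Openness of \<open>U\<close> makes whole-space derivatives at points of \<open>U\<close>
  local. Both functions are generalised because the induction passes to their directional
  derivatives.\<close>

lemma Ck_on_cong:
  assumes "open U" "\<And>x. x \<in> U \<Longrightarrow> f x = g x"
  shows "Ck_on k f U \<longleftrightarrow> Ck_on k g U"
  using assms(2)
proof (induction k arbitrary: f g)
  case 0
  then show ?case by (simp cong: continuous_on_cong)
next
  case (Suc k)
  have der: "(f has_derivative D) (at x) \<longleftrightarrow> (g has_derivative D) (at x)" if "x \<in> U" for x D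
    using has_derivative_transform_within_open[OF _ assms(1) that] Suc.prems by metis
  have dd: "dir_deriv b f x = dir_deriv b g x" if "x \<in> U" for x b
    unfolding dir_deriv_def frechet_derivative_def using der[OF that] by simp
  have "f differentiable (at x) \<longleftrightarrow> g differentiable (at x)" if "x \<in> U" for x
    unfolding differentiable_def using der[OF that] by blast
  moreover have "Ck_on k (dir_deriv b f) U \<longleftrightarrow> Ck_on k (dir_deriv b g) U" for b
    using dd by (intro Suc.IH) auto
  ultimately show ?case by simp
qed

text \<open>The introduction rule for the calculus below: once a derivative formula is known, only
  the smoothness of that formula in each basis direction remains to be shown.\<close>

lemma Ck_on_cong_derivative:
  assumes "open U" "\<And>x. x \<in> U \<Longrightarrow> (f has_derivative f' x) (at x)"
    and "\<And>b. b \<in> Basis \<Longrightarrow> Ck_on k (\<lambda>x. f' x b) U"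
  shows "Ck_on (Suc k) f U"
proof (rule Ck_on_SucI[OF assms(1,2)])
  fix b :: 'a assume "b \<in> Basis"
  then show "Ck_on k (dir_deriv b f) U"
    using Ck_on_cong[OF assms(1), of "dir_deriv b f" "\<lambda>x. f' x b" k] dir_deriv_eqI[OF assms(2)] assms(3)
    by auto
qed

lemma Ck_on_subset: "Ck_on k f U \<Longrightarrow> V \<subseteq> U \<Longrightarrow> Ck_on k f V"
  by (induction k arbitrary: f) (auto intro: continuous_on_subset)

lemma Ck_on_Suc_imp:
  assumes "Ck_on (Suc k) f U"
  shows "Ck_on k f U"
  using assms
proof (induction k arbitrary: f)
  case 0
  then show ?case
    by (auto intro!: continuous_at_imp_continuous_on differentiable_imp_continuous_within)
qed simp

lemma Ck_on_le: "Ck_on k f U \<Longrightarrow> j \<le> k \<Longrightarrow> Ck_on j f U"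
  by (induction k) (auto simp: le_Suc_eq simp del: Ck_on.simps dest: Ck_on_Suc_imp)

lemma Ck_on_imp_continuous_on: "Ck_on k f U \<Longrightarrow> continuous_on U f"
  using Ck_on_le[of k f U 0] by simp

lemma Ck_on_const: "open U \<Longrightarrow> Ck_on k (\<lambda>x. c) U"
proof (induction k arbitrary: c)
  case (Suc k)
  then show ?case by (intro Ck_on_cong_derivative[where f'="\<lambda>x h. 0"]) auto
qed simp

lemma Ck_on_bounded_linear:
  assumes "open U" "bounded_linear f"
  shows "Ck_on k f U"
proof (cases k)
  case 0
  then show ?thesis using assms by (simp add: linear_continuous_on)
next
  case (Suc j)
  then show ?thesis
    using assms Ck_on_const by (auto simp del: Ck_on.simps
        intro!: Ck_on_cong_derivative[where f'="\<lambda>x. f"] bounded_linear_imp_has_derivative)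
qed

lemma Ck_on_add:
  assumes "open U" "Ck_on k f U" "Ck_on k g U"
  shows "Ck_on k (\<lambda>x. f x + g x) U"
  using assms(2,3)
proof (induction k arbitrary: f g)
  case (Suc k)
  then show ?case
    by (intro Ck_on_cong_derivative[OF assms(1), where f'="\<lambda>x h. dir_deriv h f x + dir_deriv h g x"])
      (auto intro!: has_derivative_add has_derivative_dir_deriv)
qed (simp add: continuous_on_add)

lemma Ck_on_sum:
  assumes "open U" "\<And>i. i \<in> I \<Longrightarrow> Ck_on k (f i) U"
  shows "Ck_on k (\<lambda>x. \<Sum>i\<in>I. f i x) U"
  using assms(2)
  by (induction I rule: infinite_finite_induct) (auto intro: Ck_on_const Ck_on_add assms(1))

lemma Ck_on_compose_bounded_linear:
  assumes "open U" "bounded_linear h" "Ck_on k f U"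
  shows "Ck_on k (\<lambda>x. h (f x)) U"
  using assms(3)
proof (induction k arbitrary: f)
  case 0
  then show ?case using assms(2) by (simp add: bounded_linear.continuous_on)
next
  case (Suc k)
  then show ?case
    by (intro Ck_on_cong_derivative[OF assms(1), where f'="\<lambda>x v. h (dir_deriv v f x)"])
      (auto intro!: bounded_linear.has_derivative[OF assms(2)] has_derivative_dir_deriv)
qed

text \<open>Leibniz rule: the derivative consists of two products of the same kind, so one induction
  serves all bilinear operations. The factors also occur undifferentiated, hence their order is
  first lowered to \<open>k\<close>.\<close>

lemma Ck_on_bilinear:
  assumes "open U" "bounded_bilinear pr" "Ck_on k f U" "Ck_on k g U"
  shows "Ck_on k (\<lambda>x. pr (f x) (g x)) U"
  using assms(3,4)
proof (induction k arbitrary: f g)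
  case 0
  then show ?case using bounded_bilinear.continuous_on[OF assms(2)] by auto
next
  case (Suc k)
  have "Ck_on k f U" "Ck_on k g U"
    using Suc.prems Ck_on_Suc_imp by blast+
  with Suc show ?case
    by (intro Ck_on_cong_derivative[OF assms(1),
          where f'="\<lambda>x h. pr (f x) (dir_deriv h g x) + pr (dir_deriv h f x) (g x)"])
      (auto intro!: bounded_bilinear.FDERIV[OF assms(2)] Ck_on_add assms(1) has_derivative_dir_deriv)
qed

lemmas Ck_on_mult = Ck_on_bilinear[OF _ bounded_bilinear_mult]
lemmas Ck_on_scaleR = Ck_on_bilinear[OF _ bounded_bilinear_scaleR]

lemma Ck_on_minus:
  fixes f :: "'a::euclidean_space \<Rightarrow> 'b::real_normed_vector"
  assumes "open U" "Ck_on k f U"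
  shows "Ck_on k (\<lambda>x. - f x) U"
  using Ck_on_compose_bounded_linear[OF assms(1) bounded_linear_minus[OF bounded_linear_ident] assms(2)]
  by simp

lemma Ck_on_sub:
  assumes "open U" "Ck_on k f U" "Ck_on k g U"
  shows "Ck_on k (\<lambda>x. f x - g x) U"
  using Ck_on_add[OF assms(1,2) Ck_on_minus[OF assms(1,3)]] by simp

text \<open>The derivative of the reciprocal contains only the reciprocal itself and the derivative
  of \<open>f\<close>, so the induction runs with \<open>f\<close> fixed.\<close>

lemma Ck_on_inverse:
  fixes f :: "'a::euclidean_space \<Rightarrow> real"
  assumes "open U" "Ck_on k f U" "\<And>x. x \<in> U \<Longrightarrow> f x \<noteq> 0"
  shows "Ck_on k (\<lambda>x. inverse (f x)) U"
  using assms(2)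
proof (induction k)
  case 0
  then show ?case using assms(3) by (simp add: continuous_on_inverse)
next
  case (Suc k)
  have "Ck_on k (\<lambda>x. inverse (f x)) U"
    using Suc Ck_on_Suc_imp by blast
  with Suc.prems show ?case using assms(3)
    by (intro Ck_on_cong_derivative[OF assms(1),
          where f'="\<lambda>x h. - (inverse (f x) * dir_deriv h f x * inverse (f x))"])
      (auto intro!: Ck_on_minus Ck_on_mult assms(1) Deriv.has_derivative_inverse has_derivative_dir_deriv)
qed

text \<open>In the chain rule the direction \<open>dir_deriv b g x\<close> varies with
  \<open>x\<close>. Expanding it in the basis leaves derivatives of \<open>f\<close> in fixed
  directions, to which the induction hypothesis applies, with scalar coefficients coming from
  \<open>g\<close>.\<close>

lemma Ck_on_compose:
  fixes f :: "'b::euclidean_space \<Rightarrow> 'c::real_normed_vector" and g :: "'a::euclidean_space \<Rightarrow> 'b"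
  assumes "open U" "open V" "g ` U \<subseteq> V" "Ck_on k g U" "Ck_on k f V"
  shows "Ck_on k (\<lambda>x. f (g x)) U"
  using assms(4,5)
proof (induction k arbitrary: f)
  case 0
  then show ?case using assms(3) by (auto intro: continuous_on_compose2)
next
  case (Suc k)
  have gk: "Ck_on k g U" using Suc.prems Ck_on_Suc_imp by blast
  have eq: "dir_deriv v f y = (\<Sum>c\<in>Basis. (v \<bullet> c) *\<^sub>R dir_deriv c f y)" if "y \<in> V" for y v
  proof -
    have lin: "linear (\<lambda>h. dir_deriv h f y)"
      using has_derivative_dir_deriv[of f y] Suc.prems(2) that has_derivative_linear by auto
    have "dir_deriv (\<Sum>c\<in>Basis. (v \<bullet> c) *\<^sub>R c) f y = (\<Sum>c\<in>Basis. (v \<bullet> c) *\<^sub>R dir_deriv c f y)"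
      using linear_sum[OF lin, of "\<lambda>c. (v \<bullet> c) *\<^sub>R c" Basis] linear_cmul[OF lin] by simp
    then show ?thesis by (simp add: euclidean_representation)
  qed
  have "Ck_on k (\<lambda>x. dir_deriv (dir_deriv b g x) f (g x)) U" if b: "b \<in> Basis" for b
  proof -
    have "Ck_on k (\<lambda>x. \<Sum>c\<in>Basis. (dir_deriv b g x \<bullet> c) *\<^sub>R dir_deriv c f (g x)) U"
      using Suc.prems Suc.IH[OF gk] b
      by (intro Ck_on_sum Ck_on_scaleR assms(1) Ck_on_compose_bounded_linear[OF _ bounded_linear_inner_left]) auto
    then show ?thesis
      using assms(3) by (subst Ck_on_cong[OF assms(1) eq]) auto
  qed
  moreover have "((\<lambda>x. f (g x)) has_derivative (\<lambda>h. dir_deriv (dir_deriv h g x) f (g x))) (at x)"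
    if "x \<in> U" for x
  proof -
    have "g x \<in> V" using that assms(3) by auto
    then show ?thesis
      using has_derivative_compose[OF has_derivative_dir_deriv[of g x] has_derivative_dir_deriv[of f "g x"]] Suc.prems that
      by auto
  qed
  ultimately show ?case
    by (intro Ck_on_cong_derivative[OF assms(1)]) auto
qed

section \<open>Symmetry of second derivatives\<close>

lemma has_real_derivative_along_line:
  fixes f :: "'a::euclidean_space \<Rightarrow> real"
  assumes "f differentiable (at (y + p *\<^sub>R a))"
  shows "((\<lambda>p. f (y + p *\<^sub>R a)) has_real_derivative dir_deriv a f (y + p *\<^sub>R a)) (at p)"
proof -
  have "((\<lambda>p. y + p *\<^sub>R a) has_derivative (\<lambda>h. h *\<^sub>R a)) (at p)"
    by (auto intro!: derivative_eq_intros)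
  from has_derivative_compose[OF this has_derivative_dir_deriv[OF assms]]
  have 1: "((\<lambda>p. f (y + p *\<^sub>R a)) has_derivative (\<lambda>h. dir_deriv (h *\<^sub>R a) f (y + p *\<^sub>R a))) (at p)" .
  have lin: "linear (\<lambda>h. dir_deriv h f (y + p *\<^sub>R a))"
    using has_derivative_dir_deriv[OF assms] has_derivative_linear by blast
  show ?thesis
    unfolding has_field_derivative_def
    by (rule has_derivative_eq_rhs[OF 1]) (simp add: fun_eq_iff linear_cmul[OF lin] mult.commute)
qed

text \<open>The mean value theorem is applied twice: along \<open>a\<close> to the increment of
  \<open>f\<close> by \<open>s *\<^sub>R b\<close>, and then along \<open>b\<close> to
  \<open>dir_deriv a f\<close>.\<close>

lemma second_difference_mean_value:
  fixes f :: "'a::euclidean_space \<Rightarrow> real"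
  assumes C2: "Ck_on 2 f UNIV" and a: "a \<in> Basis" and b: "b \<in> Basis" and s: "s > 0"
  obtains p q where "0 < p" "p < s" "0 < q" "q < s"
    "f (x + s *\<^sub>R a + s *\<^sub>R b) - f (x + s *\<^sub>R a) - f (x + s *\<^sub>R b) + f x
      = s\<^sup>2 * dir_deriv b (dir_deriv a f) (x + p *\<^sub>R a + q *\<^sub>R b)"
proof -
  have df: "f differentiable (at y)" "dir_deriv a f differentiable (at y)" for y
    using C2 a by (simp_all add: numeral_2_eq_2)
  define h where "h p = f ((x + s *\<^sub>R b) + p *\<^sub>R a) - f (x + p *\<^sub>R a)" for p
  have "(h has_real_derivative
      (dir_deriv a f ((x + s *\<^sub>R b) + p *\<^sub>R a) - dir_deriv a f (x + p *\<^sub>R a))) (at p)" for p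
    unfolding h_def by (intro DERIV_diff has_real_derivative_along_line df)
  from MVT2[OF s this] obtain p where p: "0 < p" "p < s"
    "h s - h 0 = (s - 0) * (dir_deriv a f ((x + s *\<^sub>R b) + p *\<^sub>R a) - dir_deriv a f (x + p *\<^sub>R a))"
    by blast
  from MVT2[OF s has_real_derivative_along_line[OF df(2)]] obtain q where q: "0 < q" "q < s"
    "dir_deriv a f ((x + p *\<^sub>R a) + s *\<^sub>R b) - dir_deriv a f ((x + p *\<^sub>R a) + 0 *\<^sub>R b)
      = (s - 0) * dir_deriv b (dir_deriv a f) ((x + p *\<^sub>R a) + q *\<^sub>R b)"
    by blast
  have "f (x + s *\<^sub>R a + s *\<^sub>R b) - f (x + s *\<^sub>R a) - f (x + s *\<^sub>R b) + f x = h s - h 0"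
    by (simp add: h_def algebra_simps)
  also have "\<dots> = s * (s * dir_deriv b (dir_deriv a f) (x + p *\<^sub>R a + q *\<^sub>R b))"
    using p(3) q(3) by (simp add: add_ac)
  finally show thesis
    using that[OF p(1,2) q(1,2)] by (simp add: power2_eq_square)
qed

text \<open>The intermediate points are squeezed towards \<open>x\<close> by \<open>s n\<close>, so
  continuity of the second derivative gives the limit.\<close>

lemma second_difference_limit:
  fixes f :: "'a::euclidean_space \<Rightarrow> real"
  assumes C2: "Ck_on 2 f UNIV" and a: "a \<in> Basis" and b: "b \<in> Basis"
  defines "s \<equiv> \<lambda>n. inverse (real (Suc n))"
  shows "(\<lambda>n. (f (x + s n *\<^sub>R a + s n *\<^sub>R b) - f (x + s n *\<^sub>R a) - f (x + s n *\<^sub>R b) + f x) / (s n)\<^sup>2)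
    \<longlonglongrightarrow> dir_deriv b (dir_deriv a f) x"
proof -
  have "\<exists>p q. 0 < p \<and> p < s n \<and> 0 < q \<and> q < s n \<and>
    (f (x + s n *\<^sub>R a + s n *\<^sub>R b) - f (x + s n *\<^sub>R a) - f (x + s n *\<^sub>R b) + f x) / (s n)\<^sup>2
      = dir_deriv b (dir_deriv a f) (x + p *\<^sub>R a + q *\<^sub>R b)" for n
  proof -
    have "s n > 0" by (simp add: s_def)
    from second_difference_mean_value[OF C2 a b this, of x] obtain p q where
      "0 < p" "p < s n" "0 < q" "q < s n"
      "f (x + s n *\<^sub>R a + s n *\<^sub>R b) - f (x + s n *\<^sub>R a) - f (x + s n *\<^sub>R b) + f x
        = (s n)\<^sup>2 * dir_deriv b (dir_deriv a f) (x + p *\<^sub>R a + q *\<^sub>R b)"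
      by blast
    with \<open>s n > 0\<close> show ?thesis by (intro exI[of _ p] exI[of _ q]) simp
  qed
  then obtain p q where pq: "\<And>n. 0 < p n" "\<And>n. p n < s n" "\<And>n. 0 < q n" "\<And>n. q n < s n"
    and eq: "\<And>n. (f (x + s n *\<^sub>R a + s n *\<^sub>R b) - f (x + s n *\<^sub>R a) - f (x + s n *\<^sub>R b) + f x) / (s n)\<^sup>2
      = dir_deriv b (dir_deriv a f) (x + p n *\<^sub>R a + q n *\<^sub>R b)"
    by metis
  have s0: "s \<longlonglongrightarrow> 0" unfolding s_def by (rule LIMSEQ_inverse_real_of_nat)
  have "p \<longlonglongrightarrow> 0" "q \<longlonglongrightarrow> 0"
    using pq by (auto intro!: tendsto_sandwich[OF _ _ tendsto_const s0] always_eventually less_imp_le)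
  then have lim: "(\<lambda>n. x + p n *\<^sub>R a + q n *\<^sub>R b) \<longlonglongrightarrow> x + 0 *\<^sub>R a + 0 *\<^sub>R b"
    by (intro tendsto_intros)
  have "continuous_on UNIV (dir_deriv b (dir_deriv a f))"
    using C2 a b by (simp add: numeral_2_eq_2)
  then have "isCont (dir_deriv b (dir_deriv a f)) x"
    by (simp add: continuous_on_eq_continuous_at)
  then show ?thesis
    unfolding eq using isCont_tendsto_compose lim by fastforce
qed

text \<open>The second difference is symmetric in \<open>a\<close> and \<open>b\<close>, so both
  iterated derivatives are limits of the same sequence.\<close>

lemma dir_deriv_commute_real:
  fixes f :: "'a::euclidean_space \<Rightarrow> real"
  assumes "Ck_on 2 f UNIV" "a \<in> Basis" "b \<in> Basis"
  shows "dir_deriv b (dir_deriv a f) x = dir_deriv a (dir_deriv b f) x"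
proof (rule LIMSEQ_unique[OF second_difference_limit[OF assms(1,2,3)]])
  let ?s = "\<lambda>n. inverse (real (Suc n))"
  have eq: "f (x + ?s n *\<^sub>R a + ?s n *\<^sub>R b) - f (x + ?s n *\<^sub>R a) - f (x + ?s n *\<^sub>R b) + f x
    = f (x + ?s n *\<^sub>R b + ?s n *\<^sub>R a) - f (x + ?s n *\<^sub>R b) - f (x + ?s n *\<^sub>R a) + f x" for n
    by (simp add: add_ac)
  show "(\<lambda>n. (f (x + ?s n *\<^sub>R a + ?s n *\<^sub>R b) - f (x + ?s n *\<^sub>R a) - f (x + ?s n *\<^sub>R b) + f x)
      / (?s n)\<^sup>2) \<longlonglongrightarrow> dir_deriv a (dir_deriv b f) x"
    using second_difference_limit[OF assms(1,3,2), of x] by (simp only: eq)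
qed

lemma dir_deriv_commute:
  fixes f :: "'a::euclidean_space \<Rightarrow> real^'n"
  assumes C2: "Ck_on 2 f UNIV" and ab: "a \<in> Basis" "b \<in> Basis"
  shows "dir_deriv b (dir_deriv a f) = dir_deriv a (dir_deriv b f)"
proof -
  have df: "\<forall>x. f differentiable (at x)" "\<forall>x. dir_deriv a f differentiable (at x)"
    "\<forall>x. dir_deriv b f differentiable (at x)"
    using C2 ab by (simp_all add: numeral_2_eq_2)
  have "dir_deriv b (dir_deriv a f) x $ i = dir_deriv a (dir_deriv b f) x $ i" for x i
    using dir_deriv_commute_real[OF Ck_on_nth[OF C2] ab, of i x] df by (simp add: dir_deriv_nth)
  then show ?thesis by (simp add: fun_eq_iff vec_eq_iff)
qed

section \<open>Vector-valued mixed partial derivatives and the norm of the space of fields\<close>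

definition mixed_partial :: "nat \<Rightarrow> nat \<Rightarrow> (real^2 \<Rightarrow> 'b::real_normed_vector) \<Rightarrow> real^2 \<Rightarrow> 'b" where
  "mixed_partial a b w = (partial 1 ^^ a) ((partial 2 ^^ b) w)"

lemma partial_commute:
  fixes f :: "real^2 \<Rightarrow> real^'n"
  assumes "Ck_on 2 f UNIV"
  shows "partial i (partial j f) = partial j (partial i f)"
  unfolding partial_def by (rule dir_deriv_commute[OF assms]) (auto simp: axis_in_Basis_iff)

lemma partial_funpow_commute:
  fixes f :: "real^2 \<Rightarrow> real^'n"
  assumes "Ck_on (Suc m) f UNIV"
  shows "partial j ((partial i ^^ m) f) = (partial i ^^ m) (partial j f)"
  using assms
proof (induction m)
  case (Suc m)
  have "Ck_on 2 ((partial i ^^ m) f) UNIV"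
    using Ck_on_partial_funpow[of m 2 f i] Suc.prems by (simp add: numeral_2_eq_2 del: Ck_on.simps)
  with Suc.IH[OF Ck_on_Suc_imp[OF Suc.prems]] show ?case
    by (simp add: partial_commute[of _ j i])
qed simp

lemma Ck_on_mixed_partial:
  assumes "Ck_on n w UNIV" "a + b + k \<le> n"
  shows "Ck_on k (mixed_partial a b w) UNIV"
proof -
  have "Ck_on (b + (a + k)) w UNIV" using Ck_on_le[OF assms(1)] assms(2) by (simp add: add_ac)
  then show ?thesis unfolding mixed_partial_def by (intro Ck_on_partial_funpow)
qed

lemma partial_mixed_partial:
  fixes w :: "real^2 \<Rightarrow> real^'n"
  shows "partial 1 (mixed_partial a b w) = mixed_partial (Suc a) b w"
    and "Ck_on (Suc (a + b)) w UNIV \<Longrightarrow> partial 2 (mixed_partial a b w) = mixed_partial a (Suc b) w"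
proof -
  assume *: "Ck_on (Suc (a + b)) w UNIV"
  then have "Ck_on (Suc a) ((partial 2 ^^ b) w) UNIV"
    by (intro Ck_on_partial_funpow) (simp add: add_ac del: Ck_on.simps)
  then show "partial 2 (mixed_partial a b w) = mixed_partial a (Suc b) w"
    by (simp add: mixed_partial_def partial_funpow_commute)
qed (simp add: mixed_partial_def)

lemma has_derivative_partial:
  fixes f :: "real^2 \<Rightarrow> 'b::real_normed_vector"
  assumes "f differentiable (at x)"
  shows "(f has_derivative (\<lambda>h. h$1 *\<^sub>R partial 1 f x + h$2 *\<^sub>R partial 2 f x)) (at x)"
proof -
  have lin: "linear (\<lambda>h. dir_deriv h f x)"
    using has_derivative_dir_deriv[OF assms] has_derivative_linear by blast
  have "h = h$1 *\<^sub>R axis 1 1 + h$2 *\<^sub>R axis 2 1" for h :: "real^2"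
    by (auto simp: vec_eq_iff forall_2 axis_def)
  then have "dir_deriv h f x = h$1 *\<^sub>R partial 1 f x + h$2 *\<^sub>R partial 2 f x" for h
    unfolding partial_def using linear_add[OF lin] linear_cmul[OF lin] by metis
  then show ?thesis using has_derivative_dir_deriv[OF assms] by simp
qed

lemma has_derivative_mixed_partial:
  fixes w :: "real^2 \<Rightarrow> real^'n"
  assumes "Ck_on n w UNIV" "a + b < n"
  shows "(mixed_partial a b w has_derivative
    (\<lambda>h. h$1 *\<^sub>R mixed_partial (Suc a) b w x + h$2 *\<^sub>R mixed_partial a (Suc b) w x)) (at x)"
proof -
  have "Ck_on (Suc (a + b)) w UNIV" by (rule Ck_on_le[OF assms(1)]) (use assms(2) in simp)
  moreover have "Ck_on 1 (mixed_partial a b w) UNIV"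
    using Ck_on_mixed_partial[OF assms(1), of a b 1] assms(2) by simp
  ultimately show ?thesis
    using has_derivative_partial[of "mixed_partial a b w" x]
    by (simp add: partial_mixed_partial)
qed

lemma partial_funpow_nth:
  fixes f :: "real^'n::finite \<Rightarrow> real^'m"
  assumes "Ck_on m f UNIV"
  shows "(partial i ^^ m) (\<lambda>x. f x $ k) = (\<lambda>x. (partial i ^^ m) f x $ k)"
  using assms
proof (induction m arbitrary: f)
  case (Suc m)
  have "partial i (\<lambda>x. f x $ k) = (\<lambda>x. partial i f x $ k)"
    using Suc.prems by (simp add: partial_def dir_deriv_nth)
  with Suc.IH[OF Ck_on_partial[OF Suc.prems]] show ?case
    by (simp add: funpow_Suc_right del: funpow.simps)
qed simp

lemma multi_deriv_nth:
  assumes "Ck_on 3 w UNIV" "\<alpha> $ 1 + \<alpha> $ 2 \<le> 3"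
  shows "multi_deriv \<alpha> (\<lambda>y. w y $ i) x = mixed_partial (\<alpha> $ 1) (\<alpha> $ 2) w x $ i"
proof -
  have "Ck_on (\<alpha> $ 2 + \<alpha> $ 1) w UNIV" using Ck_on_le[OF assms(1)] assms(2) by (simp add: add_ac)
  from Ck_on_partial_funpow[OF this] Ck_on_le[OF this] show ?thesis
    by (simp add: multi_deriv_def mixed_partial_def partial_funpow_nth)
qed

text \<open>Replaces multi-indices and scalar components by vector-valued mixed partials, the form
  used in all later estimates of the norm.\<close>

lemma C3_values_eq:
  assumes "Ck_on 3 w UNIV"
  shows "C3_values w = {\<bar>mixed_partial a b w x $ i\<bar> | a b x i. a + b \<le> 3}"
proof -
  have "\<exists>y \<alpha> j. \<bar>mixed_partial a b w x $ i\<bar> = \<bar>multi_deriv \<alpha> (\<lambda>y. w y $ j) y\<bar> \<and> \<alpha> $ 1 + \<alpha> $ 2 \<le> 3"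
    if "a + b \<le> 3" for a b x i
    using that multi_deriv_nth[OF assms, of "vector [a, b]" i x]
    by (intro exI[of _ x] exI[of _ "vector [a, b]"] exI[of _ i]) simp
  moreover have "\<exists>a b y j. \<bar>multi_deriv \<alpha> (\<lambda>y. w y $ i) x\<bar> = \<bar>mixed_partial a b w y $ j\<bar> \<and> a + b \<le> 3"
    if "\<alpha> $ 1 + \<alpha> $ 2 \<le> 3" for \<alpha> i x
    using that multi_deriv_nth[OF assms that, of i x]
    by (intro exI[of _ "\<alpha> $ 1"] exI[of _ "\<alpha> $ 2"] exI[of _ x] exI[of _ i]) simp
  ultimately show ?thesis
    unfolding C3_values_def by blast
qed

lemma mixed_partial_diff:
  assumes "Ck_on 3 v UNIV" "Ck_on 3 w UNIV" "a + b \<le> 3"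
  shows "mixed_partial a b (\<lambda>x. v x - w x) x = mixed_partial a b v x - mixed_partial a b w x"
proof -
  have 1: "Ck_on (b + a) v UNIV" "Ck_on (b + a) w UNIV"
    using Ck_on_le[OF assms(1)] Ck_on_le[OF assms(2)] assms(3) by auto
  then have "Ck_on b v UNIV" "Ck_on b w UNIV"
    using Ck_on_le by (metis le_add1)+
  with Ck_on_partial_funpow[OF 1(1)] Ck_on_partial_funpow[OF 1(2)] show ?thesis
    by (simp add: mixed_partial_def partial_funpow_diff)
qed

text \<open>The norm of the space controls each component separately; the factor 2 comes from
  bounding the Euclidean norm by the sum of the two components.\<close>

lemma norm_mixed_partial_diff_le:
  assumes "v \<in> C3" "w \<in> C3" "a + b \<le> 3"
  shows "norm (mixed_partial a b v x - mixed_partial a b w x) \<le> 2 * C3_dist v w"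
proof -
  let ?u = "\<lambda>x. v x - w x"
  have u: "?u \<in> C3" using C3_diff assms by blast
  have ck: "Ck_on 3 ?u UNIV" and bdd: "bdd_above (C3_values ?u)" using u by (simp_all add: C3_def)
  have "\<bar>mixed_partial a b ?u x $ i\<bar> \<in> C3_values ?u" for i
    unfolding C3_values_eq[OF ck] using assms(3) by blast
  from C3_values_le[OF this bdd]
  have "\<bar>mixed_partial a b ?u x $ i\<bar> \<le> C3_norm ?u" for i .
  then have "norm (mixed_partial a b ?u x) \<le> C3_norm ?u + C3_norm ?u"
    using order_trans[OF norm_le_l1_cart[of "mixed_partial a b ?u x"]] unfolding sum_2
    by (meson add_mono)
  moreover have "mixed_partial a b ?u x = mixed_partial a b v x - mixed_partial a b w x"
    using assms by (intro mixed_partial_diff) (simp_all add: C3_def)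
  moreover have "C3_dist v w = C3_norm ?u" using assms by (simp add: C3_dist_def)
  ultimately show ?thesis by simp
qed

lemma C3_norm_leI:
  assumes "Ck_on 3 w UNIV" "\<And>a b x i. a + b \<le> 3 \<Longrightarrow> \<bar>mixed_partial a b w x $ i\<bar> \<le> B"
  shows "w \<in> C3" "C3_norm w \<le> B"
proof -
  have le: "r \<le> B" if "r \<in> C3_values w" for r
    using that assms(2) unfolding C3_values_eq[OF assms(1)] by auto
  then have "bdd_above (C3_values w)" by (rule bdd_aboveI)
  then show "w \<in> C3" using assms(1) by (simp add: C3_def)
  show "C3_norm w \<le> B"
    unfolding C3_norm_def using C3_values_zeroth[of w 0 1] by (intro cSup_least le) auto
qed

lemma jacobian_nth:
  fixes w :: "real^2 \<Rightarrow> real^2"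
  shows "jacobian w (at x) $ i $ j = partial j w x $ i"
  by (simp add: jacobian_def matrix_def partial_def dir_deriv_def)

section \<open>Regular zero sets\<close>

text \<open>The map \<open>\<phi>\<close> replaces the \<open>e\<close>-coordinate of
  \<open>z\<close> by \<open>g z\<close>; its derivative is invertible where \<open>g\<close> has
  nonzero derivative in direction \<open>e\<close>. The inverse function theorem gives a
  differentiable inverse, whose higher smoothness is read off from the formula for its
  derivative.\<close>

lemma coordinate_change:
  fixes g :: "'a::euclidean_space \<Rightarrow> real"
  assumes W: "open W" "p \<in> W" and g: "Ck_on (Suc k) g W"
    and e: "e \<in> Basis" and ne: "dir_deriv e g p \<noteq> 0"
  defines "\<phi> \<equiv> \<lambda>z. z + (g z - z \<bullet> e) *\<^sub>R e"
  obtains U V \<psi> where "open U" "open V" "p \<in> U" "U \<subseteq> W" "homeomorphism U V \<phi> \<psi>"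
    "Ck_on (Suc k) \<phi> U" "Ck_on (Suc k) \<psi> V"
proof -
  have ee: "e \<bullet> e = 1" using e by simp
  define D where "D z h = dir_deriv h g z" for z h
  have dg: "(g has_derivative D z) (at z)" if "z \<in> W" for z
    unfolding D_def using g that by (intro has_derivative_dir_deriv) auto
  have lin: "linear (D z)" if "z \<in> W" for z
    using dg[OF that] has_derivative_linear by blast
  have CkD: "Ck_on k (\<lambda>z. D z b) W" if "b \<in> Basis" for b
    using g that by (simp add: D_def)
  define W' where "W' = W \<inter> (\<lambda>z. D z e) -` (- {0})"
  have "continuous_on W (\<lambda>z. D z e)" by (rule Ck_on_imp_continuous_on[OF CkD[OF e]])
  then have "open W'"
    unfolding W'_def by (rule continuous_open_preimage[OF _ W(1)]) auto
  have p': "p \<in> W'" and sub: "W' \<subseteq> W" using ne W(2) by (auto simp: W'_def D_def)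
  have nz: "D z e \<noteq> 0" if "z \<in> W'" for z using that by (simp add: W'_def)
  define \<phi>' where "\<phi>' z = (\<lambda>h. h + (D z h - h \<bullet> e) *\<^sub>R e)" for z
  have d\<phi>: "(\<phi> has_derivative \<phi>' z) (at z)" if "z \<in> W" for z
    unfolding \<phi>_def \<phi>'_def by (auto intro!: derivative_eq_intros dg[OF that])
  \<comment> \<open>\<open>I z\<close> is the explicit inverse of \<open>\<phi>' z\<close>: the
    other coordinates are kept, and the \<open>e\<close>-coordinate is recovered by dividing by
    \<open>D z e\<close>.\<close>
  define I where "I z = (\<lambda>u. u + ((u \<bullet> e - D z u) * inverse (D z e)) *\<^sub>R e)" for z
  have blI: "bounded_linear (I z)" if "z \<in> W" for z
    unfolding I_def
    by (intro bounded_linear_add bounded_linear_ident bounded_linear_scaleR_const bounded_linear_mult_const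
        bounded_linear_sub bounded_linear_inner_left has_derivative_bounded_linear[OF dg[OF that]])
  have I\<phi>: "I z (\<phi>' z h) = h" "\<phi>' z (I z h) = h" if "z \<in> W'" for z h
  proof -
    have z: "z \<in> W" using that sub by auto
    have De: "D z (h + c *\<^sub>R e) = D z h + c * D z e" "(h + c *\<^sub>R e) \<bullet> e = h \<bullet> e + c" for c
      using ee by (simp_all add: linear_add[OF lin[OF z]] linear_cmul[OF lin[OF z]] inner_add_left)
    show "I z (\<phi>' z h) = h"
      unfolding I_def \<phi>'_def De using nz[OF that] by (simp add: field_simps flip: scaleR_add_left)
    show "\<phi>' z (I z h) = h"
      unfolding I_def \<phi>'_def De using nz[OF that] by (simp add: field_simps flip: scaleR_add_left)
  qed
  define B where "B z = Blinfun (\<phi>' z)" for z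
  have B: "blinfun_apply (B z) = \<phi>' z" if "z \<in> W" for z
    unfolding B_def by (rule bounded_linear_Blinfun_apply[OF has_derivative_bounded_linear[OF d\<phi>[OF that]]])
  have "continuous_on W (\<lambda>z. \<phi>' z i)" if "i \<in> Basis" for i
    unfolding \<phi>'_def by (intro continuous_intros Ck_on_imp_continuous_on[OF CkD[OF that]])
  then have "continuous_on W' (\<lambda>z. blinfun_apply (B z) i)" if "i \<in> Basis" for i
    using that sub B continuous_on_subset[OF _ sub]
    by (subst continuous_on_cong[OF refl, of _ _ "\<lambda>z. \<phi>' z i"]) auto
  then have contB: "continuous_on W' B"
    by (rule continuous_on_blinfun_componentwise)
  have invB: "Blinfun (I p) o\<^sub>L B p = id_blinfun"
    using I\<phi>(1)[OF p'] B[OF W(2)] bounded_linear_Blinfun_apply[OF blI[OF W(2)]]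
    by (intro blinfun_eqI) simp
  have derB: "(\<phi> has_derivative blinfun_apply (B z)) (at z)" if "z \<in> W'" for z
    using d\<phi>[of z] B[of z] that sub by auto
  obtain U V \<psi> \<psi>' where U: "open U" "U \<subseteq> W'" "p \<in> U" "open V" "\<phi> p \<in> V" "homeomorphism U V \<phi> \<psi>"
    and d\<psi>: "\<And>y. y \<in> V \<Longrightarrow> (\<psi> has_derivative \<psi>' y) (at y)"
    and \<psi>': "\<And>y. y \<in> V \<Longrightarrow> \<psi>' y = inv (blinfun_apply (B (\<psi> y)))"
    and "\<And>y. y \<in> V \<Longrightarrow> bij (blinfun_apply (B (\<psi> y)))"
    apply (rule inverse_function_theorem[OF \<open>open W'\<close> derB contB p' invB])
     apply assumption
    subgoal premises pr for U V \<psi> \<psi>' by (rule pr(1)[OF pr(2-)])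
    done
  have \<psi>U: "\<psi> y \<in> U" if "y \<in> V" for y
    using U(6) that unfolding homeomorphism_def by blast
  have "\<psi>' y = I (\<psi> y)" if "y \<in> V" for y
  proof -
    have "\<psi> y \<in> W'" using \<psi>U[OF that] U(2) by auto
    then show ?thesis
      unfolding \<psi>'[OF that] using I\<phi>[of "\<psi> y"] B[of "\<psi> y"] sub
      by (intro inv_equality) auto
  qed
  with d\<psi> have dI: "(\<psi> has_derivative I (\<psi> y)) (at y)" if "y \<in> V" for y
    using that by metis
  have \<psi>W: "\<psi> ` V \<subseteq> W'" using \<psi>U U(2) by blast
  \<comment> \<open>Bootstrapping: the derivative of \<open>\<psi>\<close> at \<open>y\<close> is
    \<open>I (\<psi> y)\<close>, a rational expression in derivatives of \<open>g\<close> at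
    \<open>\<psi> y\<close>. Hence smoothness of order \<open>j \<le> k\<close> improves to
    \<open>Suc j\<close>.\<close>
  have "Ck_on j \<psi> V" if "j \<le> Suc k" for j
    using that
  proof (induction j)
    case 0
    then show ?case using U(6) by (simp add: homeomorphism_def)
  next
    case (Suc j)
    then have j: "Ck_on j \<psi> V" "j \<le> k" by simp_all
    show ?case
    proof (rule Ck_on_cong_derivative[OF U(4) dI])
      fix b :: 'a assume b: "b \<in> Basis"
      have c: "Ck_on j (\<lambda>y. D (\<psi> y) b) V" if "b \<in> Basis" for b
        using Ck_on_compose[OF U(4) \<open>open W'\<close> \<psi>W j(1) Ck_on_subset[OF Ck_on_le[OF CkD[OF that] j(2)] sub]] .
      show "Ck_on j (\<lambda>y. I (\<psi> y) b) V"
        unfolding I_def using \<psi>W nz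
        by (intro Ck_on_add Ck_on_scaleR Ck_on_mult Ck_on_sub Ck_on_inverse Ck_on_const c b e U(4)) auto
    qed
  qed
  then have \<psi>k: "Ck_on (Suc k) \<psi> V" by blast
  have UW: "U \<subseteq> W" using U(2) sub by blast
  have "Ck_on (Suc k) \<phi> U"
    unfolding \<phi>_def
    by (intro Ck_on_add[OF U(1)] Ck_on_scaleR[OF U(1)] Ck_on_sub[OF U(1)] Ck_on_subset[OF g UW]
        Ck_on_const[OF U(1)] Ck_on_bounded_linear[OF U(1) bounded_linear_inner_left]
        Ck_on_bounded_linear[OF U(1) bounded_linear_ident])
  with \<psi>k show thesis
    by (intro that[OF U(1,4,3) UW U(6)])
qed

text \<open>The new \<open>e\<close>-coordinate is the value of \<open>g\<close>, so zeros of
  \<open>g\<close> correspond to points of the hyperplane orthogonal to \<open>e\<close>.\<close>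

lemma coordinate_change_zero_set:
  fixes g :: "'a::euclidean_space \<Rightarrow> real"
  assumes S: "S \<inter> W = {z \<in> W. g z = 0}" and U: "U \<subseteq> W" and e: "e \<in> Basis"
    and h: "homeomorphism U V (\<lambda>z. z + (g z - z \<bullet> e) *\<^sub>R e) \<psi>"
  shows "(\<lambda>z. z + (g z - z \<bullet> e) *\<^sub>R e) ` (S \<inter> U) = {z. e \<bullet> z = 0} \<inter> V"
proof -
  define \<phi> where "\<phi> = (\<lambda>z. z + (g z - z \<bullet> e) *\<^sub>R e)"
  have "e \<bullet> \<phi> z = g z" for z
    using e by (simp add: \<phi>_def inner_add_right inner_commute)
  moreover have "S \<inter> U = {z \<in> U. g z = 0}" using S U by blast
  moreover have "\<phi> ` U = V" using h by (simp add: \<phi>_def homeomorphism_def)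
  ultimately have "\<phi> ` (S \<inter> U) = {z. e \<bullet> z = 0} \<inter> V" by auto
  then show ?thesis by (simp add: \<phi>_def)
qed

text \<open>Regular value criterion in local form: the defining function, its domain and the
  direction of nonzero derivative may change from point to point.\<close>

lemma embedded_submanifold_zero_set:
  fixes S :: "'a::euclidean_space set"
  assumes "\<And>p. p \<in> S \<Longrightarrow> \<exists>W g e. open W \<and> p \<in> W \<and> Ck_on (Suc k) g W \<and> S \<inter> W = {z \<in> W. g z = 0}
    \<and> e \<in> Basis \<and> dir_deriv e g p \<noteq> (0::real)"
  shows "embedded_submanifold (Suc k) (DIM('a) - 1) S"
  unfolding embedded_submanifold_def
proof
  fix p assume "p \<in> S"
  from assms[OF this] obtain W g e where W: "open W" "p \<in> W" "Ck_on (Suc k) g W"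
    and S: "S \<inter> W = {z \<in> W. g z = 0}" and e: "e \<in> Basis" "dir_deriv e g p \<noteq> (0::real)"
    by blast
  obtain U V \<psi> where U: "open U" "open V" "p \<in> U" "U \<subseteq> W"
    "homeomorphism U V (\<lambda>z. z + (g z - z \<bullet> e) *\<^sub>R e) \<psi>"
    "Ck_on (Suc k) (\<lambda>z. z + (g z - z \<bullet> e) *\<^sub>R e) U" "Ck_on (Suc k) \<psi> V"
    by (rule coordinate_change[OF W e])
  have "e \<noteq> 0" using e(1) by auto
  show "\<exists>U V \<phi> \<psi> (L::'a set). open U \<and> open V \<and> p \<in> U \<and> homeomorphism U V \<phi> \<psi> \<and>
      Ck_on (Suc k) \<phi> U \<and> Ck_on (Suc k) \<psi> V \<and> subspace L \<and> dim L = DIM('a) - 1 \<and> \<phi> ` (S \<inter> U) = L \<inter> V"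
    using U coordinate_change_zero_set[OF S U(4) e(1) U(5)] subspace_hyperplane[of e]
      dim_hyperplane[OF \<open>e \<noteq> 0\<close>]
    by (intro exI[of _ U] exI[of _ V] exI[of _ "\<lambda>z. z + (g z - z \<bullet> e) *\<^sub>R e"] exI[of _ \<psi>]
        exI[of _ "{z. e \<bullet> z = 0}"] conjI)
qed

text \<open>The coordinate change for the time direction leaves \<open>x\<close> fixed. Its inverse
  therefore sends \<open>(0, x)\<close> to a point over \<open>x\<close>, and the time of that point
  is \<open>\<tau> x\<close>.\<close>

lemma local_graph_at_zero_set:
  fixes S :: "(real \<times> (real^2)) set"
  assumes W: "open W" "p \<in> W" "Ck_on 2 g W" and S: "S \<inter> W = {z \<in> W. g z = 0}" and pS: "p \<in> S"
    and ne: "dir_deriv (1, 0) g p \<noteq> (0::real)"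
  shows "\<exists>\<tau>. local_graph_at S p \<tau>"
proof -
  define e where "e = (1::real, 0::real^2)"
  have e: "e \<in> Basis" by (simp add: e_def Basis_prod_def)
  have ge: "dir_deriv e g p \<noteq> 0" using ne by (simp add: e_def)
  have W3: "Ck_on (Suc 1) g W" using W(3) by (simp only: Suc_1)
  define \<phi> where "\<phi> = (\<lambda>z. z + (g z - z \<bullet> e) *\<^sub>R e)"
  obtain U V \<psi> where U: "open U" "open V" "p \<in> U" "U \<subseteq> W" "homeomorphism U V \<phi> \<psi>" "Ck_on (Suc 1) \<psi> V"
    by (rule coordinate_change[OF W(1,2) W3 e ge, folded \<phi>_def])
  have im: "\<phi> ` (S \<inter> U) = {z. e \<bullet> z = 0} \<inter> V"
    using coordinate_change_zero_set[OF S U(4) e] U(5) unfolding \<phi>_def by blast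
  have inv: "\<psi> (\<phi> z) = z" if "z \<in> U" for z using U(5) that by (simp add: homeomorphism_def)
  have inv2: "\<phi> (\<psi> z) = z" if "z \<in> V" for z using U(5) that by (simp add: homeomorphism_def)
  have snd_\<phi>: "snd (\<phi> z) = snd z" for z by (simp add: \<phi>_def e_def)
  define \<tau> where "\<tau> x = fst (\<psi> (0, x))" for x :: "real^2"
  define V' where "V' = (\<lambda>x::real^2. (0::real, x)) -` V"
  have V': "open V'"
    unfolding V'_def by (rule open_vimage[OF U(2)]) (intro continuous_intros)
  have "Ck_on 2 (\<lambda>x. \<psi> (0, x)) V'"
    by (rule Ck_on_compose[OF V' U(2) _ Ck_on_bounded_linear])
      (use U(6) V' in \<open>auto simp: V'_def bounded_linear_Pair bounded_linear_zero bounded_linear_ident numeral_2_eq_2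
        simp del: Ck_on.simps\<close>)
  then have "Ck_on 2 \<tau> V'"
    unfolding \<tau>_def by (rule Ck_on_compose_bounded_linear[OF V' bounded_linear_fst])
  moreover have "S \<inter> U = (\<lambda>x. (\<tau> x, x)) ` V'"
  proof -
    have "S \<inter> U = \<psi> ` \<phi> ` (S \<inter> U)" using inv by force
    also have "\<phi> ` (S \<inter> U) = (\<lambda>x. (0, x)) ` V'"
      unfolding im by (force simp: e_def V'_def inner_prod_def)
    also have "\<psi> ` (\<lambda>x. (0, x)) ` V' = (\<lambda>x. (\<tau> x, x)) ` V'"
    proof -
      have "\<psi> (0, x) = (\<tau> x, x)" if "x \<in> V'" for x
        using snd_\<phi>[of "\<psi> (0, x)"] inv2[of "(0, x)"] that
        by (simp add: \<tau>_def V'_def prod_eq_iff)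
      then show ?thesis by force
    qed
    finally show ?thesis .
  qed
  moreover from this have "p \<in> (\<lambda>x. (\<tau> x, x)) ` V'" using pS U(3) by blast
  then have "snd p \<in> V'" by auto
  ultimately show ?thesis unfolding local_graph_at_def using U(1,3) V' by blast
qed

section \<open>The determinant as a function of the jet\<close>

text \<open>The determinant of the matrix with columns \<open>u\<close> and \<open>v\<close>, in a
  form to which the product rule for bilinear maps applies.\<close>

definition cross2 :: "real^2 \<Rightarrow> real^2 \<Rightarrow> real" where
  "cross2 u v = u$1 * v$2 - u$2 * v$1"

lemma bounded_bilinear_cross2: "bounded_bilinear cross2"
proof
  show "\<exists>K. \<forall>u v. norm (cross2 u v) \<le> norm u * norm v * K"
  proof (intro exI[of _ 2] allI)
    fix u v :: "real^2"
    have "\<bar>u$i * v$j\<bar> \<le> norm u * norm v" for i j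
      unfolding abs_mult by (intro mult_mono component_le_norm_cart) auto
    from this[of 1 2] this[of 2 1] show "norm (cross2 u v) \<le> norm u * norm v * 2"
      by (simp add: cross2_def)
  qed
qed (simp_all add: cross2_def algebra_simps)

lemma cross2_zero [simp]: "cross2 0 v = 0" "cross2 u 0 = 0" "cross2 u u = 0"
  by (simp_all add: cross2_def)

type_synonym jet = "(real^2) \<times> (real^2) \<times> (real^2) \<times> (real^2) \<times> (real^2)
  \<times> (real^2) \<times> (real^2) \<times> (real^2) \<times> (real^2)"

text \<open>The value \<open>w x\<close> is absent because only \<open>Dw\<close> enters
  \<open>I + t Dw\<close>. By symmetry \<open>mixed_partial 1 1 w x\<close> is both the
  \<open>x_2\<close>-derivative of the first column of \<open>Dw\<close> and the
  \<open>x_1\<close>-derivative of the second.\<close>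

definition jet :: "(real^2 \<Rightarrow> real^2) \<Rightarrow> real^2 \<Rightarrow> jet" where
  "jet w x = (mixed_partial 1 0 w x, mixed_partial 0 1 w x,
     mixed_partial 2 0 w x, mixed_partial 1 1 w x, mixed_partial 0 2 w x,
     mixed_partial 3 0 w x, mixed_partial 2 1 w x, mixed_partial 1 2 w x, mixed_partial 0 3 w x)"

text \<open>The columns of \<open>I + t Dw\<close> are \<open>col1\<close> and \<open>col2\<close>, so \<open>det_jet\<close> is its determinant;
  the subscripts of the other functions record differentiation in \<open>t\<close>, \<open>x\<^sub>1\<close>, \<open>x\<^sub>2\<close>.\<close>

definition col1 :: "real \<Rightarrow> jet \<Rightarrow> real^2" where
  "col1 t = (\<lambda>(a, b, _). axis 1 1 + t *\<^sub>R a)"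

definition col2 :: "real \<Rightarrow> jet \<Rightarrow> real^2" where
  "col2 t = (\<lambda>(a, b, _). axis 2 1 + t *\<^sub>R b)"

definition det_jet :: "real \<Rightarrow> jet \<Rightarrow> real" where
  "det_jet t J = cross2 (col1 t J) (col2 t J)"

definition det_t :: "real \<Rightarrow> jet \<Rightarrow> real" where
  "det_t t J = (case J of (a, b, _) \<Rightarrow> cross2 a (col2 t J) + cross2 (col1 t J) b)"

definition det_1 :: "real \<Rightarrow> jet \<Rightarrow> real" where
  "det_1 t J = (case J of (_, _, a1, b1, _) \<Rightarrow> t * (cross2 a1 (col2 t J) + cross2 (col1 t J) b1))"

definition det_2 :: "real \<Rightarrow> jet \<Rightarrow> real" where
  "det_2 t J = (case J of (_, _, _, a2, b2, _) \<Rightarrow> t * (cross2 a2 (col2 t J) + cross2 (col1 t J) b2))"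

definition det_11 :: "real \<Rightarrow> jet \<Rightarrow> real" where
  "det_11 t J = (case J of (_, _, a1, b1, _, a11, b11, _) \<Rightarrow>
     t * (cross2 a11 (col2 t J) + 2 * t * cross2 a1 b1 + cross2 (col1 t J) b11))"

text \<open>The product rule also yields a multiple of \<open>cross2 a2 b1\<close>, which vanishes
  because \<open>a2\<close> and \<open>b1\<close> are the same mixed derivative.\<close>

definition det_12 :: "real \<Rightarrow> jet \<Rightarrow> real" where
  "det_12 t J = (case J of (_, _, a1, _, b2, _, a12, b12, _) \<Rightarrow>
     t * (cross2 a12 (col2 t J) + t * cross2 a1 b2 + cross2 (col1 t J) b12))"

definition det_22 :: "real \<Rightarrow> jet \<Rightarrow> real" where
  "det_22 t J = (case J of (_, _, _, a2, b2, _, _, a22, b22) \<Rightarrow>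
     t * (cross2 a22 (col2 t J) + 2 * t * cross2 a2 b2 + cross2 (col1 t J) b22))"

definition degenerate :: "real \<Rightarrow> jet \<Rightarrow> bool" where
  "degenerate t J \<longleftrightarrow> det_jet t J = 0 \<and> det_1 t J = 0 \<and> det_2 t J = 0
     \<and> det_t t J * (det_11 t J * det_22 t J - (det_12 t J)\<^sup>2) = 0"

lemmas det_jet_defs = col1_def col2_def det_jet_def det_t_def det_1_def det_2_def
  det_11_def det_12_def det_22_def

lemma has_derivative_mixed_partial_snd:
  fixes w :: "real^2 \<Rightarrow> real^'n" and z :: "real \<times> (real^2)"
  assumes "Ck_on 3 w UNIV" "a + b < 3"
  shows "((\<lambda>z. mixed_partial a b w (snd z)) has_derivative
    (\<lambda>h. (snd h)$1 *\<^sub>R mixed_partial (Suc a) b w (snd z) + (snd h)$2 *\<^sub>R mixed_partial a (Suc b) w (snd z)))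
    (at z)"
  by (rule has_derivative_compose[OF has_derivative_snd[OF has_derivative_ident]
      has_derivative_mixed_partial[OF assms]])

lemma mixed_partial_snd_derivs:
  fixes w :: "real^2 \<Rightarrow> real^'n" and z :: "real \<times> (real^2)"
  assumes "Ck_on 3 w UNIV"
  shows "((\<lambda>z. mixed_partial 1 0 w (snd z)) has_derivative
      (\<lambda>h. (snd h)$1 *\<^sub>R mixed_partial 2 0 w (snd z) + (snd h)$2 *\<^sub>R mixed_partial 1 1 w (snd z))) (at z)"
    "((\<lambda>z. mixed_partial 0 1 w (snd z)) has_derivative
      (\<lambda>h. (snd h)$1 *\<^sub>R mixed_partial 1 1 w (snd z) + (snd h)$2 *\<^sub>R mixed_partial 0 2 w (snd z))) (at z)"
    "((\<lambda>z. mixed_partial 2 0 w (snd z)) has_derivative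
      (\<lambda>h. (snd h)$1 *\<^sub>R mixed_partial 3 0 w (snd z) + (snd h)$2 *\<^sub>R mixed_partial 2 1 w (snd z))) (at z)"
    "((\<lambda>z. mixed_partial 1 1 w (snd z)) has_derivative
      (\<lambda>h. (snd h)$1 *\<^sub>R mixed_partial 2 1 w (snd z) + (snd h)$2 *\<^sub>R mixed_partial 1 2 w (snd z))) (at z)"
    "((\<lambda>z. mixed_partial 0 2 w (snd z)) has_derivative
      (\<lambda>h. (snd h)$1 *\<^sub>R mixed_partial 1 2 w (snd z) + (snd h)$2 *\<^sub>R mixed_partial 0 3 w (snd z))) (at z)"
  using has_derivative_mixed_partial_snd[OF assms, of 1 0 z] has_derivative_mixed_partial_snd[OF assms, of 0 1 z]
    has_derivative_mixed_partial_snd[OF assms, of 2 0 z] has_derivative_mixed_partial_snd[OF assms, of 1 1 z]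
    has_derivative_mixed_partial_snd[OF assms, of 0 2 z]
  by (simp_all add: numeral_2_eq_2 numeral_3_eq_3)

text \<open>Product rule for \<open>cross2\<close> and the columns. The time derivatives of
  \<open>det_1\<close> and \<open>det_2\<close> stay unnamed constants because the later arguments
  work for any value of them.\<close>

lemma det_jet_derivs:
  fixes w :: "real^2 \<Rightarrow> real^2" and z :: "real \<times> (real^2)"
  assumes w: "Ck_on 3 w UNIV"
  defines "J \<equiv> jet w (snd z)"
  shows "((\<lambda>z. det_jet (fst z) (jet w (snd z))) has_derivative
      (\<lambda>h. fst h * det_t (fst z) J + (snd h)$1 * det_1 (fst z) J + (snd h)$2 * det_2 (fst z) J)) (at z)"
    and "\<exists>c. ((\<lambda>z. det_1 (fst z) (jet w (snd z))) has_derivative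
      (\<lambda>h. fst h * c + (snd h)$1 * det_11 (fst z) J + (snd h)$2 * det_12 (fst z) J)) (at z)"
    and "\<exists>c. ((\<lambda>z. det_2 (fst z) (jet w (snd z))) has_derivative
      (\<lambda>h. fst h * c + (snd h)$1 * det_12 (fst z) J + (snd h)$2 * det_22 (fst z) J)) (at z)"
    and "(\<lambda>z. det_t (fst z) (jet w (snd z))) differentiable (at z)"
proof -
  note d = mixed_partial_snd_derivs[OF w, of z] bounded_bilinear.FDERIV[OF bounded_bilinear_cross2]
  note fst' = has_derivative_fst[OF has_derivative_ident]
  have c1: "((\<lambda>z. col1 (fst z) (jet w (snd z))) has_derivative
    (\<lambda>h. fst h *\<^sub>R mixed_partial 1 0 w (snd z)
      + fst z *\<^sub>R ((snd h)$1 *\<^sub>R mixed_partial 2 0 w (snd z) + (snd h)$2 *\<^sub>R mixed_partial 1 1 w (snd z)))) (at z)"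
    unfolding col1_def jet_def prod.case
    by (rule has_derivative_eq_rhs, rule has_derivative_add[OF has_derivative_const has_derivative_scaleR[OF fst' d(1)]])
      (simp add: fun_eq_iff)
  have c2: "((\<lambda>z. col2 (fst z) (jet w (snd z))) has_derivative
    (\<lambda>h. fst h *\<^sub>R mixed_partial 0 1 w (snd z)
      + fst z *\<^sub>R ((snd h)$1 *\<^sub>R mixed_partial 1 1 w (snd z) + (snd h)$2 *\<^sub>R mixed_partial 0 2 w (snd z)))) (at z)"
    unfolding col2_def jet_def prod.case
    by (rule has_derivative_eq_rhs, rule has_derivative_add[OF has_derivative_const has_derivative_scaleR[OF fst' d(2)]])
      (simp add: fun_eq_iff)
  note c = c1[unfolded jet_def] c2[unfolded jet_def]
  show "((\<lambda>z. det_jet (fst z) (jet w (snd z))) has_derivative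
      (\<lambda>h. fst h * det_t (fst z) J + (snd h)$1 * det_1 (fst z) J + (snd h)$2 * det_2 (fst z) J)) (at z)"
    unfolding det_jet_def det_t_def det_1_def det_2_def J_def jet_def prod.case
    by (rule has_derivative_eq_rhs, rule d(6)[OF c]) (simp add: fun_eq_iff cross2_def algebra_simps)
  show "\<exists>c. ((\<lambda>z. det_1 (fst z) (jet w (snd z))) has_derivative
      (\<lambda>h. fst h * c + (snd h)$1 * det_11 (fst z) J + (snd h)$2 * det_12 (fst z) J)) (at z)"
    unfolding det_11_def det_1_def det_12_def J_def jet_def prod.case
    apply (rule exI[of _ "cross2 (mixed_partial 2 0 w (snd z)) (col2 (fst z) J) + cross2 (col1 (fst z) J) (mixed_partial 1 1 w (snd z))
      + fst z * (cross2 (mixed_partial 2 0 w (snd z)) (mixed_partial 0 1 w (snd z))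
        + cross2 (mixed_partial 1 0 w (snd z)) (mixed_partial 1 1 w (snd z)))"])
    by (rule has_derivative_eq_rhs,
        rule has_derivative_mult[OF fst' has_derivative_add[OF d(6)[OF d(3) c(2)] d(6)[OF c(1) d(4)]]])
      (simp add: fun_eq_iff cross2_def algebra_simps J_def jet_def)
  show "\<exists>c. ((\<lambda>z. det_2 (fst z) (jet w (snd z))) has_derivative
      (\<lambda>h. fst h * c + (snd h)$1 * det_12 (fst z) J + (snd h)$2 * det_22 (fst z) J)) (at z)"
    unfolding det_22_def det_2_def det_12_def J_def jet_def prod.case
    apply (rule exI[of _ "cross2 (mixed_partial 1 1 w (snd z)) (col2 (fst z) J) + cross2 (col1 (fst z) J) (mixed_partial 0 2 w (snd z))
      + fst z * (cross2 (mixed_partial 1 1 w (snd z)) (mixed_partial 0 1 w (snd z))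
        + cross2 (mixed_partial 1 0 w (snd z)) (mixed_partial 0 2 w (snd z)))"])
    by (rule has_derivative_eq_rhs,
        rule has_derivative_mult[OF fst' has_derivative_add[OF d(6)[OF d(4) c(2)] d(6)[OF c(1) d(5)]]])
      (simp add: fun_eq_iff cross2_def algebra_simps J_def jet_def)
  show "(\<lambda>z. det_t (fst z) (jet w (snd z))) differentiable (at z)"
    unfolding det_t_def jet_def prod.case differentiable_def
    by (rule exI, rule has_derivative_add[OF d(6)[OF d(1) c(2)] d(6)[OF c(1) d(2)]])
qed

lemma Ck_on_det_jet:
  fixes w :: "real^2 \<Rightarrow> real^2"
  assumes w: "Ck_on 3 w UNIV"
  shows "Ck_on 2 (\<lambda>z. det_jet (fst z) (jet w (snd z))) UNIV"
proof -
  have d: "Ck_on 2 (\<lambda>z::real \<times> (real^2). mixed_partial a b w (snd z)) UNIV" if "a + b = 1" for a b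
    by (rule Ck_on_compose[OF open_UNIV open_UNIV _ Ck_on_bounded_linear[OF open_UNIV bounded_linear_snd]
          Ck_on_mixed_partial[OF w]]) (use that in auto)
  show ?thesis
    unfolding det_jet_def col1_def col2_def jet_def prod.case
    by (intro Ck_on_bilinear[OF _ bounded_bilinear_cross2] Ck_on_add Ck_on_const Ck_on_scaleR d
        Ck_on_bounded_linear[OF _ bounded_linear_fst] open_UNIV) auto
qed

lemma flow_jacobian_nth:
  fixes w :: "real^2 \<Rightarrow> real^2"
  shows "flow_jacobian w (t, x) $ i $ 1 = col1 t (jet w x) $ i"
    and "flow_jacobian w (t, x) $ i $ 2 = col2 t (jet w x) $ i"
  by (auto simp: flow_jacobian_def jacobian_nth col1_def col2_def jet_def mixed_partial_def mat_def axis_def)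

lemma det_flow_jacobian: "det (flow_jacobian w (t, x)) = det_jet t (jet w x)"
  by (simp add: Determinants.det_2 flow_jacobian_nth det_jet_def cross2_def algebra_simps)

lemma flow_jacobian_eq_0_iff:
  "flow_jacobian w (t, x) = 0 \<longleftrightarrow> col1 t (jet w x) = 0 \<and> col2 t (jet w x) = 0"
  by (auto simp: vec_eq_iff forall_2 flow_jacobian_nth)

lemma rank_2x2:
  fixes A :: "real^2^2"
  shows "rank A = Suc 0 \<longleftrightarrow> det A = 0 \<and> A \<noteq> 0" and "rank A = 2 \<longleftrightarrow> det A \<noteq> 0"
proof -
  have "rank A \<le> 2" using rank_bound[of A] by simp
  then show "rank A = Suc 0 \<longleftrightarrow> det A = 0 \<and> A \<noteq> 0" "rank A = 2 \<longleftrightarrow> det A \<noteq> 0"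
    using det_eq_0_rank[of A] rank_eq_0[of A] by auto
qed

text \<open>Every summand of the determinant and of its first derivatives has a column as a factor.
  Excluding degenerate points therefore also excludes rank zero.\<close>

lemma degenerate_if_cols_0: "col1 t J = 0 \<Longrightarrow> col2 t J = 0 \<Longrightarrow> degenerate t J"
  by (auto simp: degenerate_def det_jet_def det_t_def det_1_def det_2_def split: prod.split)

text \<open>The bounds make each entry of \<open>t Dw\<close> at most 1/8 in modulus, so the
  determinant is at least 1 - 2/8 - 2/64.\<close>

lemma det_jet_pos:
  assumes T: "0 \<le> t" "t \<le> T" and a: "norm (fst J) \<le> 1 / (8 * (T + 1))" and b: "norm (fst (snd J)) \<le> 1 / (8 * (T + 1))"
  shows "det_jet t J > 0"
proof -
  obtain a b r where J: "J = (a, b, r)" by (cases J) auto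
  have le: "\<bar>t * u$i\<bar> \<le> 1/8" if "norm u \<le> 1 / (8 * (T + 1))" for u :: "real^2" and i
  proof -
    have "\<bar>t * u$i\<bar> \<le> (T + 1) * (1 / (8 * (T + 1)))"
      unfolding abs_mult using T order_trans[OF component_le_norm_cart that] by (intro mult_mono) auto
    also have "\<dots> = 1/8" using T by (simp add: field_simps)
    finally show ?thesis .
  qed
  have m: "\<bar>(t * a$i) * (t * b$j)\<bar> \<le> 1/8 * (1/8)" for i j
    unfolding abs_mult[of "t * a$i"] using le[of a i] le[of b j] assms J by (intro mult_mono) auto
  have "det_jet t J = 1 + t * a$1 + t * b$2 + (t * a$1) * (t * b$2) - (t * a$2) * (t * b$1)"
    by (simp add: J det_jet_defs cross2_def axis_def algebra_simps)
  moreover note m[of 1 2] m[of 2 1] le[of a 1] le[of b 2] assms(3,4)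
  ultimately show ?thesis by (simp add: J abs_le_iff)
qed

section \<open>Fields without degenerate points\<close>

text \<open>An injective derivative satisfies \<open>B * norm h \<le> norm (f' h)\<close>. At
  another point of the fibre the remainder would be at least that large, against the bound
  \<open>B / 2 * norm h\<close> near \<open>z\<close>. Differentiability at the single point
  \<open>z\<close> suffices.\<close>

lemma isolated_in_fibre:
  fixes f :: "'a::euclidean_space \<Rightarrow> 'b::euclidean_space"
  assumes f: "(f has_derivative f') (at z)" and inj: "\<And>h. f' h = 0 \<Longrightarrow> h = 0"
  shows "\<not> z islimpt {y. f y = f z}"
proof
  assume lim: "z islimpt {y. f y = f z}"
  have lin: "linear f'" using f has_derivative_linear by blast
  then have "inj f'" using inj by (simp add: linear_injective_0)
  from linear_inj_bounded_below_pos[OF lin this] obtain B where B: "B > 0" "\<And>x. B * norm x \<le> norm (f' x)"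
    by blast
  from f B(1) obtain d where d: "d > 0"
    "\<And>y. norm (y - z) < d \<Longrightarrow> norm (f y - f z - f' (y - z)) \<le> B / 2 * norm (y - z)"
    unfolding has_derivative_at_alt by (meson half_gt_zero)
  from lim d(1) obtain y where y: "f y = f z" "y \<noteq> z" "dist y z < d"
    unfolding islimpt_approachable by auto
  then have "norm (f' (y - z)) \<le> B / 2 * norm (y - z)"
    using d(2)[of y] by (simp add: dist_norm norm_minus_commute)
  with B(2)[of "y - z"] have "B * norm (y - z) \<le> B / 2 * norm (y - z)" by simp
  with B(1) y(2) show False by simp
qed

text \<open>By Cayley-Hamilton, the square of \<open>A\<close> is its trace times \<open>A\<close>
  when the determinant vanishes, so a nonzero column is an eigenvector for the trace. The trace may
  still be zero here.\<close>

lemma eigenvalue_trace_2x2: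
  fixes A :: "real^2^2"
  assumes "det A = 0" "A \<noteq> 0"
  shows "eigenvalue A (A$1$1 + A$2$2)"
proof -
  obtain j where "column j A \<noteq> 0"
    using assms(2) by (auto simp: vec_eq_iff column_def)
  moreover have "A$1$1 * A$2$2 = A$1$2 * A$2$1"
    using assms(1) by (simp add: Determinants.det_2)
  then have "A *v column j A = (A$1$1 + A$2$2) *\<^sub>R column j A"
    using exhaust_2[of j]
    by (auto simp: vec_eq_iff forall_2 matrix_vector_mult_def sum_2 column_def algebra_simps)
  ultimately show ?thesis unfolding eigenvalue_def by blast
qed

text \<open>An Euler-type identity for the polynomial \<open>1 + t tr Dw + t^2 det Dw\<close>. On
  the zero set, for \<open>t > 0\<close>, it turns a nonzero \<open>det_t\<close> into a nonzero
  trace.\<close>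

lemma time_det_t:
  "t * det_t t J = 2 * det_jet t J - (col1 t J $ 1 + col2 t J $ 2)"
  by (cases J) (simp add: det_jet_defs cross2_def axis_def algebra_simps)

text \<open>The bound is half of that in \<open>det_jet_pos\<close>, which leaves room for a
  perturbation of the field.\<close>

lemma C3_0_partials_small:
  assumes w: "w \<in> C3_0" and T: "T > 0"
  obtains R where "\<And>x. R \<le> norm x \<Longrightarrow>
    norm (mixed_partial 1 0 w x) < 1 / (16 * (T + 1)) \<and> norm (mixed_partial 0 1 w x) < 1 / (16 * (T + 1))"
proof -
  have lim: "((\<lambda>x. jacobian w (at x)) \<longlongrightarrow> 0) at_infinity" using w by (simp add: C3_0_def)
  have "((\<lambda>x. partial j w x) \<longlongrightarrow> 0) at_infinity" for j
  proof (rule vec_tendstoI)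
    fix i
    show "((\<lambda>x. partial j w x $ i) \<longlongrightarrow> 0 $ i) at_infinity"
      using tendsto_vec_nth[OF tendsto_vec_nth[OF lim, of i], of j] by (simp add: jacobian_nth)
  qed
  from tendstoD[OF this, of "1 / (16 * (T + 1))"]
  have "\<forall>\<^sub>F x in at_infinity. norm (partial j w x) < 1 / (16 * (T + 1))" for j
    using T by simp
  then have "\<forall>\<^sub>F x in at_infinity. norm (mixed_partial 1 0 w x) < 1 / (16 * (T + 1))
      \<and> norm (mixed_partial 0 1 w x) < 1 / (16 * (T + 1))"
    by (intro eventually_conj) (simp_all add: mixed_partial_def)
  then show thesis using that unfolding eventually_at_infinity by blast
qed

text \<open>Degenerate points are excluded up to and including \<open>t = T\<close>, although
  \<open>S1\<close> stops before \<open>T\<close>: the finiteness argument uses a compact set of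
  times.\<close>

locale nondegenerate_flow =
  fixes T :: real and w :: "real^2 \<Rightarrow> real^2"
  assumes T: "T > 0" and w: "w \<in> C3_0"
    and nondeg: "\<And>t x. 0 \<le> t \<Longrightarrow> t \<le> T \<Longrightarrow> \<not> degenerate t (jet w x)"
begin

lemma C3: "Ck_on 3 w UNIV" using w by (simp add: C3_0_def C3_def)

abbreviation "G \<equiv> \<lambda>z. det_jet (fst z) (jet w (snd z))"

text \<open>At \<open>t = 0\<close> the determinant is 1, and rank zero is impossible by
  \<open>degenerate_if_cols_0\<close>. So \<open>S1\<close> is the full zero set of \<open>G\<close>
  in an open slab, and the boundary \<open>t = 0\<close> plays no part in the local
  analysis.\<close>

lemma S1_iff: "(t, x) \<in> S1 T w \<longleftrightarrow> 0 < t \<and> t < T \<and> G (t, x) = 0"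
proof -
  have "G (0, x) = 1" by (simp add: det_jet_defs cross2_def axis_def jet_def)
  moreover have "flow_jacobian w (t, x) \<noteq> 0" if "0 \<le> t" "t < T"
    using nondeg[of t x] that degenerate_if_cols_0[of t "jet w x"] by (auto simp: flow_jacobian_eq_0_iff)
  ultimately show ?thesis
    by (cases "t = 0") (auto simp: S1_def rank_2x2 det_flow_jacobian)
qed

definition W :: "(real \<times> (real^2)) set" where "W = {0<..<T} \<times> UNIV"

lemma open_W: "open W" unfolding W_def by (intro open_Times) auto

lemma S1_Int_W: "S1 T w \<inter> W = {z \<in> W. G z = 0}" "S1 T w \<subseteq> W"
  using S1_iff by (auto simp: W_def)

lemma dir_deriv_G:
  "dir_deriv (1, 0) G z = det_t (fst z) (jet w (snd z))"
  "dir_deriv (0, axis 1 1) G z = det_1 (fst z) (jet w (snd z))"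
  "dir_deriv (0, axis 2 1) G z = det_2 (fst z) (jet w (snd z))"
  using dir_deriv_eqI[OF det_jet_derivs(1)[OF C3, of z]] by (auto simp: axis_def)

lemma Ck_on_G: "Ck_on 2 G W"
  by (rule Ck_on_subset[OF Ck_on_det_jet[OF C3]]) auto

lemma embedded_submanifold_S1: "embedded_submanifold 2 2 (S1 T w)"
proof -
  have "\<exists>W g e. open W \<and> p \<in> W \<and> Ck_on (Suc 1) g W \<and> S1 T w \<inter> W = {z \<in> W. g z = 0}
    \<and> e \<in> Basis \<and> dir_deriv e g p \<noteq> (0::real)" if p: "p \<in> S1 T w" for p
  proof -
    have "\<not> degenerate (fst p) (jet w (snd p))" "G p = 0"
      using p S1_iff[of "fst p" "snd p"] nondeg[of "fst p" "snd p"] by auto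
    \<comment> \<open>If all three first derivatives vanished, so would the product in
      \<open>degenerate\<close>, since \<open>det_t\<close> is a factor of it.\<close>
    then obtain e where "e \<in> {(1, 0), (0, axis 1 1), (0, axis 2 1)}" "dir_deriv e G p \<noteq> 0"
      unfolding degenerate_def dir_deriv_G[symmetric] by fastforce
    moreover from this(1) have "e \<in> Basis"
      by (auto simp: Basis_prod_def axis_in_Basis_iff)
    ultimately show ?thesis
      using open_W S1_Int_W p Ck_on_G unfolding Suc_1
      by (intro exI[of _ W] exI[of _ G] exI[of _ e]) auto
  qed
  from embedded_submanifold_zero_set[of "S1 T w" 1, OF this] show ?thesis
    by (simp add: numeral_2_eq_2)
qed

text \<open>For every \<open>v\<close> some curve in \<open>S1\<close> passes through
  \<open>p\<close> with velocity \<open>(0, v)\<close>. Since \<open>G\<close> vanishes along it,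
  the chain rule kills the derivative of \<open>G\<close> in that direction.\<close>

lemma perpendicular_imp:
  assumes p: "p \<in> S1 T w" and perp: "perpendicular_to_t_axis (S1 T w) p"
  shows "det_1 (fst p) (jet w (snd p)) = 0" "det_2 (fst p) (jet w (snd p)) = 0"
proof -
  have "dir_deriv (0, v) G p = 0" for v
  proof -
    have "(0, v) \<in> tangent_space (S1 T w) p"
      using perp by (simp add: perpendicular_to_t_axis_def)
    then obtain \<gamma> e where \<gamma>: "e > 0" "\<gamma> ` {-e<..<e} \<subseteq> S1 T w" "\<gamma> 0 = p"
      "(\<gamma> has_vector_derivative (0, v)) (at 0)"
      unfolding tangent_space_def by blast
    let ?D = "\<lambda>h. dir_deriv h G p"
    have dG: "(G has_derivative ?D) (at (\<gamma> 0))"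
      unfolding \<gamma>(3) using det_jet_derivs(1)[OF C3, of p]
      by (intro has_derivative_dir_deriv) (auto simp: differentiable_def)
    have "((\<lambda>s. G (\<gamma> s)) has_derivative (\<lambda>s. ?D (s *\<^sub>R (0, v)))) (at 0)"
      using has_derivative_compose[of \<gamma> "\<lambda>s. s *\<^sub>R (0, v)" 0 UNIV G ?D] dG \<gamma>(4)
      unfolding has_vector_derivative_def by blast
    then have "((\<lambda>s. 0) has_derivative (\<lambda>s. ?D (s *\<^sub>R (0, v)))) (at 0)"
    proof (rule has_derivative_transform_within_open[OF _ open_greaterThanLessThan[of "-e" e]])
      fix s assume "s \<in> {-e<..<e}"
      then have "\<gamma> s \<in> S1 T w" using \<gamma>(2) by blast
      then show "G (\<gamma> s) = 0" using S1_iff[of "fst (\<gamma> s)" "snd (\<gamma> s)"] by simp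
    qed (use \<gamma>(1) in simp)
    from fun_cong[OF has_derivative_unique[OF this has_derivative_const], of 1]
    show ?thesis by simp
  qed
  then show "det_1 (fst p) (jet w (snd p)) = 0" "det_2 (fst p) (jet w (snd p)) = 0"
    unfolding dir_deriv_G[symmetric] by blast+
qed

lemma perpendicular_nonzero:
  assumes p: "p \<in> S1 T w" and perp: "perpendicular_to_t_axis (S1 T w) p"
  shows "det_t (fst p) (jet w (snd p)) \<noteq> 0"
    "det_11 (fst p) (jet w (snd p)) * det_22 (fst p) (jet w (snd p)) - (det_12 (fst p) (jet w (snd p)))\<^sup>2 \<noteq> 0"
  using nondeg[of "fst p" "snd p"] perpendicular_imp[OF assms] p S1_iff[of "fst p" "snd p"]
  unfolding degenerate_def by auto

lemma continuous_on_dets: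
  "continuous_on UNIV G"
  "continuous_on UNIV (\<lambda>z. det_1 (fst z) (jet w (snd z)))"
  "continuous_on UNIV (\<lambda>z. det_2 (fst z) (jet w (snd z)))"
  using det_jet_derivs[OF C3] has_derivative_continuous
  by (auto simp: continuous_on_eq_continuous_at) blast+

text \<open>All perpendicular points lie in the compact set \<open>Z\<close> of common zeros of
  \<open>G\<close> and its spatial derivatives. No point of \<open>Z\<close> is a limit point of it,
  so \<open>Z\<close> is finite.\<close>

lemma finite_perpendicular: "finite {p \<in> S1 T w. perpendicular_to_t_axis (S1 T w) p}"
proof -
  define \<Phi> where "\<Phi> z = (G z, det_1 (fst z) (jet w (snd z)), det_2 (fst z) (jet w (snd z)))" for z
  from C3_0_partials_small[OF w T] obtain R where R: "\<And>x. R \<le> norm x \<Longrightarrow>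
    norm (mixed_partial 1 0 w x) < 1 / (16 * (T + 1)) \<and> norm (mixed_partial 0 1 w x) < 1 / (16 * (T + 1))"
    by metis
  have pos: "G (t, x) > 0" if "0 \<le> t" "t \<le> T" "R \<le> norm x" for t x
  proof -
    have "1 / (16 * (T + 1)) \<le> 1 / (8 * (T + 1))" using T by (simp add: field_simps)
    then show ?thesis using R[OF that(3)] that by (simp add: det_jet_pos jet_def)
  qed
  \<comment> \<open>For times in the closed interval, \<open>G\<close> is positive outside the ball
    of radius \<open>R\<close>, so its zeros lie in \<open>K\<close>.\<close>
  define K where "K = {0..T} \<times> cball (0::real^2) R"
  define Z where "Z = K \<inter> {z. \<Phi> z = 0}"
  have "continuous_on UNIV \<Phi>"
    unfolding \<Phi>_def by (intro continuous_intros continuous_on_dets)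
  then have "closed {z. \<Phi> z = 0}" by (intro closed_Collect_eq) auto
  moreover have "compact K" unfolding K_def by (intro compact_Times) auto
  ultimately have "compact Z" unfolding Z_def by (rule compact_Int_closed[rotated])
  have "\<not> z islimpt Z" if "z \<in> Z" for z
  proof -
    have z: "0 \<le> fst z" "fst z \<le> T" "\<Phi> z = 0" using that by (auto simp: Z_def K_def)
    let ?J = "jet w (snd z)"
    obtain c where c: "((\<lambda>z. det_1 (fst z) (jet w (snd z))) has_derivative
      (\<lambda>h. fst h * c + (snd h)$1 * det_11 (fst z) ?J + (snd h)$2 * det_12 (fst z) ?J)) (at z)"
      using det_jet_derivs(2)[OF C3, of z] by blast
    obtain d where d: "((\<lambda>z. det_2 (fst z) (jet w (snd z))) has_derivative
      (\<lambda>h. fst h * d + (snd h)$1 * det_12 (fst z) ?J + (snd h)$2 * det_22 (fst z) ?J)) (at z)"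
      using det_jet_derivs(3)[OF C3, of z] by blast
    have der: "(\<Phi> has_derivative (\<lambda>h.
        (fst h * det_t (fst z) ?J + (snd h)$1 * det_1 (fst z) ?J + (snd h)$2 * det_2 (fst z) ?J,
         fst h * c + (snd h)$1 * det_11 (fst z) ?J + (snd h)$2 * det_12 (fst z) ?J,
         fst h * d + (snd h)$1 * det_12 (fst z) ?J + (snd h)$2 * det_22 (fst z) ?J))) (at z)"
      unfolding \<Phi>_def by (intro has_derivative_Pair det_jet_derivs(1)[OF C3] c d)
    have 0: "G z = 0" "det_1 (fst z) ?J = 0" "det_2 (fst z) ?J = 0"
      using z(3) by (simp_all add: \<Phi>_def zero_prod_def)
    then have nz: "det_t (fst z) ?J \<noteq> 0" "det_11 (fst z) ?J * det_22 (fst z) ?J - (det_12 (fst z) ?J)\<^sup>2 \<noteq> 0"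
      using nondeg[OF z(1,2), of "snd z"] unfolding degenerate_def by auto
    \<comment> \<open>With \<open>det_1\<close> and \<open>det_2\<close> zero, the derivative of
      \<open>\<Phi>\<close> is block triangular, with \<open>det_t\<close> for time and the spatial
      Hessian of \<open>G\<close> as diagonal blocks, both invertible.\<close>
    have "\<not> z islimpt {y. \<Phi> y = \<Phi> z}"
    proof (rule isolated_in_fibre[OF der])
      fix h :: "real \<times> (real^2)"
      let ?a = "det_11 (fst z) ?J" and ?b = "det_12 (fst z) ?J" and ?c = "det_22 (fst z) ?J"
      assume "(fst h * det_t (fst z) ?J + (snd h)$1 * det_1 (fst z) ?J + (snd h)$2 * det_2 (fst z) ?J,
         fst h * c + (snd h)$1 * ?a + (snd h)$2 * ?b, fst h * d + (snd h)$1 * ?b + (snd h)$2 * ?c) = 0"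
      with 0 nz have h: "fst h = 0" "(snd h)$1 * ?a + (snd h)$2 * ?b = 0" "(snd h)$1 * ?b + (snd h)$2 * ?c = 0"
        by (auto simp: zero_prod_def)
      \<comment> \<open>Cramer's rule for the symmetric system in \<open>h(2,3)\<close>.\<close>
      have "(snd h)$1 * (?a * ?c - ?b\<^sup>2)
          = ((snd h)$1 * ?a + (snd h)$2 * ?b) * ?c - ((snd h)$1 * ?b + (snd h)$2 * ?c) * ?b"
        by (simp add: algebra_simps power2_eq_square)
      also have "\<dots> = 0" unfolding h(2,3) by simp
      finally have 1: "(snd h)$1 * (?a * ?c - ?b\<^sup>2) = 0" .
      have "(snd h)$2 * (?a * ?c - ?b\<^sup>2)
          = ((snd h)$1 * ?b + (snd h)$2 * ?c) * ?a - ((snd h)$1 * ?a + (snd h)$2 * ?b) * ?b"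
        by (simp add: algebra_simps power2_eq_square)
      also have "\<dots> = 0" unfolding h(2,3) by simp
      finally have 2: "(snd h)$2 * (?a * ?c - ?b\<^sup>2) = 0" .
      from 1 2 nz(2) have "(snd h)$1 = 0" "(snd h)$2 = 0" by simp_all
      with h(1) show "h = 0" by (simp add: prod_eq_iff vec_eq_iff forall_2)
    qed
    moreover have "Z \<subseteq> {y. \<Phi> y = \<Phi> z}" using z(3) by (auto simp: Z_def)
    ultimately show ?thesis using islimpt_subset by blast
  qed
  with \<open>compact Z\<close> have "finite Z"
    by (metis compact_eq_Bolzano_Weierstrass order_refl)
  moreover have "{p \<in> S1 T w. perpendicular_to_t_axis (S1 T w) p} \<subseteq> Z"
  proof
    fix p assume "p \<in> {p \<in> S1 T w. perpendicular_to_t_axis (S1 T w) p}"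
    then have p: "p \<in> S1 T w" "perpendicular_to_t_axis (S1 T w) p" by auto
    obtain t x where tx: "p = (t, x)" by fastforce
    have "0 < t" "t < T" "G (t, x) = 0" using p(1) S1_iff[of t x] tx by auto
    moreover from this have "\<not> R \<le> norm x" using pos[of t x] by fastforce
    ultimately show "p \<in> Z"
      using perpendicular_imp[OF p] by (simp add: Z_def K_def tx \<Phi>_def zero_prod_def)
  qed
  ultimately show ?thesis by (rule finite_subset[rotated])
qed

lemma perpendicular_local_graph:
  assumes p: "p \<in> S1 T w" and perp: "perpendicular_to_t_axis (S1 T w) p"
  shows "\<exists>\<tau>. local_graph_at (S1 T w) p \<tau>"
proof (rule local_graph_at_zero_set[OF open_W _ Ck_on_G S1_Int_W(1) p])
  show "p \<in> W" using S1_Int_W(2) p by blast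
  show "dir_deriv (1, 0) G p \<noteq> 0"
    using perpendicular_nonzero[OF assms] by (simp add: dir_deriv_G)
qed

text \<open>The trace is the eigenvalue. It is nonzero by \<open>time_det_t\<close>, as
  \<open>t > 0\<close>, \<open>G = 0\<close> and \<open>det_t\<close> does not vanish at a
  perpendicular point.\<close>

lemma perpendicular_eigenvalue:
  assumes p: "p \<in> S1 T w" and perp: "perpendicular_to_t_axis (S1 T w) p"
  shows "\<exists>c. c \<noteq> 0 \<and> eigenvalue (flow_jacobian w p) c"
proof -
  obtain t x where tx: "p = (t, x)" by fastforce
  have "rank (flow_jacobian w p) = 1" using p by (simp add: S1_def)
  then have "eigenvalue (flow_jacobian w p) (flow_jacobian w p $ 1 $ 1 + flow_jacobian w p $ 2 $ 2)"
    by (intro eigenvalue_trace_2x2) (auto simp: rank_2x2)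
  moreover have "t * det_t t (jet w x) \<noteq> 0"
    using perpendicular_nonzero[OF assms] S1_iff[of t x] p tx by auto
  then have "flow_jacobian w p $ 1 $ 1 + flow_jacobian w p $ 2 $ 2 \<noteq> 0"
    using time_det_t[of t "jet w x"] S1_iff[of t x] p tx by (auto simp: flow_jacobian_nth)
  ultimately show ?thesis by blast
qed

text \<open>Differentiating \<open>G (\<tau> x, x) = 0\<close> once gives
  \<open>G_t \<tau>_i + G_i = 0\<close> near the point; a second differentiation at the point, where
  \<open>\<tau>_i = 0\<close>, gives \<open>G_t \<tau>_ij + G_ij = 0\<close>.\<close>

lemma perpendicular_hessian:
  assumes p: "p \<in> S1 T w" and perp: "perpendicular_to_t_axis (S1 T w) p"
    and \<tau>: "local_graph_at (S1 T w) p \<tau>"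
  shows "rank (hessian \<tau> (snd p)) = 2"
proof -
  from \<tau> obtain U V where U: "open U" "p \<in> U" and V: "open V" "snd p \<in> V" and C2: "Ck_on 2 \<tau> V"
    and SU: "S1 T w \<inter> U = (\<lambda>x. (\<tau> x, x)) ` V"
    unfolding local_graph_at_def by blast
  define y where "y = snd p"
  have py: "p = (\<tau> y, y)"
    using p U SU unfolding y_def by (metis (no_types, lifting) IntI imageE snd_conv)
  define Gt where "Gt x = det_t (\<tau> x) (jet w x)" for x
  define Gi where "Gi i x = (if i = 1 then det_1 (\<tau> x) (jet w x) else det_2 (\<tau> x) (jet w x))" for i :: 2 and x
  have d\<tau>: "(\<tau> has_derivative (\<lambda>h. h$1 *\<^sub>R partial 1 \<tau> x + h$2 *\<^sub>R partial 2 \<tau> x)) (at x)" if "x \<in> V" for x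
    using C2 that by (intro has_derivative_partial) (simp add: numeral_2_eq_2)
  have dgr: "((\<lambda>x. (\<tau> x, x)) has_derivative (\<lambda>h. (h$1 *\<^sub>R partial 1 \<tau> x + h$2 *\<^sub>R partial 2 \<tau> x, h))) (at x)"
    if "x \<in> V" for x
    by (intro has_derivative_Pair d\<tau>[OF that] has_derivative_ident)
  have first: "Gt x * partial i \<tau> x + Gi i x = 0" if x: "x \<in> V" for i x
  proof -
    have "((\<lambda>x. G (\<tau> x, x)) has_derivative (\<lambda>h. (h$1 *\<^sub>R partial 1 \<tau> x + h$2 *\<^sub>R partial 2 \<tau> x) * Gt x
        + h$1 * Gi 1 x + h$2 * Gi 2 x)) (at x)"
      using has_derivative_compose[OF dgr[OF x] det_jet_derivs(1)[OF C3]] by (simp add: Gt_def Gi_def)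
    then have "((\<lambda>x. 0) has_derivative (\<lambda>h. (h$1 *\<^sub>R partial 1 \<tau> x + h$2 *\<^sub>R partial 2 \<tau> x) * Gt x
        + h$1 * Gi 1 x + h$2 * Gi 2 x)) (at x)"
    proof (rule has_derivative_transform_within_open[OF _ V(1) x])
      fix x assume "x \<in> V"
      then have "(\<tau> x, x) \<in> S1 T w" using SU by blast
      then show "G (\<tau> x, x) = 0" using S1_iff by blast
    qed
    from fun_cong[OF has_derivative_unique[OF this has_derivative_const]]
    have "(h$1 *\<^sub>R partial 1 \<tau> x + h$2 *\<^sub>R partial 2 \<tau> x) * Gt x + h$1 * Gi 1 x + h$2 * Gi 2 x = 0" for h :: "real^2" .
    from this[of "axis 1 1"] this[of "axis 2 1"] show ?thesis
      using exhaust_2[of i] by (auto simp: axis_def mult.commute)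
  qed
  have Gt: "Gt y \<noteq> 0" using perpendicular_nonzero[OF p perp] py by (simp add: Gt_def)
  have yV: "y \<in> V" using V(2) by (simp add: y_def)
  have Gi0: "Gi i y = 0" for i using perpendicular_imp[OF p perp] py by (simp add: Gi_def)
  have \<tau>0: "partial i \<tau> y = 0" for i using first[OF yV, of i] Gi0[of i] Gt by simp
  \<comment> \<open>Bare differentiability of \<open>Gt\<close> is enough: in the product rule its
    derivative is multiplied by \<open>partial i \<tau> y = 0\<close>.\<close>
  have dGt: "Gt differentiable (at y)"
    using det_jet_derivs(4)[OF C3, of "(\<tau> y, y)"] has_derivative_compose[OF dgr[OF yV]]
    unfolding differentiable_def Gt_def by fastforce
  define H :: "2 \<Rightarrow> 2 \<Rightarrow> real" where "H i j = (if i = j then if i = 1 then det_11 (\<tau> y) (jet w y) else det_22 (\<tau> y) (jet w y)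
    else det_12 (\<tau> y) (jet w y))" for i j
  \<comment> \<open>The derivative of \<open>\<tau>\<close> vanishes at \<open>y\<close>, so the
    time coefficients \<open>c\<close> and \<open>d\<close> drop out and only the spatial Hessian
    \<open>H\<close> of \<open>G\<close> remains.\<close>
  have dGi: "(Gi i has_derivative (\<lambda>h. h$1 * H i 1 + h$2 * H i 2)) (at y)" for i
  proof -
    obtain c where c: "((\<lambda>z. det_1 (fst z) (jet w (snd z))) has_derivative
      (\<lambda>h. fst h * c + (snd h)$1 * det_11 (\<tau> y) (jet w y) + (snd h)$2 * det_12 (\<tau> y) (jet w y))) (at (\<tau> y, y))"
      using det_jet_derivs(2)[OF C3, of "(\<tau> y, y)"] by auto
    obtain d where d: "((\<lambda>z. det_2 (fst z) (jet w (snd z))) has_derivative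
      (\<lambda>h. fst h * d + (snd h)$1 * det_12 (\<tau> y) (jet w y) + (snd h)$2 * det_22 (\<tau> y) (jet w y))) (at (\<tau> y, y))"
      using det_jet_derivs(3)[OF C3, of "(\<tau> y, y)"] by auto
    from has_derivative_compose[OF dgr[OF yV] c] has_derivative_compose[OF dgr[OF yV] d]
    show ?thesis
      using exhaust_2[of i] by (auto simp: Gi_def[abs_def] H_def \<tau>0)
  qed
  have second: "Gt y * partial j (partial i \<tau>) y + H i j = 0" for i j
  proof -
    have di: "(partial i \<tau> has_derivative (\<lambda>h. dir_deriv h (partial i \<tau>) y)) (at y)"
      using C2 yV unfolding partial_def
      by (intro has_derivative_dir_deriv) (auto simp: numeral_2_eq_2 axis_in_Basis_iff)
    have "((\<lambda>x. Gt x * partial i \<tau> x + Gi i x) has_derivative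
      (\<lambda>h. (Gt y * dir_deriv h (partial i \<tau>) y + dir_deriv h Gt y * partial i \<tau> y) + (h$1 * H i 1 + h$2 * H i 2))) (at y)"
      by (intro has_derivative_add has_derivative_mult di has_derivative_dir_deriv dGt dGi)
    then have "((\<lambda>x. 0) has_derivative
      (\<lambda>h. (Gt y * dir_deriv h (partial i \<tau>) y + dir_deriv h Gt y * partial i \<tau> y) + (h$1 * H i 1 + h$2 * H i 2))) (at y)"
      by (rule has_derivative_transform_within_open[OF _ V(1) yV]) (rule first)
    from fun_cong[OF has_derivative_unique[OF this has_derivative_const]]
    have "(Gt y * dir_deriv h (partial i \<tau>) y + dir_deriv h Gt y * partial i \<tau> y) + (h$1 * H i 1 + h$2 * H i 2) = 0" for h .
    note this[of "axis j 1"]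
    moreover have pj: "dir_deriv (axis j 1) f y = partial j f y" for f :: "real^2 \<Rightarrow> real" by (simp add: partial_def)
    ultimately show ?thesis
      using exhaust_2[of j] by (auto simp: pj \<tau>0 axis_def)
  qed
  have eq: "partial j (partial i \<tau>) y = - H i j / Gt y" for i j
    using second[of j i] Gt by (simp add: field_simps add_eq_0_iff)
  have "det (hessian \<tau> y) = (det_11 (\<tau> y) (jet w y) * det_22 (\<tau> y) (jet w y) - (det_12 (\<tau> y) (jet w y))\<^sup>2) / (Gt y)\<^sup>2"
    using Gt by (simp add: Determinants.det_2 hessian_def eq H_def power2_eq_square field_simps)
  also have "\<dots> \<noteq> 0" using perpendicular_nonzero[OF p perp] py Gt by simp
  finally show ?thesis unfolding rank_2x2 y_def .
qed

end

section \<open>Openness\<close>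

lemma continuous_on_jet:
  assumes "Ck_on 3 w UNIV"
  shows "continuous_on UNIV (jet w)"
proof -
  have "continuous_on UNIV (mixed_partial a b w)" if "a + b \<le> 3" for a b
    using Ck_on_mixed_partial[OF assms, of a b 0] that by simp
  then show ?thesis
    unfolding jet_def by (intro continuous_intros) simp_all
qed

text \<open>Nine entries, each contributing at most twice the distance.\<close>

lemma dist_jet_le:
  assumes "v \<in> C3" "w \<in> C3"
  shows "dist (jet v x) (jet w x) \<le> 18 * C3_dist v w"
proof -
  have P: "norm (p, q) \<le> r + s" if "norm p \<le> r" "norm q \<le> s"
    for p :: "'a::real_normed_vector" and q :: "'b::real_normed_vector" and r s
    using norm_Pair_le[of p q] that by linarith
  note n = norm_mixed_partial_diff_le[OF assms, of _ _ x]
  have "norm (jet v x - jet w x) \<le> 2 * C3_dist v w + (2 * C3_dist v w + (2 * C3_dist v w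
    + (2 * C3_dist v w + (2 * C3_dist v w + (2 * C3_dist v w + (2 * C3_dist v w
    + (2 * C3_dist v w + 2 * C3_dist v w)))))))"
    unfolding jet_def diff_Pair by (intro P n) simp_all
  then show ?thesis by (simp add: dist_norm)
qed

text \<open>Positivity far from the origin, with one radius \<open>R\<close> common to all fields
  close to \<open>w\<close>.\<close>

lemma det_jet_pos_far:
  assumes T: "T > 0" and w: "w \<in> C3_0"
  obtains R e where "e > 0" "\<And>v t x. v \<in> C3_0 \<Longrightarrow> C3_dist v w < e \<Longrightarrow> 0 \<le> t \<Longrightarrow> t \<le> T \<Longrightarrow> R \<le> norm x \<Longrightarrow>
    det_jet t (jet v x) > 0"
proof -
  define c where "c = 1 / (16 * (T + 1))"
  have c: "c > 0" "c + c = 1 / (8 * (T + 1))" using T by (simp_all add: c_def field_simps)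
  from C3_0_partials_small[OF w T] obtain R where R: "\<And>x. R \<le> norm x \<Longrightarrow>
    norm (mixed_partial 1 0 w x) < c \<and> norm (mixed_partial 0 1 w x) < c"
    unfolding c_def by metis
  have w3: "w \<in> C3" using w by (simp_all add: C3_0_def)
  show thesis
  \<comment> \<open>By the factor 2 in \<open>norm_mixed_partial_diff_le\<close>, a distance below
    \<open>c / 2\<close> changes first derivatives by at most \<open>c\<close>, and
    \<open>c + c\<close> is the bound of \<open>det_jet_pos\<close>.\<close>
  proof (rule that[of "c / 2" R])
    show "c / 2 > 0" using c by simp
    fix v t and x :: "real^2" assume v: "v \<in> C3_0" and dist: "C3_dist v w < c / 2" and t: "0 \<le> t" "t \<le> T" and x: "R \<le> norm x"
    have v3: "v \<in> C3" using v by (simp add: C3_0_def)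
    have "norm (mixed_partial a b v x) \<le> norm (mixed_partial a b w x) + c"
      if "a + b \<le> 3" for a b
      using norm_mixed_partial_diff_le[OF v3 w3 that, of x] dist
        norm_triangle_sub[of "mixed_partial a b v x" "mixed_partial a b w x"]
      by linarith
    from this[of 1 0] this[of 0 1]
    have "norm (mixed_partial 1 0 v x) \<le> norm (mixed_partial 1 0 w x) + c"
      "norm (mixed_partial 0 1 v x) \<le> norm (mixed_partial 0 1 w x) + c" by simp_all
    moreover have "norm (mixed_partial 1 0 w x) < c" "norm (mixed_partial 0 1 w x) < c"
      using R[OF x] by simp_all
    ultimately have "norm (mixed_partial 1 0 v x) \<le> 1 / (8 * (T + 1))" "norm (mixed_partial 0 1 v x) \<le> 1 / (8 * (T + 1))"
      using c(2) by linarith+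
    then have "norm (fst (jet v x)) \<le> 1 / (8 * (T + 1))" "norm (fst (snd (jet v x))) \<le> 1 / (8 * (T + 1))"
      unfolding jet_def by simp_all
    then show "det_jet t (jet v x) > 0" by (rule det_jet_pos[OF t])
  qed
qed

text \<open>Far out, positivity of the determinant excludes \<open>P\<close> for all nearby fields.
  Over the remaining ball the pairs of time and jet form a compact set disjoint from a closed one,
  hence at positive distance, and jets depend uniformly on the field.\<close>

lemma open_jet_condition:
  assumes T: "T > 0" and closed: "closed {z. P (fst z) (snd z)}"
    and P: "\<And>t J. P t J \<Longrightarrow> det_jet t J = 0"
    and w: "w \<in> C3_0" and avoid: "\<And>t x. 0 \<le> t \<Longrightarrow> t \<le> T \<Longrightarrow> \<not> P t (jet w x)"
  obtains e where "e > 0"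
    "\<And>v t x. v \<in> C3_0 \<Longrightarrow> C3_dist v w < e \<Longrightarrow> 0 \<le> t \<Longrightarrow> t \<le> T \<Longrightarrow> \<not> P t (jet v x)"
proof -
  from det_jet_pos_far[OF T w] obtain R c where c: "c > 0"
    and R: "\<And>v t x. v \<in> C3_0 \<Longrightarrow> C3_dist v w < c \<Longrightarrow> 0 \<le> t \<Longrightarrow> t \<le> T \<Longrightarrow> R \<le> norm x \<Longrightarrow>
    det_jet t (jet v x) > 0"
    by metis
  have w3: "w \<in> C3" "Ck_on 3 w UNIV" using w by (simp_all add: C3_0_def C3_def)
  define K where "K = (\<lambda>z. (fst z, jet w (snd z))) ` ({0..T} \<times> cball (0::real^2) R)"
  have "continuous_on ({0..T} \<times> cball (0::real^2) R) (\<lambda>z. (fst z, jet w (snd z)))"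
    by (intro continuous_intros continuous_on_compose2[OF continuous_on_jet[OF w3(2)]]) auto
  then have K: "compact K" unfolding K_def by (intro compact_continuous_image compact_Times) auto
  have disj: "K \<inter> {z. P (fst z) (snd z)} = {}" using avoid by (auto simp: K_def)
  from separate_compact_closed[OF K closed disj] obtain d where d0: "d > 0"
    and "\<forall>y\<in>K. \<forall>z\<in>{z. P (fst z) (snd z)}. d \<le> dist y z" by blast
  then have d: "d > 0" "\<And>y z. y \<in> K \<Longrightarrow> P (fst z) (snd z) \<Longrightarrow> d \<le> dist y z" by auto
  show thesis
  \<comment> \<open>The first bound serves the far region; the second, with the constant of
    \<open>dist_jet_le\<close>, moves jets by less than \<open>d\<close>.\<close>
  proof (rule that[of "min c (d / 18)"])
    show "min c (d / 18) > 0" using d(1) c by simp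
    fix v t and x :: "real^2" assume v: "v \<in> C3_0" and dist: "C3_dist v w < min c (d / 18)" and t: "0 \<le> t" "t \<le> T"
    have v3: "v \<in> C3" using v by (simp add: C3_0_def)
    show "\<not> P t (jet v x)"
    proof (cases "R \<le> norm x")
      case True
      then show ?thesis using R[OF v _ t, of x] dist P[of t "jet v x"] by auto
    next
      case False
      have "dist (t, jet w x) (t, jet v x) < d"
        using dist_jet_le[OF v3 w3(1), of x] dist by (simp add: dist_Pair_Pair dist_commute)
      moreover have "(t, jet w x) \<in> K" using t False unfolding K_def by force
      ultimately show ?thesis using d(2)[of "(t, jet w x)" "(t, jet v x)"] by force
    qed
  qed
qed

text \<open>The excluded condition is a parameter because openness and approximation are shown for
  several conditions in turn. The closed time interval provides compactness.\<close>

definition generic :: "real \<Rightarrow> (real \<Rightarrow> jet \<Rightarrow> bool) \<Rightarrow> (real^2 \<Rightarrow> real^2) set" where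
  "generic T P = {w \<in> C3_0. \<forall>t x. 0 \<le> t \<longrightarrow> t \<le> T \<longrightarrow> \<not> P t (jet w x)}"

lemma openin_generic:
  assumes "T > 0" "closed {z. P (fst z) (snd z)}" "\<And>t J. P t J \<Longrightarrow> det_jet t J = 0"
  shows "openin C3_0_topology (generic T P)"
proof -
  interpret Metric_space C3_0 C3_dist by (rule Metric_space_C3_0)
  have "\<exists>r>0. mball w r \<subseteq> generic T P" if w: "w \<in> generic T P" for w
  proof -
    obtain e where e: "e > 0"
      "\<And>v t x. v \<in> C3_0 \<Longrightarrow> C3_dist v w < e \<Longrightarrow> 0 \<le> t \<Longrightarrow> t \<le> T \<Longrightarrow> \<not> P t (jet v x)"
      by (rule open_jet_condition[OF assms, of w]) (use w in \<open>auto simp: generic_def\<close>)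
    then show ?thesis
      by (intro exI[of _ e]) (auto simp: generic_def mball_def commute)
  qed
  then show ?thesis
    unfolding C3_0_topology_def openin_mtopology by (auto simp: generic_def)
qed

text \<open>The entry of \<open>I + t Dw\<close> in row \<open>i\<close> and column \<open>j\<close> has the largest modulus.\<close>

definition dominant :: "2 \<Rightarrow> 2 \<Rightarrow> real \<Rightarrow> jet \<Rightarrow> bool" where
  "dominant i j t J \<longleftrightarrow> (\<forall>k. \<bar>col1 t J $ k\<bar> \<le> \<bar>(if j = 1 then col1 t J else col2 t J) $ i\<bar>)
    \<and> (\<forall>k. \<bar>col2 t J $ k\<bar> \<le> \<bar>(if j = 1 then col1 t J else col2 t J) $ i\<bar>)"

lemma exists_dominant: "\<exists>i j. dominant i j t J"
proof -
  let ?f = "\<lambda>(i::2, j::2). \<bar>(if j = 1 then col1 t J else col2 t J) $ i\<bar>"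
  have "finite (range ?f)" "range ?f \<noteq> {}" by simp_all
  from Max_in[OF this] obtain i j where ij: "Max (range ?f) = ?f (i, j)" by force
  have "?f (k, l) \<le> ?f (i, j)" for k l
    unfolding ij[symmetric] by (rule Max_ge[OF _ rangeI]) simp
  from this[of _ 1] this[of _ 2] show ?thesis unfolding dominant_def by (intro exI[of _ i] exI[of _ j]) auto
qed

lemma continuous_on_jet_functions:
  "continuous_on UNIV (\<lambda>z. col1 (fst z) (snd z))" "continuous_on UNIV (\<lambda>z. col2 (fst z) (snd z))"
  "continuous_on UNIV (\<lambda>z. det_jet (fst z) (snd z))" "continuous_on UNIV (\<lambda>z. det_t (fst z) (snd z))"
  "continuous_on UNIV (\<lambda>z. det_1 (fst z) (snd z))" "continuous_on UNIV (\<lambda>z. det_2 (fst z) (snd z))"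
  "continuous_on UNIV (\<lambda>z. det_11 (fst z) (snd z))" "continuous_on UNIV (\<lambda>z. det_12 (fst z) (snd z))"
  "continuous_on UNIV (\<lambda>z. det_22 (fst z) (snd z))"
  unfolding det_jet_defs case_prod_beta cross2_def by (intro continuous_intros)+

text \<open>Nonvanishing of a given entry is not a closed condition, but maximality of its modulus
  is, being made of weak inequalities. By \<open>exists_dominant\<close> the four cases cover all
  degenerate points.\<close>

lemma closed_degenerate_dominant:
  "closed {z. degenerate (fst z) (snd z) \<and> dominant i j (fst z) (snd z)}"
proof -
  have "continuous_on UNIV (\<lambda>z. if j = 1 then col1 (fst z) (snd z) else col2 (fst z) (snd z))"
    by (cases "j = 1") (simp_all add: continuous_on_jet_functions)
  then show ?thesis
    unfolding degenerate_def dominant_def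
    by (intro closed_Collect_conj closed_Collect_all closed_Collect_eq closed_Collect_le
        continuous_intros continuous_on_jet_functions)
qed

lemma closed_cols_0: "closed {z. col1 (fst z) (snd z) = 0 \<and> col2 (fst z) (snd z) = 0}"
  by (intro closed_Collect_conj closed_Collect_eq continuous_on_jet_functions continuous_intros)

section \<open>Critical values of the parameter map\<close>

text \<open>Vanishing to first order survives multiplication by a differentiable function; the
  stationarity of \<open>\<Psi>\<close> in the next proof rests on this.\<close>

lemma DERIV_zero_mult:
  fixes f g :: "real \<Rightarrow> real"
  assumes "f a = 0" "(f has_real_derivative 0) (at a)" "g differentiable (at a)"
  shows "((\<lambda>s. f s * g s) has_real_derivative 0) (at a)"
proof -
  obtain g' where "(g has_real_derivative g') (at a)"
    using assms(3) by (auto simp: real_differentiable_def)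
  from DERIV_mult[OF assms(2) this] show ?thesis using assms(1) by simp
qed

text \<open>\<open>F0\<close>, \<open>F1\<close>, \<open>F2\<close> are the perturbed determinant and its two partial derivatives; \<open>c\<close> and
  \<open>e\<close> are the cofactors multiplying the derivatives of the perturbation. In the proof \<open>q\<close> in
  \<open>\<real>\<^sup>4\<close> collects \<open>t\<close>, \<open>x\<^sub>i\<close>, \<open>x\<^sub>j\<close> and the value of the \<open>x\<^sub>j\<close>-derivative of the perturbation at \<open>x\<close>,
  and \<open>\<Psi> q\<close> is the unique parameter for which \<open>F0\<close>, \<open>F1\<close>, \<open>F2\<close> vanish at \<open>(t, x)\<close>.
  If they vanish at \<open>z\<close> together with their derivatives in direction \<open>h\<close>, then \<open>\<Psi>\<close> is stationary
  along a lift of \<open>h\<close>.\<close>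

lemma negligible_singular_parameters:
  fixes A A1 A2 c c1 c2 e e1 e2 :: "real \<times> (real^2) \<Rightarrow> real" and i j :: 2
  assumes diff: "\<And>f z. f \<in> {A, A1, A2, c, c1, c2, e, e1, e2} \<Longrightarrow> f differentiable (at z)"
    and ij: "i \<noteq> j"
    and F0: "\<And>p z. F0 p z = A z - fst z * ((p$1 + p$3 * snd z $ i + p$4 * snd z $ j) * c z + (p$2 + p$4 * snd z $ i) * e z)"
    and F1: "\<And>p z. F1 p z = A1 z - fst z * (p$3 * c z + p$4 * e z
      + (p$1 + p$3 * snd z $ i + p$4 * snd z $ j) * c1 z + (p$2 + p$4 * snd z $ i) * e1 z)"
    and F2: "\<And>p z. F2 p z = A2 z - fst z * (p$4 * c z
      + (p$1 + p$3 * snd z $ i + p$4 * snd z $ j) * c2 z + (p$2 + p$4 * snd z $ i) * e2 z)"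
  shows "negligible {p::real^4. \<exists>z h. fst z > 0 \<and> c z \<noteq> 0 \<and> h \<noteq> 0 \<and> (\<forall>f\<in>{F0 p, F1 p, F2 p}. f z = 0 \<and>
    (f has_derivative (\<lambda>h. dir_deriv h f z)) (at z) \<and> dir_deriv h f z = 0)}"
    (is "negligible ?Bad")
proof -
  \<comment> \<open>These are the derivatives of the perturbing polynomial with respect to the
    coordinates \<open>i\<close> and \<open>j\<close>.\<close>
  define L1 L2 where "L1 p z = p$1 + p$3 * snd z $ i + p$4 * snd z $ j" and "L2 p z = p$2 + p$4 * snd z $ i"
    for p :: "real^4" and z :: "real \<times> (real^2)"
  note F_defs = F0[folded L1_def L2_def] F1[folded L1_def L2_def] F2[folded L1_def L2_def]
  define X :: "real^4 \<Rightarrow> real \<times> (real^2)" where "X q = (q$1, q$2 *\<^sub>R axis i 1 + q$3 *\<^sub>R axis j 1)" for q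
  \<comment> \<open>Once the value \<open>q$4\<close> of \<open>L2\<close> is given, the equations
    are triangular: \<open>F0 = 0\<close> yields \<open>L1\<close>, then \<open>F2 = 0\<close>
    yields \<open>p$4\<close>, then \<open>F1 = 0\<close> yields \<open>p$3\<close>. Each step
    divides by \<open>c\<close>.\<close>
  define l where "l q = (A (X q) / q$1 - q$4 * e (X q)) / c (X q)" for q
  define b where "b q = (A2 (X q) / q$1 - l q * c2 (X q) - q$4 * e2 (X q)) / c (X q)" for q
  define a where "a q = (A1 (X q) / q$1 - b q * e (X q) - l q * c1 (X q) - q$4 * e1 (X q)) / c (X q)" for q
  \<comment> \<open>The linear coefficients are recovered from
    \<open>p$1 = L1 - p$3 x_i - p$4 x_j\<close> and \<open>p$2 = L2 - p$4 x_i\<close>.\<close>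
  define \<Psi> :: "real^4 \<Rightarrow> real^4" where
    "\<Psi> q = (l q - a q * q$2 - b q * q$3) *\<^sub>R axis 1 1 + (q$4 - b q * q$2) *\<^sub>R axis 2 1
      + a q *\<^sub>R axis 3 1 + b q *\<^sub>R axis 4 1" for q
  define S where "S = {q::real^4. q$1 > 0 \<and> c (X q) \<noteq> 0}"
  have blX: "bounded_linear X"
    unfolding X_def
    by (intro bounded_linear_Pair bounded_linear_add bounded_linear_scaleR_const bounded_linear_vec_nth)
  have X: "(\<lambda>q. f (X q)) differentiable (at q)" if "f \<in> {A, A1, A2, c, c1, c2, e, e1, e2}" for f q
    using differentiable_chain_at[OF bounded_linear_imp_differentiable[OF blX] diff[OF that]] by (simp add: o_def)
  have nth: "(\<lambda>q::real^4. q$k) differentiable (at q)" for k q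
    by (rule bounded_linear_imp_differentiable[OF bounded_linear_vec_nth])
  have d\<Psi>: "\<Psi> differentiable (at q)" if "q \<in> S" for q
  proof -
    have q: "q$1 \<noteq> 0" "c (X q) \<noteq> 0" using that by (auto simp: S_def)
    have l: "l differentiable (at q)"
      unfolding l_def[abs_def] using q
      by (intro differentiable_divide differentiable_diff differentiable_mult X nth) auto
    have b: "b differentiable (at q)"
      unfolding b_def[abs_def] using q
      by (intro differentiable_divide differentiable_diff differentiable_mult X nth l) auto
    have a: "a differentiable (at q)"
      unfolding a_def[abs_def] using q
      by (intro differentiable_divide differentiable_diff differentiable_mult X nth l b) auto
    show ?thesis
      unfolding \<Psi>_def[abs_def]
      by (intro differentiable_add differentiable_scaleR differentiable_diff differentiable_mult nth l a b
          differentiable_const)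
  qed
  define \<Psi>' where "\<Psi>' q = (\<lambda>h. dir_deriv h \<Psi> q)" for q
  have \<Psi>': "(\<Psi> has_derivative \<Psi>' q) (at q)" if "q \<in> S" for q
    unfolding \<Psi>'_def by (rule has_derivative_dir_deriv[OF d\<Psi>[OF that]])
  \<comment> \<open>The critical points of \<open>\<Psi>\<close>. Sard's theorem makes their image
    negligible, so it remains to see that each bad parameter is a critical value.\<close>
  define B where "B = {q \<in> S. rank (matrix (\<Psi>' q)) < CARD(4)}"
  have "negligible (\<Psi> ` B)"
    by (rule baby_Sard[where f'=\<Psi>']) (auto simp: B_def intro: has_derivative_at_withinI[OF \<Psi>'])
  moreover have "?Bad \<subseteq> \<Psi> ` B"
  proof
    fix p assume "p \<in> ?Bad"
    then obtain z h where z: "fst z > 0" "c z \<noteq> 0" "h \<noteq> 0"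
      and F: "\<And>F. F \<in> {F0, F1, F2} \<Longrightarrow> F p z = 0" "\<And>F. F \<in> {F0, F1, F2} \<Longrightarrow> dir_deriv h (F p) z = 0"
        "\<And>F. F \<in> {F0, F1, F2} \<Longrightarrow> (F p has_derivative (\<lambda>h. dir_deriv h (F p) z)) (at z)"
      by blast
    \<comment> \<open>The line through \<open>z\<close> in direction \<open>h\<close> is lifted to
      \<open>real^4\<close> with \<open>L2 p\<close> along it as fourth coordinate. The lift is
      affine in \<open>s\<close> because \<open>L2 p\<close> is affine in \<open>x\<close>.\<close>
    define q :: "real \<Rightarrow> real^4" where
      "q s = (fst z + s * fst h) *\<^sub>R axis 1 1 + (snd z $ i + s * snd h $ i) *\<^sub>R axis 2 1
        + (snd z $ j + s * snd h $ j) *\<^sub>R axis 3 1 + (p$2 + p$4 * (snd z $ i + s * snd h $ i)) *\<^sub>R axis 4 1" for s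
    have qn: "q s $ 1 = fst z + s * fst h" "q s $ 2 = snd z $ i + s * snd h $ i"
      "q s $ 3 = snd z $ j + s * snd h $ j" "q s $ 4 = L2 p (z + s *\<^sub>R h)" for s
      by (simp_all add: q_def axis_def L2_def)
    have rep: "u $ i *\<^sub>R axis i 1 + u $ j *\<^sub>R axis j 1 = u" for u :: "real^2"
      using ij exhaust_2[of i] exhaust_2[of j] by (auto simp: vec_eq_iff forall_2 axis_def)
    have Xq: "X (q s) = z + s *\<^sub>R h" for s
    proof -
      have "snd (X (q s)) = snd (z + s *\<^sub>R h)"
        using rep[of "snd (z + s *\<^sub>R h)"] by (simp add: X_def qn)
      then show ?thesis by (simp add: prod_eq_iff) (simp add: X_def qn)
    qed
    have q0: "q 0 \<in> S" using z Xq[of 0] by (simp add: S_def qn)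
    define \<zeta> :: "real^4" where
      "\<zeta> = fst h *\<^sub>R axis 1 1 + snd h $ i *\<^sub>R axis 2 1 + snd h $ j *\<^sub>R axis 3 1 + (p$4 * snd h $ i) *\<^sub>R axis 4 1"
    have q_eq: "q s = q 0 + s *\<^sub>R \<zeta>" for s
      by (simp add: vec_eq_iff forall_4 q_def \<zeta>_def axis_def algebra_simps)
    have line: "(\<lambda>s. f (z + s *\<^sub>R h)) differentiable (at 0)" if "f \<in> {A, A1, A2, c, c1, c2, e, e1, e2}" for f
    proof -
      have "(\<lambda>s. z + s *\<^sub>R h) differentiable (at 0)"
        by (intro differentiable_add differentiable_scaleR differentiable_const differentiable_ident)
      from differentiable_chain_at[OF this, of f] diff[OF that] show ?thesis by (simp add: o_def)
    qed
    have DF: "((\<lambda>s. F p (z + s *\<^sub>R h)) has_real_derivative 0) (at 0)" if "F \<in> {F0, F1, F2}" for F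
    proof -
      have "((\<lambda>s. z + s *\<^sub>R h) has_derivative (\<lambda>s. s *\<^sub>R h)) (at 0)"
        by (auto intro!: derivative_eq_intros)
      moreover have "(F p has_derivative (\<lambda>h. dir_deriv h (F p) z)) (at (z + 0 *\<^sub>R h))"
        using F(3)[OF that] by simp
      ultimately have "((\<lambda>s. F p (z + s *\<^sub>R h)) has_derivative (\<lambda>s. dir_deriv (s *\<^sub>R h) (F p) z)) (at 0)"
        by (rule has_derivative_compose)
      moreover have "dir_deriv (s *\<^sub>R h) (F p) z = 0 * s" for s
        using linear_cmul[OF has_derivative_linear[OF F(3)[OF that]], of s h] F(2)[OF that] by simp
      then have "(\<lambda>s. dir_deriv (s *\<^sub>R h) (F p) z) = (*) 0" by (simp add: fun_eq_iff)
      ultimately show ?thesis unfolding has_field_derivative_def by (simp only:)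
    qed
    have t: "(\<lambda>s. fst z + s * fst h) differentiable (at 0)"
      by (intro differentiable_add differentiable_mult differentiable_const differentiable_ident)
    \<comment> \<open>\<open>u0\<close>, \<open>u3\<close> and \<open>u2\<close> are the errors with
      which \<open>l\<close>, \<open>b\<close> and \<open>a\<close> recover \<open>L1 p\<close>,
      \<open>p$4\<close> and \<open>p$3\<close> along the line. They combine \<open>F0 p\<close>,
      \<open>F1 p\<close>, \<open>F2 p\<close> with differentiable coefficients and so vanish to
      first order at \<open>s = 0\<close>.\<close>
    define u0 where "u0 s = F0 p (z + s *\<^sub>R h) * inverse ((fst z + s * fst h) * c (z + s *\<^sub>R h))" for s
    define u3 where "u3 s = F2 p (z + s *\<^sub>R h) * inverse ((fst z + s * fst h) * c (z + s *\<^sub>R h))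
      - u0 s * (c2 (z + s *\<^sub>R h) * inverse (c (z + s *\<^sub>R h)))" for s
    define u2 where "u2 s = F1 p (z + s *\<^sub>R h) * inverse ((fst z + s * fst h) * c (z + s *\<^sub>R h))
      - u3 s * (e (z + s *\<^sub>R h) * inverse (c (z + s *\<^sub>R h)))
      - u0 s * (c1 (z + s *\<^sub>R h) * inverse (c (z + s *\<^sub>R h)))" for s
    have i1: "(\<lambda>s. inverse ((fst z + s * fst h) * c (z + s *\<^sub>R h))) differentiable (at 0)"
      using z by (intro differentiable_inverse differentiable_mult t line) auto
    have i2: "(\<lambda>s. f (z + s *\<^sub>R h) * inverse (c (z + s *\<^sub>R h))) differentiable (at 0)" if "f \<in> {c2, e, c1}" for f
      using z that by (intro differentiable_inverse differentiable_mult line) auto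
    have u0: "u0 0 = 0" "(u0 has_real_derivative 0) (at 0)"
      using F(1)[of F0] DERIV_zero_mult[OF _ DF[of F0] i1] unfolding u0_def[abs_def] by simp_all
    have u3: "u3 0 = 0" "(u3 has_real_derivative 0) (at 0)"
      using F(1)[of F2] u0 DERIV_diff[OF DERIV_zero_mult[OF _ DF[of F2] i1] DERIV_zero_mult[OF u0 i2[of c2]]]
      unfolding u3_def[abs_def] by simp_all
    have u2: "u2 0 = 0" "(u2 has_real_derivative 0) (at 0)"
      using F(1)[of F1] u0 u3 DERIV_diff[OF DERIV_diff[OF DERIV_zero_mult[OF _ DF[of F1] i1]
          DERIV_zero_mult[OF u3 i2[of e]]] DERIV_zero_mult[OF u0 i2[of c1]]]
      unfolding u2_def[abs_def] by simp_all
    have eqs: "l (q s) = L1 p (z + s *\<^sub>R h) + u0 s" "b (q s) = p$4 + u3 s" "a (q s) = p$3 + u2 s" if "q s \<in> S" for s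
    proof -
      have nz: "fst z + s * fst h \<noteq> 0" "c (z + s *\<^sub>R h) \<noteq> 0"
        using that by (auto simp: S_def qn Xq)
      \<comment> \<open>Here \<open>x\<close>, \<open>k\<close>, \<open>n\<close> stand for the true
        values of \<open>L1\<close>, \<open>p$4\<close>, \<open>p$3\<close>, and \<open>u\<close>,
        \<open>v\<close> for the errors \<open>u0\<close>, \<open>u3\<close> found before.\<close>
      have alg: "(y / t - g * e) / c = x + (y - t * (x * c + g * e)) * inverse (t * c)"
        "(y / t - (x + u) * r - g * e) / c = k + ((y - t * (k * c + x * r + g * e)) * inverse (t * c) - u * (r * inverse c))"
        "(y / t - (k + v) * e' - (x + u) * r - g * e) / c
          = n + ((y - t * (n * c + k * e' + x * r + g * e)) * inverse (t * c) - v * (e' * inverse c) - u * (r * inverse c))"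
        if "t \<noteq> 0" "c \<noteq> 0" for y t g e c x u r k v e' n :: real
        using that by (simp_all add: divide_simps algebra_simps)
      have f: "fst (z + s *\<^sub>R h) = fst z + s * fst h" by simp
      show l: "l (q s) = L1 p (z + s *\<^sub>R h) + u0 s"
        unfolding l_def u0_def F_defs Xq qn f by (rule alg(1)[OF nz])
      show b: "b (q s) = p$4 + u3 s"
        unfolding b_def u3_def l F_defs Xq qn f by (rule alg(2)[OF nz])
      show "a (q s) = p$3 + u2 s"
        unfolding a_def u2_def b l F_defs Xq qn f by (rule alg(3)[OF nz])
    qed
    have \<Psi>q: "\<Psi> (q s) = p + ((u0 s - u2 s * (snd z $ i + s * snd h $ i) - u3 s * (snd z $ j + s * snd h $ j)) *\<^sub>R axis 1 1
      - (u3 s * (snd z $ i + s * snd h $ i)) *\<^sub>R axis 2 1 + u2 s *\<^sub>R axis 3 1 + u3 s *\<^sub>R axis 4 1)" if "q s \<in> S" for s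
      unfolding \<Psi>_def eqs[OF that] qn
      by (simp add: vec_eq_iff forall_4 axis_def L1_def L2_def algebra_simps)
    have "\<Psi> (q 0) = p" using \<Psi>q[OF q0] u0 u2 u3 by simp
    moreover have "\<Psi>' (q 0) \<zeta> = 0"
    proof -
      let ?r = "\<lambda>s. p + ((u0 s - u2 s * (snd z $ i + s * snd h $ i) - u3 s * (snd z $ j + s * snd h $ j)) *\<^sub>R axis 1 1
        - (u3 s * (snd z $ i + s * snd h $ i)) *\<^sub>R axis 2 1 + u2 s *\<^sub>R axis 3 1 + u3 s *\<^sub>R axis 4 1)"
      have x: "(\<lambda>s. snd z $ k + s * snd h $ k) differentiable (at 0)" for k
        by (intro differentiable_add differentiable_mult differentiable_const differentiable_ident)
      note m = DERIV_zero_mult[OF u2 x] DERIV_zero_mult[OF u3 x]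
      have hd: "(f has_derivative (\<lambda>_. 0)) (at 0)" if "(f has_real_derivative 0) (at 0)" for f :: "real \<Rightarrow> real"
        using that[unfolded has_field_derivative_def] by (rule has_derivative_eq_rhs) (simp add: fun_eq_iff)
      have h1: "((\<lambda>s. u0 s - u2 s * (snd z $ i + s * snd h $ i) - u3 s * (snd z $ j + s * snd h $ j))
          has_real_derivative 0) (at 0)"
        using DERIV_diff[OF DERIV_diff[OF u0(2) m(1)[of i]] m(2)[of j]] by simp
      have sc: "((\<lambda>s. f s *\<^sub>R v) has_derivative (\<lambda>_. 0)) (at 0)"
        if "(f has_derivative (\<lambda>_. 0)) (at 0)" for f :: "real \<Rightarrow> real" and v :: "real^4"
        using has_derivative_scaleR_left[OF that, of v] by simp
      have add: "((\<lambda>s. f s + g s) has_derivative (\<lambda>_. 0)) (at 0)"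
        and sub: "((\<lambda>s. f s - g s) has_derivative (\<lambda>_. 0)) (at 0)"
        if "(f has_derivative (\<lambda>_. 0)) (at 0)" "(g has_derivative (\<lambda>_. 0)) (at 0)" for f g :: "real \<Rightarrow> real^4"
        using has_derivative_add[OF that] has_derivative_diff[OF that] by simp_all
      have r: "(?r has_derivative (\<lambda>s. 0)) (at 0)"
        by (rule add[OF has_derivative_const add[OF add[OF sub[OF sc[OF hd[OF h1]] sc[OF hd[OF m(2)[of i]]]]
          sc[OF hd[OF u2(2)]]] sc[OF hd[OF u3(2)]]]])
      have "((\<lambda>s. q 0 + s *\<^sub>R \<zeta>) has_derivative (\<lambda>s. s *\<^sub>R \<zeta>)) (at 0)"
        by (auto intro!: derivative_eq_intros)
      then have "((\<lambda>s. q s) has_derivative (\<lambda>s. s *\<^sub>R \<zeta>)) (at 0)"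
        by (simp only: q_eq[symmetric])
      from has_derivative_compose[OF this \<Psi>'[OF q0]]
      have d: "((\<lambda>s. \<Psi> (q s)) has_derivative (\<lambda>s. \<Psi>' (q 0) (s *\<^sub>R \<zeta>))) (at 0)" .
      have "\<forall>\<^sub>F s in at 0. ?r s = \<Psi> (q s)"
      proof -
        have "isCont (\<lambda>s. fst z + s * fst h) 0" "isCont (\<lambda>s. c (z + s *\<^sub>R h)) 0"
          using t line[of c] by (auto intro: differentiable_imp_continuous_within)
        then have "((\<lambda>s. fst z + s * fst h) \<longlongrightarrow> fst z) (at 0)" "((\<lambda>s. c (z + s *\<^sub>R h)) \<longlongrightarrow> c z) (at 0)"
          by (auto simp: isCont_def)
        from order_tendstoD(1)[OF this(1) z(1)] tendsto_imp_eventually_ne[OF this(2) z(2)]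
        have "\<forall>\<^sub>F s in at 0. q s \<in> S"
          by eventually_elim (simp add: S_def qn Xq)
        then show ?thesis by eventually_elim (rule \<Psi>q[symmetric])
      qed
      from has_derivative_transform_eventually[OF r this \<Psi>q[OF q0, symmetric] UNIV_I]
      have "((\<lambda>s. \<Psi> (q s)) has_derivative (\<lambda>s. 0)) (at 0)" .
      from has_derivative_unique[OF this d]
      have "0 = \<Psi>' (q 0) (1 *\<^sub>R \<zeta>)" by (rule fun_cong)
      then show ?thesis by simp
    qed
    \<comment> \<open>The first three coordinates of \<open>\<zeta>\<close> are those of
      \<open>h\<close>. So the kernel of \<open>\<Psi>' (q 0)\<close> is nontrivial and
      \<open>q 0\<close> is critical.\<close>
    moreover have "\<zeta> \<noteq> 0"
    proof
      assume "\<zeta> = 0"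
      then have "fst h = 0" "snd h $ i = 0" "snd h $ j = 0"
        by (auto simp: vec_eq_iff forall_4 \<zeta>_def axis_def)
      then have "h = 0" using rep[of "snd h"] by (simp add: prod_eq_iff)
      with z(3) show False ..
    qed
    ultimately have "\<not> inj ((*v) (matrix (\<Psi>' (q 0))))"
      using fun_cong[OF matrix_vector_mul(2)[OF has_derivative_linear[OF \<Psi>'[OF q0]]], of \<zeta>]
      by (metis inj_eq matrix_vector_mult_0_right)
    then have "q 0 \<in> B" using q0 unfolding B_def less_rank_noninjective[symmetric] by blast
    with \<open>\<Psi> (q 0) = p\<close> show "p \<in> \<Psi> ` B" by blast
  qed
  ultimately show ?thesis by (rule negligible_subset)
qed

section \<open>Perturbations\<close>

lemma dir_deriv_cong_open:
  assumes "open U" "x \<in> U" "\<And>y. y \<in> U \<Longrightarrow> f y = g y"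
  shows "dir_deriv b f x = dir_deriv b g x"
proof -
  have "(f has_derivative D) (at x) \<longleftrightarrow> (g has_derivative D) (at x)" for D
    using has_derivative_transform_within_open[OF _ assms(1,2)] assms(3) by metis
  then show ?thesis unfolding dir_deriv_def frechet_derivative_def by simp
qed

lemma partial_funpow_cong_open:
  assumes "open U" "x \<in> U" "\<And>y. y \<in> U \<Longrightarrow> f y = g y"
  shows "(partial i ^^ m) f x = (partial i ^^ m) g x"
  using assms(2)
proof (induction m arbitrary: x)
  case (Suc m)
  then show ?case unfolding funpow.simps o_apply partial_def
    by (intro dir_deriv_cong_open[OF assms(1)]) (simp_all add: partial_def)
qed (simp add: assms(3))

lemma mixed_partial_cong_open:
  assumes "open U" "x \<in> U" "\<And>y. y \<in> U \<Longrightarrow> f y = g y"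
  shows "mixed_partial a b f x = mixed_partial a b g x"
  unfolding mixed_partial_def using assms
  by (intro partial_funpow_cong_open[OF assms(1,2)]) (rule partial_funpow_cong_open)

lemma mixed_partial_zero: "mixed_partial a b (\<lambda>x. 0 :: 'b::real_normed_vector) x = 0"
proof -
  have "(partial i ^^ m) (\<lambda>x. 0 :: 'b) = (\<lambda>x. 0)" for i :: 2 and m
    by (induction m) (auto simp: partial_def dir_deriv_def)
  then show ?thesis by (simp add: mixed_partial_def)
qed

lemma mixed_partial_scaleR:
  fixes f :: "real^2 \<Rightarrow> real" and K :: "real^'n"
  assumes "Ck_on (a + b) f UNIV"
  shows "mixed_partial a b (\<lambda>x. f x *\<^sub>R K) x = mixed_partial a b f x *\<^sub>R K"
proof -
  have *: "(partial i ^^ m) (\<lambda>x. f x *\<^sub>R K) = (\<lambda>x. (partial i ^^ m) f x *\<^sub>R K)"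
    if "Ck_on m f UNIV" for m f and i :: 2
    using that
  proof (induction m arbitrary: f)
    case (Suc m)
    have "partial i (\<lambda>x. f x *\<^sub>R K) = (\<lambda>x. partial i f x *\<^sub>R K)"
    proof
      fix x
      have "f differentiable (at x)" using Suc.prems by simp
      from has_derivative_scaleR_left[OF has_derivative_dir_deriv[OF this]]
      show "partial i (\<lambda>x. f x *\<^sub>R K) x = partial i f x *\<^sub>R K"
        unfolding partial_def by (rule dir_deriv_eqI)
    qed
    with Suc.IH[OF Ck_on_partial[OF Suc.prems]] show ?case
      by (simp add: funpow_Suc_right del: funpow.simps)
  qed simp
  have "Ck_on b f UNIV" "Ck_on a ((partial 2 ^^ b) f) UNIV"
    using Ck_on_le[OF assms, of b] Ck_on_partial_funpow[of b a f 2] assms by (simp_all add: add.commute)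
  then show ?thesis by (simp add: mixed_partial_def *)
qed

section \<open>Cutoffs and compactly supported perturbations\<close>

lemma Ck_on_max_power: "Ck_on k (\<lambda>s::real. max 0 s ^ Suc k) UNIV"
proof (induction k)
  case 0
  show ?case by (auto intro!: continuous_intros)
next
  case (Suc k)
  have der: "((\<lambda>s::real. max 0 s ^ Suc (Suc k)) has_real_derivative (of_nat (Suc (Suc k)) * max 0 s ^ Suc k)) (at s)" for s
  proof (cases s "0::real" rule: linorder_cases)
    case less
    have "((\<lambda>s::real. 0) has_real_derivative (of_nat (Suc (Suc k)) * max 0 s ^ Suc k)) (at s)"
      using less by simp
    then show ?thesis
      by (rule has_field_derivative_transform_within_open[of _ _ _ "{..<0}"]) (use less in auto)
  next
    case greater
    have "((\<lambda>s::real. s ^ Suc (Suc k)) has_real_derivative (of_nat (Suc (Suc k)) * max 0 s ^ Suc k)) (at s)"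
      using DERIV_pow[of "Suc (Suc k)" s] greater by simp
    then show ?thesis
      by (rule has_field_derivative_transform_within_open[of _ _ _ "{0<..}"]) (use greater in auto)
  next
    \<comment> \<open>At the origin the difference quotient is \<open>max 0 h ^ Suc k\<close>, which
      tends to zero.\<close>
    case equal
    have "((\<lambda>h::real. max 0 h ^ Suc k) \<longlongrightarrow> max 0 0 ^ Suc k) (at 0)"
      by (intro tendsto_intros)
    moreover have "max 0 h ^ Suc k = (max 0 (0 + h) ^ Suc (Suc k) - max 0 0 ^ Suc (Suc k)) / h" if "h \<noteq> 0" for h :: real
      using that by (auto simp: max_def)
    ultimately have "((\<lambda>h::real. (max 0 (0 + h) ^ Suc (Suc k) - max 0 0 ^ Suc (Suc k)) / h) \<longlongrightarrow> 0) (at 0)"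
      by (subst (asm) LIM_equal) auto
    then show ?thesis using equal by (simp add: DERIV_def)
  qed
  show ?case
  proof (rule Ck_on_cong_derivative[OF open_UNIV])
    show "((\<lambda>s::real. max 0 s ^ Suc (Suc k)) has_derivative (\<lambda>h. of_nat (Suc (Suc k)) * max 0 s ^ Suc k * h)) (at s)" for s
      using der[of s] by (simp only: has_field_derivative_def)
    show "Ck_on k (\<lambda>s::real. of_nat (Suc (Suc k)) * max 0 s ^ Suc k * b) UNIV" for b
      using Suc by (intro Ck_on_mult Ck_on_const open_UNIV)
  qed
qed

text \<open>Fourth powers of positive parts supply exactly the three derivatives required. The value
  is 1 for \<open>x \<bullet> x \<le> r - 1\<close> and 0 for
  \<open>r \<le> x \<bullet> x\<close>.\<close>

definition cutoff :: "real \<Rightarrow> real^2 \<Rightarrow> real" where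
  "cutoff r x = 1 - max 0 (1 - max 0 (r - x \<bullet> x) ^ 4) ^ 4"

lemma cutoff_eq_1: "x \<bullet> x \<le> r - 1 \<Longrightarrow> cutoff r x = 1"
  using one_le_power[of "r - x \<bullet> x" 4] unfolding cutoff_def by (simp add: max_absorb1 max_absorb2)

lemma cutoff_eq_0: "r \<le> x \<bullet> x \<Longrightarrow> cutoff r x = 0"
  by (simp add: cutoff_def max_def)

lemma Ck_on_cutoff: "Ck_on 3 (cutoff r) UNIV"
proof -
  have m: "Ck_on 3 (\<lambda>s::real. max 0 s ^ 4) UNIV"
    using Ck_on_max_power[of 3] by (simp only: Suc_numeral add_num_simps)
  have comp: "Ck_on 3 (\<lambda>x::real^2. max 0 (g x) ^ 4) UNIV" if "Ck_on 3 g UNIV" for g :: "real^2 \<Rightarrow> real"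
    using Ck_on_compose[OF open_UNIV open_UNIV _ that m] by simp
  show ?thesis
    unfolding cutoff_def[abs_def]
    by (intro Ck_on_sub Ck_on_const comp open_UNIV Ck_on_bilinear[OF _ bounded_bilinear_inner]
        Ck_on_bounded_linear bounded_linear_ident)
qed

text \<open>The derivatives of \<open>f\<close> are continuous and vanish outside a ball, hence
  bounded. One \<open>B\<close> serves all \<open>K\<close>, so small parameters will give small
  perturbations.\<close>

lemma compact_support_scaleR:
  fixes f :: "real^2 \<Rightarrow> real"
  assumes f: "Ck_on 3 f UNIV" and supp: "\<And>x. r < norm x \<Longrightarrow> f x = 0"
  obtains B where "B \<ge> 0" "\<And>K::real^2. (\<lambda>x. f x *\<^sub>R K) \<in> C3_0"
    "\<And>K::real^2. C3_norm (\<lambda>x. f x *\<^sub>R K) \<le> B * norm K"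
proof -
  have zero: "mixed_partial a b f x = 0" if "r < norm x" for a b x
  proof -
    have "open {x::real^2. r < norm x}" by (intro open_Collect_less continuous_intros)
    from mixed_partial_cong_open[OF this, of x f "\<lambda>x. 0" a b] show ?thesis
      using that supp by (simp add: mixed_partial_zero)
  qed
  have "\<exists>B. \<forall>x. \<bar>mixed_partial a b f x\<bar> \<le> B" if "a + b \<le> 3" for a b
  proof -
    have "continuous_on UNIV (mixed_partial a b f)"
      using Ck_on_mixed_partial[OF f, of a b 0] that by simp
    then have "compact (mixed_partial a b f ` cball 0 r)"
      by (intro compact_continuous_image) (auto intro: continuous_on_subset)
    then have "bounded (mixed_partial a b f ` cball 0 r)" by (rule compact_imp_bounded)
    then obtain B where "\<forall>y\<in>mixed_partial a b f ` cball 0 r. norm y \<le> B"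
      unfolding bounded_iff by blast
    then have B: "\<bar>mixed_partial a b f x\<bar> \<le> B" if "norm x \<le> r" for x
      using that by simp
    have "\<bar>mixed_partial a b f x\<bar> \<le> \<bar>B\<bar>" for x
      using B[of x] zero[of x a b] by (cases "norm x \<le> r") auto
    then show ?thesis by blast
  qed
  then obtain B where B: "\<And>a b x. a + b \<le> 3 \<Longrightarrow> \<bar>mixed_partial a b f x\<bar> \<le> B a b" by metis
  define C where "C = (\<Sum>(a, b)\<in>{..3}\<times>{..3}. \<bar>B a b\<bar>)"
  have C: "\<bar>mixed_partial a b f x\<bar> \<le> C" if "a + b \<le> 3" for a b x
  proof -
    have "\<bar>B a b\<bar> \<le> C" unfolding C_def
      using member_le_sum[of "(a, b)" "{..3}\<times>{..3}" "\<lambda>(a, b). \<bar>B a b\<bar>"] that by auto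
    then show ?thesis using B[OF that, of x] by linarith
  qed
  have C0: "C \<ge> 0" unfolding C_def by (intro sum_nonneg) auto
  have ck: "Ck_on 3 (\<lambda>x. f x *\<^sub>R K) UNIV" for K :: "real^2"
    by (intro Ck_on_scaleR f Ck_on_const open_UNIV)
  have le: "\<bar>mixed_partial a b (\<lambda>x. f x *\<^sub>R K) x $ i\<bar> \<le> C * norm K" if "a + b \<le> 3" for a b x i and K :: "real^2"
  proof -
    have "mixed_partial a b (\<lambda>x. f x *\<^sub>R K) x = mixed_partial a b f x *\<^sub>R K"
      by (rule mixed_partial_scaleR[OF Ck_on_le[OF f that]])
    then show ?thesis
      using mult_mono[OF C[OF that, of x] component_le_norm_cart[of K i]] C0 by (simp add: abs_mult)
  qed
  have "(\<lambda>x. f x *\<^sub>R K) \<in> C3_0" for K :: "real^2"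
  proof -
    have "jacobian (\<lambda>x. f x *\<^sub>R K) (at x) = 0" if "r < norm x" for x
    proof -
      have "partial j (\<lambda>x. f x *\<^sub>R K) x = 0" for j
        using mixed_partial_scaleR[OF Ck_on_le[OF f], of 1 0 K x] mixed_partial_scaleR[OF Ck_on_le[OF f], of 0 1 K x]
          zero[OF that, of 1 0] zero[OF that, of 0 1] exhaust_2[of j] by (auto simp: mixed_partial_def)
      then show ?thesis by (simp add: vec_eq_iff jacobian_nth)
    qed
    then have "\<forall>\<^sub>F x in at_infinity. jacobian (\<lambda>x. f x *\<^sub>R K) (at x) = 0"
      unfolding eventually_at_infinity by (intro exI[of _ "r + 1"]) auto
    then show ?thesis
      using C3_norm_leI(1)[OF ck le] by (simp add: C3_0_def tendsto_eventually)
  qed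
  then show thesis using that[OF C0] C3_norm_leI(2)[OF ck le] by blast
qed

lemma C3_0_diff:
  assumes "v \<in> C3_0" "w \<in> C3_0"
  shows "(\<lambda>x. v x - w x) \<in> C3_0"
proof -
  have vw: "v \<in> C3" "w \<in> C3" using assms by (simp_all add: C3_0_def)
  have "jacobian (\<lambda>x. v x - w x) (at x) = jacobian v (at x) - jacobian w (at x)" for x
  proof -
    have "partial j (\<lambda>x. v x - w x) x = partial j v x - partial j w x" for j
      using mixed_partial_diff[of v w 1 0 x] mixed_partial_diff[of v w 0 1 x] vw exhaust_2[of j]
      by (auto simp: mixed_partial_def C3_def)
    then show ?thesis by (simp add: vec_eq_iff jacobian_nth)
  qed
  then show ?thesis
    using assms C3_diff[OF vw] tendsto_diff[of "\<lambda>x. jacobian v (at x)" 0 at_infinity "\<lambda>x. jacobian w (at x)" 0]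
    by (simp add: C3_0_def)
qed

section \<open>Perturbation by polynomial fields of degree two\<close>

type_synonym quad = "(real^2) \<times> (real^2) \<times> (real^2) \<times> (real^2) \<times> (real^2)"

definition quad_field :: "quad \<Rightarrow> real^2 \<Rightarrow> real^2" where
  "quad_field = (\<lambda>(K, L, Q, M, N) x. x$1 *\<^sub>R K + x$2 *\<^sub>R L + ((x$1)\<^sup>2 / 2) *\<^sub>R Q
     + (x$1 * x$2) *\<^sub>R M + ((x$2)\<^sup>2 / 2) *\<^sub>R N)"

text \<open>Cutting \<open>g\<close> off keeps the perturbed field in \<open>C3_0\<close>. The
  constant \<open>B\<close> depends on \<open>g\<close> and \<open>R\<close> but not on
  \<open>w\<close> or \<open>K\<close>.\<close>

lemma cutoff_scaleR_perturbation:
  fixes g :: "real^2 \<Rightarrow> real"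
  assumes g: "Ck_on 3 g UNIV" and R: "R \<ge> 0"
  shows "\<exists>B\<ge>0. \<forall>w\<in>C3_0. \<forall>K. \<exists>v\<in>C3_0. C3_dist v w \<le> B * norm K \<and>
    (\<forall>x. norm x < R \<longrightarrow> v x = w x - g x *\<^sub>R K)"
proof -
  \<comment> \<open>With parameter \<open>R^2 + 1\<close> the cutoff is 1 for
    \<open>norm x \<le> R\<close> and 0 beyond \<open>R + 1\<close>.\<close>
  define f where "f x = cutoff (R\<^sup>2 + 1) x * g x" for x
  have "Ck_on 3 f UNIV" unfolding f_def by (intro Ck_on_mult Ck_on_cutoff g open_UNIV)
  moreover have "f x = 0" if "R + 1 < norm x" for x
  proof -
    have "R\<^sup>2 + 1 \<le> (R + 1)\<^sup>2" using R by (simp add: power2_sum)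
    also have "\<dots> \<le> (norm x)\<^sup>2" using that R by (intro power_mono) auto
    finally show ?thesis by (simp add: f_def cutoff_eq_0 power2_norm_eq_inner)
  qed
  ultimately obtain B where B: "B \<ge> 0" "\<And>K::real^2. (\<lambda>x. f x *\<^sub>R K) \<in> C3_0"
    "\<And>K::real^2. C3_norm (\<lambda>x. f x *\<^sub>R K) \<le> B * norm K"
    using compact_support_scaleR by blast
  show ?thesis
  proof (rule exI[of _ B], intro conjI ballI allI B(1), rule bexI, intro conjI allI impI)
    fix w :: "real^2 \<Rightarrow> real^2" and K :: "real^2" assume w: "w \<in> C3_0"
    show v: "(\<lambda>x. w x - f x *\<^sub>R K) \<in> C3_0" by (rule C3_0_diff[OF w B(2)])
    have "(\<lambda>x. (w x - f x *\<^sub>R K) - w x) = (\<lambda>x. f x *\<^sub>R (- K))" by auto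
    then show "C3_dist (\<lambda>x. w x - f x *\<^sub>R K) w \<le> B * norm K"
      using B(3)[of "- K"] v w by (simp add: C3_dist_def C3_0_def)
    fix x :: "real^2" assume "norm x < R"
    then have "(norm x)\<^sup>2 \<le> R\<^sup>2" by (intro power_mono) auto
    then have "f x = g x" by (simp add: f_def cutoff_eq_1 power2_norm_eq_inner)
    then show "w x - f x *\<^sub>R K = w x - g x *\<^sub>R K" by simp
  qed
qed

lemma Ck_on_nth_ident: "Ck_on k (\<lambda>x::real^2. x$i) UNIV"
  by (intro Ck_on_bounded_linear open_UNIV bounded_linear_vec_nth)

text \<open>The five monomials are subtracted one after another and the triangle inequality adds the
  bounds, which hold for the intermediate fields because they are uniform in the field.\<close>

lemma quad_field_perturbation:
  assumes R: "R \<ge> 0"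
  shows "\<exists>B\<ge>0. \<forall>w\<in>C3_0. \<forall>q. \<exists>v\<in>C3_0. C3_dist v w \<le> B * norm q \<and>
    (\<forall>x. norm x < R \<longrightarrow> v x = w x - quad_field q x)"
proof -
  interpret Metric_space C3_0 C3_dist by (rule Metric_space_C3_0)
  note n = Ck_on_nth_ident
  have ck: "Ck_on 3 (\<lambda>x::real^2. x$1) UNIV" "Ck_on 3 (\<lambda>x::real^2. x$2) UNIV"
    "Ck_on 3 (\<lambda>x::real^2. (x$1)\<^sup>2 / 2) UNIV" "Ck_on 3 (\<lambda>x::real^2. x$1 * x$2) UNIV"
    "Ck_on 3 (\<lambda>x::real^2. (x$2)\<^sup>2 / 2) UNIV"
    unfolding power2_eq_square divide_inverse by (intro n Ck_on_mult Ck_on_const open_UNIV)+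
  obtain B1 where B1: "B1 \<ge> 0" "\<And>w K. w \<in> C3_0 \<Longrightarrow> \<exists>v\<in>C3_0. C3_dist v w \<le> B1 * norm K \<and>
    (\<forall>x. norm x < R \<longrightarrow> v x = w x - x$1 *\<^sub>R K)"
    using cutoff_scaleR_perturbation[OF ck(1) R] by blast
  obtain B2 where B2: "B2 \<ge> 0" "\<And>w K. w \<in> C3_0 \<Longrightarrow> \<exists>v\<in>C3_0. C3_dist v w \<le> B2 * norm K \<and>
    (\<forall>x. norm x < R \<longrightarrow> v x = w x - x$2 *\<^sub>R K)"
    using cutoff_scaleR_perturbation[OF ck(2) R] by blast
  obtain B3 where B3: "B3 \<ge> 0" "\<And>w K. w \<in> C3_0 \<Longrightarrow> \<exists>v\<in>C3_0. C3_dist v w \<le> B3 * norm K \<and>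
    (\<forall>x. norm x < R \<longrightarrow> v x = w x - ((x$1)\<^sup>2 / 2) *\<^sub>R K)"
    using cutoff_scaleR_perturbation[OF ck(3) R] by blast
  obtain B4 where B4: "B4 \<ge> 0" "\<And>w K. w \<in> C3_0 \<Longrightarrow> \<exists>v\<in>C3_0. C3_dist v w \<le> B4 * norm K \<and>
    (\<forall>x. norm x < R \<longrightarrow> v x = w x - (x$1 * x$2) *\<^sub>R K)"
    using cutoff_scaleR_perturbation[OF ck(4) R] by blast
  obtain B5 where B5: "B5 \<ge> 0" "\<And>w K. w \<in> C3_0 \<Longrightarrow> \<exists>v\<in>C3_0. C3_dist v w \<le> B5 * norm K \<and>
    (\<forall>x. norm x < R \<longrightarrow> v x = w x - ((x$2)\<^sup>2 / 2) *\<^sub>R K)"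
    using cutoff_scaleR_perturbation[OF ck(5) R] by blast
  show ?thesis
  proof (rule exI[of _ "B1 + B2 + B3 + B4 + B5"], intro conjI ballI allI)
    show "B1 + B2 + B3 + B4 + B5 \<ge> 0" using B1(1) B2(1) B3(1) B4(1) B5(1) by simp
    fix w :: "real^2 \<Rightarrow> real^2" and q :: quad assume w: "w \<in> C3_0"
    obtain K L Q M N where q: "q = (K, L, Q, M, N)" by (cases q) auto
    have nq: "norm K \<le> norm q" "norm L \<le> norm q" "norm Q \<le> norm q" "norm M \<le> norm q" "norm N \<le> norm q"
      using norm_fst_le[of K "(L, Q, M, N)"] norm_snd_le[of "(L, Q, M, N)" K] norm_fst_le[of L "(Q, M, N)"]
        norm_snd_le[of "(Q, M, N)" L] norm_fst_le[of Q "(M, N)"] norm_snd_le[of "(M, N)" Q]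
        norm_fst_le[of M N] norm_snd_le[of N M] unfolding q by linarith+
    obtain v1 where v1: "v1 \<in> C3_0" "C3_dist v1 w \<le> B1 * norm K" "\<And>x. norm x < R \<Longrightarrow> v1 x = w x - x$1 *\<^sub>R K"
      using B1(2)[OF w, of K] by blast
    obtain v2 where v2: "v2 \<in> C3_0" "C3_dist v2 v1 \<le> B2 * norm L" "\<And>x. norm x < R \<Longrightarrow> v2 x = v1 x - x$2 *\<^sub>R L"
      using B2(2)[OF v1(1), of L] by blast
    obtain v3 where v3: "v3 \<in> C3_0" "C3_dist v3 v2 \<le> B3 * norm Q" "\<And>x. norm x < R \<Longrightarrow> v3 x = v2 x - ((x$1)\<^sup>2 / 2) *\<^sub>R Q"
      using B3(2)[OF v2(1), of Q] by blast
    obtain v4 where v4: "v4 \<in> C3_0" "C3_dist v4 v3 \<le> B4 * norm M" "\<And>x. norm x < R \<Longrightarrow> v4 x = v3 x - (x$1 * x$2) *\<^sub>R M"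
      using B4(2)[OF v3(1), of M] by blast
    obtain v5 where v5: "v5 \<in> C3_0" "C3_dist v5 v4 \<le> B5 * norm N" "\<And>x. norm x < R \<Longrightarrow> v5 x = v4 x - ((x$2)\<^sup>2 / 2) *\<^sub>R N"
      using B5(2)[OF v4(1), of N] by blast
    have "C3_dist v5 w \<le> B1 * norm K + B2 * norm L + B3 * norm Q + B4 * norm M + B5 * norm N"
      using triangle[OF v5(1) v4(1) w] triangle[OF v4(1) v3(1) w] triangle[OF v3(1) v2(1) w] triangle[OF v2(1) v1(1) w]
        v1(2) v2(2) v3(2) v4(2) v5(2) by linarith
    also have "\<dots> \<le> B1 * norm q + B2 * norm q + B3 * norm q + B4 * norm q + B5 * norm q"
      using nq B1(1) B2(1) B3(1) B4(1) B5(1) by (intro add_mono mult_left_mono) auto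
    finally have "C3_dist v5 w \<le> (B1 + B2 + B3 + B4 + B5) * norm q" by (simp add: algebra_simps)
    moreover have "v5 x = w x - quad_field q x" if "norm x < R" for x
      using v1(3)[OF that] v2(3)[OF that] v3(3)[OF that] v4(3)[OF that] v5(3)[OF that]
      by (simp add: q quad_field_def)
    ultimately show "\<exists>v\<in>C3_0. C3_dist v w \<le> (B1 + B2 + B3 + B4 + B5) * norm q \<and>
        (\<forall>x. norm x < R \<longrightarrow> v x = w x - quad_field q x)"
      using v5(1) by blast
  qed
qed

lemma partial_const: "partial i (\<lambda>x. c) = (\<lambda>x. 0)"
  by (auto simp: partial_def dir_deriv_def)

lemma partial_affine:
  fixes a b c :: "real^2"
  shows "partial 1 (\<lambda>x::real^2. a + x$1 *\<^sub>R b + x$2 *\<^sub>R c) = (\<lambda>x. b)"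
    and "partial 2 (\<lambda>x::real^2. a + x$1 *\<^sub>R b + x$2 *\<^sub>R c) = (\<lambda>x. c)"
proof -
  have "((\<lambda>x::real^2. a + x$1 *\<^sub>R b + x$2 *\<^sub>R c) has_derivative (\<lambda>h. h$1 *\<^sub>R b + h$2 *\<^sub>R c)) (at x)" for x
    by (auto intro!: derivative_eq_intros bounded_linear_imp_has_derivative[OF bounded_linear_vec_nth])
  from dir_deriv_eqI[OF this]
  show "partial 1 (\<lambda>x::real^2. a + x$1 *\<^sub>R b + x$2 *\<^sub>R c) = (\<lambda>x. b)"
    and "partial 2 (\<lambda>x::real^2. a + x$1 *\<^sub>R b + x$2 *\<^sub>R c) = (\<lambda>x. c)"
    by (auto simp: partial_def fun_eq_iff axis_def)
qed

lemma partial_quad_field: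
  "partial 1 (quad_field (K, L, Q, M, N)) = (\<lambda>x. K + x$1 *\<^sub>R Q + x$2 *\<^sub>R M)"
  "partial 2 (quad_field (K, L, Q, M, N)) = (\<lambda>x. L + x$1 *\<^sub>R M + x$2 *\<^sub>R N)"
proof -
  note n = bounded_linear_imp_has_derivative[OF bounded_linear_vec_nth]
  have "(quad_field (K, L, Q, M, N) has_derivative
    (\<lambda>h. h$1 *\<^sub>R (K + x$1 *\<^sub>R Q + x$2 *\<^sub>R M) + h$2 *\<^sub>R (L + x$1 *\<^sub>R M + x$2 *\<^sub>R N))) (at x)" for x
    unfolding quad_field_def prod.case
    by (auto intro!: derivative_eq_intros n simp: algebra_simps fun_eq_iff power2_eq_square)
  from dir_deriv_eqI[OF this]
  show "partial 1 (quad_field (K, L, Q, M, N)) = (\<lambda>x. K + x$1 *\<^sub>R Q + x$2 *\<^sub>R M)"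
    "partial 2 (quad_field (K, L, Q, M, N)) = (\<lambda>x. L + x$1 *\<^sub>R M + x$2 *\<^sub>R N)"
    by (auto simp: partial_def fun_eq_iff axis_def)
qed

lemma Ck_on_quad_field: "Ck_on k (quad_field q) UNIV"
  unfolding quad_field_def case_prod_beta power2_eq_square divide_inverse
  by (intro Ck_on_add Ck_on_scaleR Ck_on_mult Ck_on_nth_ident Ck_on_const open_UNIV)

lemma jet_sub_quad_field:
  assumes "Ck_on 3 w UNIV"
  shows "jet (\<lambda>x. w x - quad_field (K, L, Q, M, N) x) x =
    (mixed_partial 1 0 w x - (K + x$1 *\<^sub>R Q + x$2 *\<^sub>R M), mixed_partial 0 1 w x - (L + x$1 *\<^sub>R M + x$2 *\<^sub>R N),
     mixed_partial 2 0 w x - Q, mixed_partial 1 1 w x - M, mixed_partial 0 2 w x - N,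
     mixed_partial 3 0 w x, mixed_partial 2 1 w x, mixed_partial 1 2 w x, mixed_partial 0 3 w x)"
proof -
  let ?q = "quad_field (K, L, Q, M, N)"
  have "mixed_partial 1 0 ?q x = K + x$1 *\<^sub>R Q + x$2 *\<^sub>R M" "mixed_partial 0 1 ?q x = L + x$1 *\<^sub>R M + x$2 *\<^sub>R N"
    "mixed_partial 2 0 ?q x = Q" "mixed_partial 1 1 ?q x = M" "mixed_partial 0 2 ?q x = N"
    "mixed_partial 3 0 ?q x = 0" "mixed_partial 2 1 ?q x = 0" "mixed_partial 1 2 ?q x = 0" "mixed_partial 0 3 ?q x = 0"
    by (simp_all add: mixed_partial_def numeral_2_eq_2 numeral_3_eq_3 partial_quad_field partial_affine partial_const)
  then show ?thesis
    unfolding jet_def by (simp add: mixed_partial_diff[OF assms Ck_on_quad_field])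
qed

lemma jet_cong_open:
  assumes "open U" "x \<in> U" "\<And>y. y \<in> U \<Longrightarrow> v y = w y"
  shows "jet v x = jet w x"
  unfolding jet_def using mixed_partial_cong_open[OF assms] by simp

lemma det_jet_time_0: "det_jet 0 J = 1"
  by (cases J) (simp add: det_jet_defs cross2_def axis_def)

text \<open>A null set contains no ball, so arbitrarily small parameters avoid the bad ones. Within
  radius \<open>R\<close> the perturbed field has the jets of the polynomial perturbation; farther
  out the determinant is positive, and at time 0 it is 1.\<close>

lemma generic_approximation:
  fixes \<pi> :: "'p::euclidean_space \<Rightarrow> quad"
  assumes T: "T > 0" and w: "w \<in> C3_0" and eps: "\<epsilon> > 0" and P: "\<And>t J. P t J \<Longrightarrow> det_jet t J = 0"
    and \<pi>: "bounded_linear \<pi>"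
    and neg: "negligible {p. \<exists>t x. t > 0 \<and> P t (jet (\<lambda>x. w x - quad_field (\<pi> p) x) x)}" (is "negligible ?N")
  shows "\<exists>v\<in>generic T P. C3_dist v w < \<epsilon>"
proof -
  from det_jet_pos_far[OF T w] obtain R' e where e: "e > 0"
    and R': "\<And>v t x. v \<in> C3_0 \<Longrightarrow> C3_dist v w < e \<Longrightarrow> 0 \<le> t \<Longrightarrow> t \<le> T \<Longrightarrow> R' \<le> norm x \<Longrightarrow>
    det_jet t (jet v x) > 0"
    by metis
  define R where "R = \<bar>R'\<bar> + 1"
  have "R \<ge> 0" by (simp add: R_def)
  from quad_field_perturbation[OF this] obtain B where B: "B \<ge> 0"
    and pert: "\<And>q. \<exists>v\<in>C3_0. C3_dist v w \<le> B * norm q \<and> (\<forall>x. norm x < R \<longrightarrow> v x = w x - quad_field q x)"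
    using w by blast
  from bounded_linear.pos_bounded[OF \<pi>] obtain C where C: "C > 0" "\<And>p. norm (\<pi> p) \<le> norm p * C" by blast
  \<comment> \<open>With \<open>norm p < d\<close> the perturbation has size below both
    \<open>\<epsilon>\<close> and \<open>e\<close>; \<open>B + 1\<close> keeps the denominator
    positive.\<close>
  define d where "d = min \<epsilon> e / ((B + 1) * C)"
  have d: "d > 0" using eps e B C by (simp add: d_def)
  have "\<not> negligible (ball (0::'p) d)"
    using d by (intro open_not_negligible) auto
  then have "\<not> ball 0 d \<subseteq> ?N" using neg negligible_subset by blast
  then obtain p where "p \<in> ball 0 d" and pN: "p \<notin> ?N" by blast
  then have p: "norm p < d" by simp
  from pert[of "\<pi> p"] obtain v where v: "v \<in> C3_0" "C3_dist v w \<le> B * norm (\<pi> p)"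
    "\<And>x. norm x < R \<Longrightarrow> v x = w x - quad_field (\<pi> p) x"
    by blast
  have "B * norm (\<pi> p) \<le> (B + 1) * (norm p * C)"
    using B C by (intro mult_mono) auto
  also have "\<dots> < (B + 1) * (d * C)"
    using p B C by (intro mult_strict_left_mono mult_strict_right_mono) auto
  also have "\<dots> = min \<epsilon> e" using B C by (simp add: d_def)
  finally have dist: "C3_dist v w < min \<epsilon> e" using v(2) by simp
  have "\<not> P t (jet v x)" if t: "0 \<le> t" "t \<le> T" for t x
  proof (cases "t = 0")
    case True
    then show ?thesis using P[of t "jet v x"] by (auto simp: det_jet_time_0)
  next
    case False
    show ?thesis
    proof (cases "norm x < R")
      case True
      have "open {y::real^2. norm y < R}" by (intro open_Collect_less continuous_intros)
      from jet_cong_open[OF this, of x v "\<lambda>x. w x - quad_field (\<pi> p) x"] True v(3)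
      have "jet v x = jet (\<lambda>x. w x - quad_field (\<pi> p) x) x" by simp
      then show ?thesis using pN False t by auto
    next
      case False
      then have "R' \<le> norm x" by (simp add: R_def)
      then show ?thesis using R'[OF v(1) _ t, of x] dist P[of t "jet v x"] by auto
    qed
  qed
  then show ?thesis using v(1) dist by (intro bexI[of _ v]) (auto simp: generic_def)
qed

section \<open>Negligible sets of bad parameters\<close>

lemma differentiable_mixed_partial_snd:
  fixes w :: "real^2 \<Rightarrow> real^'n" and z :: "real \<times> (real^2)"
  assumes "Ck_on 3 w UNIV" "a + b < 3"
  shows "(\<lambda>z. mixed_partial a b w (snd z)) differentiable (at z)"
  using has_derivative_mixed_partial_snd[OF assms] unfolding differentiable_def by blast

lemma differentiable_cross2:
  "f differentiable (at z) \<Longrightarrow> g differentiable (at z) \<Longrightarrow> (\<lambda>z. cross2 (f z) (g z)) differentiable (at z)"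
  unfolding differentiable_def using bounded_bilinear.FDERIV[OF bounded_bilinear_cross2] by blast

text \<open>Dimension count: the linear coefficients \<open>(K, L)\<close> range over a space of
  dimension 4, while the bad ones form a differentiable image of a set of pairs
  \<open>(t, x)\<close>, of dimension 3.\<close>

lemma approximation_cols_nonzero:
  assumes T: "T > 0" and w: "w \<in> C3_0" and eps: "\<epsilon> > 0"
  shows "\<exists>v\<in>generic T (\<lambda>t J. col1 t J = 0 \<and> col2 t J = 0). C3_dist v w < \<epsilon>"
proof (rule generic_approximation[OF T w eps])
  define \<pi> :: "(real^2) \<times> (real^2) \<Rightarrow> quad" where "\<pi> p = (fst p, snd p, 0, 0, 0)" for p
  have w3: "Ck_on 3 w UNIV" using w by (simp add: C3_0_def C3_def)
  show "bounded_linear \<pi>" unfolding \<pi>_def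
    by (intro bounded_linear_Pair bounded_linear_fst bounded_linear_snd bounded_linear_zero)
  \<comment> \<open>\<open>f (t, x)\<close> is the only pair \<open>(K, L)\<close> for which the
    perturbed matrix vanishes at \<open>(t, x)\<close>.\<close>
  define f :: "real \<times> (real^2) \<Rightarrow> (real^2) \<times> (real^2)" where
    "f z = (mixed_partial 1 0 w (snd z) + inverse (fst z) *\<^sub>R axis 1 1,
      mixed_partial 0 1 w (snd z) + inverse (fst z) *\<^sub>R axis 2 1)" for z
  have "negligible (f ` {z. fst z > 0})"
  proof (rule negligible_differentiable_image_lowdim)
    show "f differentiable_on {z. fst z > 0}"
      unfolding differentiable_on_def
    proof
      fix z :: "real \<times> (real^2)" assume z: "z \<in> {z. fst z > 0}"
      have "(\<lambda>z::real \<times> (real^2). fst z) differentiable (at z)"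
        by (rule bounded_linear_imp_differentiable[OF bounded_linear_fst])
      then have i: "(\<lambda>z::real \<times> (real^2). inverse (fst z)) differentiable (at z)"
        using z by (intro differentiable_inverse) auto
      have "f differentiable (at z)"
        unfolding f_def[abs_def]
        by (intro differentiable_Pair differentiable_add differentiable_scaleR differentiable_const i
            differentiable_mixed_partial_snd[OF w3]) auto
      then show "f differentiable (at z within {z. fst z > 0})" by (rule differentiable_at_withinI)
    qed
  qed simp
  then show "negligible {p. \<exists>t x. t > 0 \<and> col1 t (jet (\<lambda>x. w x - quad_field (\<pi> p) x) x) = 0
      \<and> col2 t (jet (\<lambda>x. w x - quad_field (\<pi> p) x) x) = 0}"
  proof (rule negligible_subset, safe)
    fix K L t x assume t: "(t::real) > 0"
      and c: "col1 t (jet (\<lambda>x. w x - quad_field (\<pi> (K, L)) x) x) = 0"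
        "col2 t (jet (\<lambda>x. w x - quad_field (\<pi> (K, L)) x) x) = 0"
    have "axis 1 1 + t *\<^sub>R (mixed_partial 1 0 w x - K) = 0" "axis 2 1 + t *\<^sub>R (mixed_partial 0 1 w x - L) = 0"
      using c unfolding \<pi>_def by (simp_all add: jet_sub_quad_field[OF w3] col1_def col2_def)
    then have "inverse t *\<^sub>R (axis 1 1 + t *\<^sub>R (mixed_partial 1 0 w x - K)) = 0"
      "inverse t *\<^sub>R (axis 2 1 + t *\<^sub>R (mixed_partial 0 1 w x - L)) = 0" by simp_all
    then have "(K, L) = f (t, x)"
      using t by (simp add: f_def scaleR_right_distrib algebra_simps)
    then show "(K, L) \<in> f ` {z. fst z > 0}" using t by force
  qed
  show "\<And>t J. col1 t J = 0 \<and> col2 t J = 0 \<Longrightarrow> det_jet t J = 0" by (simp add: det_jet_def)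
qed

text \<open>With \<open>det_1 = det_2 = 0\<close> the derivative of the three functions has
  determinant \<open>det_t (det_11 det_22 - det_12^2)\<close>. This is zero at a degenerate point,
  so there is a kernel vector \<open>h\<close>.\<close>

lemma degenerate_direction:
  assumes v: "Ck_on 3 v UNIV" and deg: "degenerate t (jet v x)"
  shows "\<exists>h. h \<noteq> 0 \<and> (\<forall>F\<in>{\<lambda>z. det_jet (fst z) (jet v (snd z)), \<lambda>z. det_1 (fst z) (jet v (snd z)),
    \<lambda>z. det_2 (fst z) (jet v (snd z))}. F (t, x) = 0
      \<and> (F has_derivative (\<lambda>h. dir_deriv h F (t, x))) (at (t, x)) \<and> dir_deriv h F (t, x) = 0)"
proof -
  let ?J = "jet v x"
  let ?F0 = "\<lambda>z. det_jet (fst z) (jet v (snd z))" and ?F1 = "\<lambda>z. det_1 (fst z) (jet v (snd z))"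
    and ?F2 = "\<lambda>z. det_2 (fst z) (jet v (snd z))"
  obtain a where a: "(?F1 has_derivative (\<lambda>h. fst h * a + (snd h)$1 * det_11 t ?J + (snd h)$2 * det_12 t ?J)) (at (t, x))"
    using det_jet_derivs(2)[OF v, of "(t, x)"] by auto
  obtain b where b: "(?F2 has_derivative (\<lambda>h. fst h * b + (snd h)$1 * det_12 t ?J + (snd h)$2 * det_22 t ?J)) (at (t, x))"
    using det_jet_derivs(3)[OF v, of "(t, x)"] by auto
  have c: "(?F0 has_derivative (\<lambda>h. fst h * det_t t ?J + (snd h)$1 * det_1 t ?J + (snd h)$2 * det_2 t ?J)) (at (t, x))"
    using det_jet_derivs(1)[OF v, of "(t, x)"] by simp
  have hd: "(F has_derivative (\<lambda>h. dir_deriv h F (t, x))) (at (t, x))" if "F \<in> {?F0, ?F1, ?F2}" for F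
    using that a b c by (intro has_derivative_dir_deriv) (auto simp: differentiable_def)
  have 0: "det_jet t ?J = 0" "det_1 t ?J = 0" "det_2 t ?J = 0"
    and 1: "det_t t ?J = 0 \<or> det_11 t ?J * det_22 t ?J - (det_12 t ?J)\<^sup>2 = 0"
    using deg by (auto simp: degenerate_def)
  have "\<exists>s k l. (s \<noteq> 0 \<or> k \<noteq> 0 \<or> l \<noteq> 0) \<and> s * det_t t ?J = 0 \<and> s * a + k * det_11 t ?J + l * det_12 t ?J = 0
    \<and> s * b + k * det_12 t ?J + l * det_22 t ?J = 0"
  proof -
    define p q r where "p = det_11 t ?J" and "q = det_12 t ?J" and "r = det_22 t ?J"
    show ?thesis
      unfolding p_def[symmetric] q_def[symmetric] r_def[symmetric]
    \<comment> \<open>A singular Hessian has a kernel vector, extended by zero time component.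
      Otherwise \<open>det_t = 0\<close>, and for time component \<open>p * r - q^2\<close> Cramer's
      rule gives the spatial ones.\<close>
    proof (cases "p * r - q\<^sup>2 = 0")
      case True
      show "\<exists>s k l. (s \<noteq> 0 \<or> k \<noteq> 0 \<or> l \<noteq> 0) \<and> s * det_t t ?J = 0 \<and> s * a + k * p + l * q = 0
        \<and> s * b + k * q + l * r = 0"
      proof (cases "p = 0 \<and> q = 0")
        case True
        show ?thesis
        proof (cases "r = 0")
          case True
          with \<open>p = 0 \<and> q = 0\<close> show ?thesis by (intro exI[of _ 0] exI[of _ 1]) simp
        next
          case False
          with \<open>p = 0 \<and> q = 0\<close> show ?thesis by (intro exI[of _ 0] exI[of _ 1]) simp
        qed
      next
        case False
        with True show ?thesis
          by (intro exI[of _ 0] exI[of _ q] exI[of _ "- p"]) (auto simp: power2_eq_square algebra_simps)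
      qed
    next
      case False
      then have "det_t t ?J = 0" using 1 by (simp add: p_def q_def r_def)
      moreover have "(p * r - q\<^sup>2) * a + (b * q - a * r) * p + (a * q - b * p) * q = 0"
        "(p * r - q\<^sup>2) * b + (b * q - a * r) * q + (a * q - b * p) * r = 0"
        by (simp_all add: power2_eq_square algebra_simps)
      ultimately show "\<exists>s k l. (s \<noteq> 0 \<or> k \<noteq> 0 \<or> l \<noteq> 0) \<and> s * det_t t ?J = 0 \<and> s * a + k * p + l * q = 0
        \<and> s * b + k * q + l * r = 0"
        using False by (intro exI[of _ "p * r - q\<^sup>2"] exI[of _ "b * q - a * r"] exI[of _ "a * q - b * p"]) simp
    qed
  qed
  then obtain s k l where skl: "s \<noteq> 0 \<or> k \<noteq> 0 \<or> l \<noteq> 0" "s * det_t t ?J = 0"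
    "s * a + k * det_11 t ?J + l * det_12 t ?J = 0" "s * b + k * det_12 t ?J + l * det_22 t ?J = 0"
    by blast
  let ?h = "(s, vector [k, l]) :: real \<times> (real^2)"
  have "?h \<noteq> 0" using skl(1) by (auto simp: zero_prod_def vec_eq_iff forall_2)
  moreover have "dir_deriv ?h F (t, x) = 0" if "F \<in> {?F0, ?F1, ?F2}" for F
    using that dir_deriv_eqI[OF a, of ?h] dir_deriv_eqI[OF b, of ?h] dir_deriv_eqI[OF c, of ?h] skl 0 by auto
  ultimately show ?thesis using hd 0 by (intro exI[of _ ?h]) auto
qed

text \<open>Both columns change by multiples of one vector \<open>u\<close>. As
  \<open>cross2 u u = 0\<close>, the determinant is affine in the parameters, and the cofactors
  \<open>cross2 u (col2 t J)\<close> and \<open>cross2 (col1 t J) u\<close> do not feel the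
  perturbation. The second family exchanges the coordinates and the columns.\<close>

lemma negligible_degenerate_parameters:
  assumes w: "Ck_on 3 w UNIV"
  shows "negligible {p::real^4. \<exists>t x. t > 0 \<and> (let J = jet (\<lambda>x. w x - quad_field (p$1 *\<^sub>R u, p$2 *\<^sub>R u, p$3 *\<^sub>R u, p$4 *\<^sub>R u, 0) x) x
      in degenerate t J \<and> cross2 u (col2 t J) \<noteq> 0)}" (is "negligible ?B1")
    and "negligible {p::real^4. \<exists>t x. t > 0 \<and> (let J = jet (\<lambda>x. w x - quad_field (p$2 *\<^sub>R u, p$1 *\<^sub>R u, 0, p$4 *\<^sub>R u, p$3 *\<^sub>R u) x) x
      in degenerate t J \<and> cross2 (col1 t J) u \<noteq> 0)}" (is "negligible ?B2")
proof -
  define A A1 A2 where "A z = det_jet (fst z) (jet w (snd z))" and "A1 z = det_1 (fst z) (jet w (snd z))"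
    and "A2 z = det_2 (fst z) (jet w (snd z))" for z
  define c c1 c2 where "c z = cross2 u (col2 (fst z) (jet w (snd z)))"
    and "c1 z = fst z * cross2 u (mixed_partial 1 1 w (snd z))"
    and "c2 z = fst z * cross2 u (mixed_partial 0 2 w (snd z))" for z
  define e e1 e2 where "e z = cross2 (col1 (fst z) (jet w (snd z))) u"
    and "e1 z = fst z * cross2 (mixed_partial 2 0 w (snd z)) u"
    and "e2 z = fst z * cross2 (mixed_partial 1 1 w (snd z)) u" for z
  have t: "(\<lambda>z::real \<times> (real^2). fst z) differentiable (at z)" for z
    by (rule bounded_linear_imp_differentiable[OF bounded_linear_fst])
  note dm = differentiable_mixed_partial_snd[OF w] and dc = differentiable_cross2
  have col: "(\<lambda>z. col1 (fst z) (jet w (snd z))) differentiable (at z)"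
    "(\<lambda>z. col2 (fst z) (jet w (snd z))) differentiable (at z)" for z
    unfolding col1_def col2_def jet_def prod.case
    by (intro differentiable_add differentiable_scaleR differentiable_const t dm; simp)+
  have diff: "f differentiable (at z)" if "f \<in> {A, A1, A2, c, c1, c2, e, e1, e2}" for f z
  proof -
    have "A differentiable (at z)" "A1 differentiable (at z)" "A2 differentiable (at z)"
      using det_jet_derivs(1-3)[OF w, of z] unfolding A_def[abs_def] A1_def[abs_def] A2_def[abs_def]
      by (auto simp: differentiable_def)
    moreover have "c differentiable (at z)" "e differentiable (at z)"
      unfolding c_def[abs_def] e_def[abs_def] by (intro dc col differentiable_const)+
    moreover have "c1 differentiable (at z)" "c2 differentiable (at z)" "e1 differentiable (at z)" "e2 differentiable (at z)"
      unfolding c1_def[abs_def] c2_def[abs_def] e1_def[abs_def] e2_def[abs_def]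
      by (intro differentiable_mult t dc differentiable_const dm; simp)+
    ultimately show ?thesis using that by blast
  qed
  note defs = A_def A1_def A2_def c_def c1_def c2_def e_def e1_def e2_def
  have sub: "Ck_on 3 (\<lambda>x. w x - quad_field q x) UNIV" for q
    by (intro Ck_on_sub w Ck_on_quad_field open_UNIV)
  have i12: "(1::2) \<noteq> 2" "(2::2) \<noteq> 1" by simp_all
  define v1 where "v1 p = (\<lambda>x. w x - quad_field (p$1 *\<^sub>R u, p$2 *\<^sub>R u, p$3 *\<^sub>R u, p$4 *\<^sub>R u, 0) x)" for p :: "real^4"
  have jet1: "jet (v1 p) x =
    (mixed_partial 1 0 w x - (p$1 *\<^sub>R u + x$1 *\<^sub>R p$3 *\<^sub>R u + x$2 *\<^sub>R p$4 *\<^sub>R u),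
     mixed_partial 0 1 w x - (p$2 *\<^sub>R u + x$1 *\<^sub>R p$4 *\<^sub>R u + x$2 *\<^sub>R 0),
     mixed_partial 2 0 w x - p$3 *\<^sub>R u, mixed_partial 1 1 w x - p$4 *\<^sub>R u, mixed_partial 0 2 w x - 0,
     mixed_partial 3 0 w x, mixed_partial 2 1 w x, mixed_partial 1 2 w x, mixed_partial 0 3 w x)" for p x
    unfolding v1_def by (rule jet_sub_quad_field[OF w])
  have N1: "negligible {p. \<exists>z h. fst z > 0 \<and> c z \<noteq> 0 \<and> h \<noteq> 0 \<and>
    (\<forall>f\<in>{\<lambda>z. det_jet (fst z) (jet (v1 p) (snd z)), \<lambda>z. det_1 (fst z) (jet (v1 p) (snd z)),
      \<lambda>z. det_2 (fst z) (jet (v1 p) (snd z))}. f z = 0 \<and> (f has_derivative (\<lambda>h. dir_deriv h f z)) (at z) \<and> dir_deriv h f z = 0)}"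
    (is "negligible ?S1")
    by (rule negligible_singular_parameters[of A A1 A2 c c1 c2 e e1 e2 1 2, OF diff i12(1)])
      (unfold defs jet1, simp_all add: jet_def det_jet_defs cross2_def algebra_simps)
  have c111: "cross2 u (col2 t (jet (v1 p) x)) = c (t, x)" for p t x
    unfolding defs jet1 by (simp add: jet_def col2_def cross2_def algebra_simps)
  show "negligible ?B1"
  proof (rule negligible_subset[OF N1], rule subsetI)
    fix p assume "p \<in> ?B1"
    then obtain t x where tx: "t > 0" "degenerate t (jet (v1 p) x)" "c (t, x) \<noteq> 0"
      unfolding v1_def[symmetric] Let_def c111 by blast
    have "Ck_on 3 (v1 p) UNIV" unfolding v1_def by (rule sub)
    from degenerate_direction[OF this tx(2)] obtain h where h: "h \<noteq> 0"
      "\<forall>f\<in>{\<lambda>z. det_jet (fst z) (jet (v1 p) (snd z)), \<lambda>z. det_1 (fst z) (jet (v1 p) (snd z)),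
        \<lambda>z. det_2 (fst z) (jet (v1 p) (snd z))}. f (t, x) = 0
        \<and> (f has_derivative (\<lambda>h. dir_deriv h f (t, x))) (at (t, x)) \<and> dir_deriv h f (t, x) = 0" by blast
    have "fst (t, x) > 0" using tx(1) by simp
    with tx(3) h show "p \<in> ?S1" by blast
  qed
  define v2 where "v2 p = (\<lambda>x. w x - quad_field (p$2 *\<^sub>R u, p$1 *\<^sub>R u, 0, p$4 *\<^sub>R u, p$3 *\<^sub>R u) x)" for p :: "real^4"
  have jet2: "jet (v2 p) x =
    (mixed_partial 1 0 w x - (p$2 *\<^sub>R u + x$1 *\<^sub>R 0 + x$2 *\<^sub>R p$4 *\<^sub>R u),
     mixed_partial 0 1 w x - (p$1 *\<^sub>R u + x$1 *\<^sub>R p$4 *\<^sub>R u + x$2 *\<^sub>R p$3 *\<^sub>R u),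
     mixed_partial 2 0 w x - 0, mixed_partial 1 1 w x - p$4 *\<^sub>R u, mixed_partial 0 2 w x - p$3 *\<^sub>R u,
     mixed_partial 3 0 w x, mixed_partial 2 1 w x, mixed_partial 1 2 w x, mixed_partial 0 3 w x)" for p x
    unfolding v2_def by (rule jet_sub_quad_field[OF w])
  have diff': "f differentiable (at z)" if "f \<in> {A, A2, A1, e, e2, e1, c, c2, c1}" for f z
    using diff[of f z] that by blast
  have N2: "negligible {p. \<exists>z h. fst z > 0 \<and> e z \<noteq> 0 \<and> h \<noteq> 0 \<and>
    (\<forall>f\<in>{\<lambda>z. det_jet (fst z) (jet (v2 p) (snd z)), \<lambda>z. det_2 (fst z) (jet (v2 p) (snd z)),
      \<lambda>z. det_1 (fst z) (jet (v2 p) (snd z))}. f z = 0 \<and> (f has_derivative (\<lambda>h. dir_deriv h f z)) (at z) \<and> dir_deriv h f z = 0)}"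
    (is "negligible ?S2")
    by (rule negligible_singular_parameters[of A A2 A1 e e2 e1 c c2 c1 2 1, OF diff' i12(2)])
      (unfold defs jet2, simp_all add: jet_def det_jet_defs cross2_def algebra_simps)
  have c222: "cross2 (col1 t (jet (v2 p) x)) u = e (t, x)" for p t x
    unfolding defs jet2 by (simp add: jet_def col1_def cross2_def algebra_simps)
  show "negligible ?B2"
  proof (rule negligible_subset[OF N2], rule subsetI)
    fix p assume "p \<in> ?B2"
    then obtain t x where tx: "t > 0" "degenerate t (jet (v2 p) x)" "e (t, x) \<noteq> 0"
      unfolding v2_def[symmetric] Let_def c222 by blast
    have "Ck_on 3 (v2 p) UNIV" unfolding v2_def by (rule sub)
    from degenerate_direction[OF this tx(2)] obtain h where h: "h \<noteq> 0"
      "\<forall>f\<in>{\<lambda>z. det_jet (fst z) (jet (v2 p) (snd z)), \<lambda>z. det_1 (fst z) (jet (v2 p) (snd z)),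
        \<lambda>z. det_2 (fst z) (jet (v2 p) (snd z))}. f (t, x) = 0
        \<and> (f has_derivative (\<lambda>h. dir_deriv h f (t, x))) (at (t, x)) \<and> dir_deriv h f (t, x) = 0" by blast
    have "fst (t, x) > 0" using tx(1) by simp
    \<comment> \<open>\<open>?S2\<close> lists \<open>det_2\<close> before \<open>det_1\<close>
      because the coordinates are exchanged.\<close>
    with tx(3) h(1) h(2)[unfolded insert_commute[of "\<lambda>z. det_1 (fst z) (jet (v2 p) (snd z))"]]
    show "p \<in> ?S2" by blast
  qed
qed

section \<open>Density\<close>

definition dominant_degeneracy :: "2 \<Rightarrow> 2 \<Rightarrow> real \<Rightarrow> jet \<Rightarrow> bool" where
  "dominant_degeneracy i j t J \<longleftrightarrow> degenerate t J \<and> dominant i j t J"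

lemma dominant_degeneracy_det: "dominant_degeneracy i j t J \<Longrightarrow> det_jet t J = 0"
  by (simp add: dominant_degeneracy_def degenerate_def)

lemma openin_generic_dominant:
  "T > 0 \<Longrightarrow> openin C3_0_topology (generic T (dominant_degeneracy i j))"
  using openin_generic[of T "dominant_degeneracy i j"] closed_degenerate_dominant[of i j] dominant_degeneracy_det
  unfolding dominant_degeneracy_def by blast

lemma dominant_entry_nonzero:
  assumes "dominant i j t J" "\<not> (col1 t J = 0 \<and> col2 t J = 0)"
  shows "(if j = 1 then col1 t J else col2 t J) $ i \<noteq> 0"
proof
  assume "(if j = 1 then col1 t J else col2 t J) $ i = 0"
  with assms(1) have "\<forall>k. \<bar>col1 t J $ k\<bar> \<le> 0" "\<forall>k. \<bar>col2 t J $ k\<bar> \<le> 0"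
    unfolding dominant_def by simp_all
  with assms(2) show False by (simp add: vec_eq_iff)
qed

text \<open>The other coordinate vector works: pairing with it returns \<open>v$i\<close> up to
  sign.\<close>

lemma cross2_axis_nonzero: "\<exists>u. \<forall>v. v$i \<noteq> 0 \<longrightarrow> cross2 u v \<noteq> 0 \<and> cross2 v u \<noteq> 0"
  by (rule exI[of _ "axis (if i = 1 then 2 else 1) 1"])
    (use exhaust_2[of i] in \<open>auto simp: cross2_def axis_def\<close>)

text \<open>Two perturbations: the first makes the matrix nonzero everywhere, an open property; the
  second removes the degenerate points and is small enough to preserve that property.\<close>

lemma approximation_dominant:
  assumes T: "T > 0" and w: "w \<in> C3_0" and eps: "\<epsilon> > 0"
  shows "\<exists>v\<in>generic T (dominant_degeneracy i j). C3_dist v w < \<epsilon>"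
proof -
  interpret Metric_space C3_0 C3_dist by (rule Metric_space_C3_0)
  define V where "V = generic T (\<lambda>t J. col1 t J = 0 \<and> col2 t J = 0)"
  obtain v where v: "v \<in> V" "C3_dist v w < \<epsilon> / 2"
    using approximation_cols_nonzero[OF T w, of "\<epsilon> / 2"] eps unfolding V_def by auto
  have v0: "v \<in> C3_0" using v(1) by (simp add: V_def generic_def)
  have v3: "Ck_on 3 v UNIV" using v0 by (simp add: C3_0_def C3_def)
  have "openin mtopology V"
    using openin_generic[OF T closed_cols_0] unfolding V_def C3_0_topology_def by (simp add: det_jet_def)
  then obtain r where r: "r > 0" "mball v r \<subseteq> V"
    using v(1) unfolding openin_mtopology by blast
  \<comment> \<open>The extra conjunct makes the dominant entry nonzero. It costs nothing, since the
    final field stays in \<open>V\<close>.\<close>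
  define P where "P t J \<longleftrightarrow> dominant_degeneracy i j t J \<and> \<not> (col1 t J = 0 \<and> col2 t J = 0)" for t J
  obtain u where u: "\<And>x. x$i \<noteq> 0 \<Longrightarrow> cross2 u x \<noteq> 0" "\<And>x. x$i \<noteq> 0 \<Longrightarrow> cross2 x u \<noteq> 0"
    using cross2_axis_nonzero[of i] by blast
  \<comment> \<open>The cofactor to divide by belongs to the other column, so \<open>p$1\<close>,
    \<open>p$3\<close> and \<open>p$4\<close> act on the column that does not contain the dominant
    entry.\<close>
  define \<pi> :: "real^4 \<Rightarrow> quad" where "\<pi> p = (if j = 1
    then (p$2 *\<^sub>R u, p$1 *\<^sub>R u, 0, p$4 *\<^sub>R u, p$3 *\<^sub>R u) else (p$1 *\<^sub>R u, p$2 *\<^sub>R u, p$3 *\<^sub>R u, p$4 *\<^sub>R u, 0))" for p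
  have P_imp: "degenerate t J" "j = 1 \<Longrightarrow> cross2 (col1 t J) u \<noteq> 0" "j \<noteq> 1 \<Longrightarrow> cross2 u (col2 t J) \<noteq> 0"
    if "P t J" for t J
    using that dominant_entry_nonzero[of i j t J] u[of "col1 t J"] u[of "col2 t J"]
    unfolding P_def dominant_degeneracy_def by (auto split: if_splits)
  have "bounded_linear \<pi>"
    unfolding \<pi>_def by (cases "j = 1")
      (simp_all add: bounded_linear_Pair bounded_linear_scaleR_const bounded_linear_vec_nth bounded_linear_zero)
  moreover have "negligible {p. \<exists>t x. t > 0 \<and> P t (jet (\<lambda>x. v x - quad_field (\<pi> p) x) x)}"
  proof (cases "j = 1")
    case True
    show ?thesis
      by (rule negligible_subset[OF negligible_degenerate_parameters(2)[OF v3, of u]])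
        (use True P_imp(1,2) in \<open>unfold \<pi>_def Let_def, simp only: simp_thms if_True if_False, blast\<close>)
  next
    case False
    show ?thesis
      by (rule negligible_subset[OF negligible_degenerate_parameters(1)[OF v3, of u]])
        (use False P_imp(1,3) in \<open>unfold \<pi>_def Let_def, simp only: simp_thms if_True if_False, blast\<close>)
  qed
  moreover have "P t J \<Longrightarrow> det_jet t J = 0" for t J unfolding P_def using dominant_degeneracy_det by blast
  moreover have "min (\<epsilon> / 2) r > 0" using eps r by simp
  ultimately obtain v' where v': "v' \<in> generic T P" "C3_dist v' v < min (\<epsilon> / 2) r"
    using generic_approximation[OF T v0, of "min (\<epsilon> / 2) r" P \<pi>] by blast
  have v'0: "v' \<in> C3_0" using v'(1) by (simp add: generic_def)
  have "v' \<in> V" using r(2) v'(2) v0 v'0 by (auto simp: mball_def commute)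
  with v'(1) have "v' \<in> generic T (dominant_degeneracy i j)"
    by (auto simp: generic_def V_def P_def)
  moreover have "C3_dist v' w < \<epsilon>"
    using triangle[OF v'0 v0 w] v(2) v'(2) by simp
  ultimately show ?thesis by blast
qed

lemma topspace_C3_0: "topspace C3_0_topology = C3_0"
  unfolding C3_0_topology_def by (simp add: Metric_space.topspace_mtopology[OF Metric_space_C3_0])

lemma dense_generic_dominant:
  assumes T: "T > 0"
  shows "C3_0_topology closure_of generic T (dominant_degeneracy i j) = topspace C3_0_topology"
proof -
  interpret Metric_space C3_0 C3_dist by (rule Metric_space_C3_0)
  have "\<exists>v\<in>generic T (dominant_degeneracy i j). v \<in> mball w r" if "w \<in> C3_0" "r > 0" for w r
    using approximation_dominant[OF T that, of i j] that by (auto simp: generic_def mball_def commute)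
  then show ?thesis
    unfolding topspace_C3_0 unfolding C3_0_topology_def metric_closure_of by auto
qed

text \<open>A nonempty open set meets \<open>A\<close> in a nonempty open set, which in turn meets
  \<open>B\<close>.\<close>

lemma dense_Int_open:
  assumes "openin X A" "X closure_of A = topspace X" "X closure_of B = topspace X"
  shows "X closure_of (A \<inter> B) = topspace X"
  using assms unfolding dense_intersects_open by (metis Int_assoc inf_commute openin_Int)

theorem theorem5p1:
  fixes T :: real
  assumes "T > 0"
  shows "\<exists>F. openin C3_0_topology F \<and> C3_0_topology closure_of F = C3_0 \<and>
    (\<forall>w\<in>F.
       embedded_submanifold 2 2 (S1 T w) \<and>
       finite {p \<in> S1 T w. perpendicular_to_t_axis (S1 T w) p} \<and>
       (\<forall>p\<in>S1 T w. perpendicular_to_t_axis (S1 T w) p \<longrightarrow>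
          (\<exists>\<tau>. local_graph_at (S1 T w) p \<tau>) \<and>
          (\<forall>\<tau>. local_graph_at (S1 T w) p \<tau> \<longrightarrow> rank (hessian \<tau> (snd p)) = 2) \<and>
          (\<exists>c. c \<noteq> 0 \<and> eigenvalue (flow_jacobian w p) c)))"
proof -
  define U where "U i j = generic T (dominant_degeneracy i j)" for i j
  define F where "F = U 1 1 \<inter> (U 1 2 \<inter> (U 2 1 \<inter> U 2 2))"
  have U: "openin C3_0_topology (U i j)" "C3_0_topology closure_of U i j = topspace C3_0_topology" for i j
    using openin_generic_dominant dense_generic_dominant assms unfolding U_def by blast+
  have "openin C3_0_topology F" unfolding F_def by (intro openin_Int U)
  moreover have "C3_0_topology closure_of F = C3_0"
    unfolding F_def topspace_C3_0[symmetric] by (intro dense_Int_open U openin_Int)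
  moreover have nd: "nondegenerate_flow T w" if w: "w \<in> F" for w
  proof
    show "T > 0" "w \<in> C3_0" using assms w by (simp_all add: F_def U_def generic_def)
    fix t x assume t: "0 \<le> t" "t \<le> T"
    \<comment> \<open>A degenerate point would be caught by the condition belonging to its largest
      entry.\<close>
    obtain i j where ij: "dominant i j t (jet w x)" using exists_dominant by blast
    have "w \<in> U i j" using w exhaust_2[of i] exhaust_2[of j] by (auto simp: F_def)
    then show "\<not> degenerate t (jet w x)"
      using t ij by (auto simp: U_def generic_def dominant_degeneracy_def)
  qed
  ultimately show ?thesis
    by (intro exI[of _ F] conjI ballI allI impI nondegenerate_flow.embedded_submanifold_S1[OF nd]
        nondegenerate_flow.finite_perpendicular[OF nd] nondegenerate_flow.perpendicular_local_graph[OF nd]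
        nondegenerate_flow.perpendicular_hessian[OF nd] nondegenerate_flow.perpendicular_eigenvalue[OF nd])
qed

end
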